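(* Let $\Bbbk$ be a field and let $Q=\Bbbk[[x,y,z]]$ be the power series algebra in three variables over $\Bbbk$. For every integer $r\ge 3$ there is a quotient ring of $Q$ that is of class $\mathbf{G}(r)$ and is not Gorenstein.
   Context: Let $(Q,\mathfrak n,\Bbbk)$ be a regular local ring and let $\mathfrak a\subseteq\mathfrak n^2$ be an ideal such that $R=Q/\mathfrak a$ has projective dimension $3$ as a $Q$-module. Let $K^R$ be the Koszul complex over $R$ on a minimal set of generators of the maximal ideal $\mathfrak n/\mathfrak a$ of $R$, and let $A=\mathrm{H}(K^R)$ be its homology algebra, a graded-commutative $\Bbbk$-algebra, isomorphic to $\mathrm{Tor}^Q_*(R,\Bbbk)$, with $A_i=0$ for $i\ge 4$. Let $\mu(\mathfrak a)$ be the minimal number of generators of $\mathfrak a$ and let $\mathrm{type}(R)=\mathrm{rank}_\Bbbk(A_3)$. For $r\ge 2$, the ring $R=Q/\mathfrak a$ (with $\mathfrak a\subseteq\mathfrak n^2$ an ideal such that $Q/\mathfrak a$ has projective dimension $3$ as a $Q$-module) is of class $\mathbf{G}(r)$ if, with $n=\mu(\mathfrak a)$ and $t=\mathrm{type}(R)$, there are $\Bbbk$-bases $\mathbf e_1,\dots,\mathbf e_n$ of $A_1$, $\mathbf f_1,\dots,\mathbf f_{n+t-1}$ of $A_2$, and $\mathbf g_1,\dots,\mathbf g_t$ of $A_3$ such that the only non-zero products of basis elements of positive degree are $\mathbf e_i\mathbf f_i=\mathbf g_1=-\mathbf f_i\mathbf e_i$ for $1\le i\le r$. In this case $r$ is the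 rank of the canonical map $\delta\colon A_2\to\mathrm{Hom}_\Bbbk(A_1,A_3)$ induced by multiplication.
   Formalization: In the definition of class G(r) the printed products e_i f_i = g_1 = -f_i e_i are corrected to e_i f_i = g_1 = f_i e_i, since graded-commutativity in degrees 1 and 2 makes the printed sign impossible unless the field has characteristic 2. *)

theory Defs
  imports
    "HOL-Algebra.Algebra"
    "HOL-Algebra.Algebraic_Closure_Type"
    "HOL-Computational_Algebra.Formal_Power_Series"
    "HOL-Library.Extended_Nat"
    "HOL-Library.FuncSet"
begin

subsection \<open>Power series, local rings, generators\<close>

text \<open>Three-variable power series are iterated one-variable ones:
  $k[[x,y,z]] = k[[x]][[y]][[z]]$.\<close>

definition power_series_3 :: "'k::field fps fps fps ring" where
  "power_series_3 = ring_of_type_algebra"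

definition local_ring :: "('a, 'b) ring_scheme \<Rightarrow> bool" where
  "local_ring R \<longleftrightarrow> cring R \<and> (\<exists>!m. maximalideal m R)"

definition max_ideal :: "('a, 'b) ring_scheme \<Rightarrow> 'a set" where
  "max_ideal R = (THE m. maximalideal m R)"

definition min_num_gens :: "('a, 'b) ring_scheme \<Rightarrow> 'a set \<Rightarrow> nat" where
  "min_num_gens R I =
     (LEAST n. \<exists>S. S \<subseteq> carrier R \<and> finite S \<and> card S = n \<and> genideal R S = I)"

definition min_gen_list :: "('a, 'b) ring_scheme \<Rightarrow> 'a set \<Rightarrow> 'a list \<Rightarrow> bool" where
  "min_gen_list R I xs \<longleftrightarrow>
     set xs \<subseteq> carrier R \<and> distinct xs \<and> genideal R (set xs) = I \<and>
     (\<forall>S. S \<subset> set xs \<longrightarrow> genideal R S \<noteq> I)"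


subsection \<open>Projective and injective dimension\<close>

definition mod_hom ::
  "('a, 'c) ring_scheme \<Rightarrow> ('a, 'm) module \<Rightarrow> ('a, 'n) module \<Rightarrow> ('m \<Rightarrow> 'n) set" where
  "mod_hom R M N =
     {f \<in> hom (add_monoid M) (add_monoid N).
        \<forall>c\<in>carrier R. \<forall>x\<in>carrier M. f (c \<odot>\<^bsub>M\<^esub> x) = c \<odot>\<^bsub>N\<^esub> f x}"

text \<open>Since HOL cannot quantify over types inside a formula, all test modules and all terms of
  resolutions over a ring with elements of type \<open>'a\<close> have carriers in the type \<open>nat \<Rightarrow> 'a\<close>; up to
  isomorphism these are all modules of cardinality at most $|{\tt 'a}|^{\aleph_0}$.  For a nonzero
  ring this class contains the ring, all its ideals and all countably generated modules, and it is
  closed under submodules, quotients and free covers; over a noetherian ring it is also closed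
  under injective hulls (Baer's construction).  So projectivity and injectivity tested inside the
  class are the usual notions, and for finitely generated modules over noetherian rings the
  projective and injective dimensions below are the usual ones.\<close>

type_synonym 'a umodule = "('a, nat \<Rightarrow> 'a) module"

definition projective_module :: "('a, 'c) ring_scheme \<Rightarrow> 'a umodule \<Rightarrow> bool" where
  "projective_module R P \<longleftrightarrow> module R P \<and>
     (\<forall>(L :: 'a umodule) (N :: 'a umodule) p f.
        module R L \<and> module R N \<and>
        p \<in> mod_hom R L N \<and> p ` carrier L = carrier N \<and> f \<in> mod_hom R P N \<longrightarrow>
        (\<exists>g \<in> mod_hom R P L. \<forall>x\<in>carrier P. p (g x) = f x))"

definition injective_module :: "('a, 'c) ring_scheme \<Rightarrow> 'a umodule \<Rightarrow> bool" where
  "injective_module R E \<longleftrightarrow> module R E \<and>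
     (\<forall>(N :: 'a umodule) (L :: 'a umodule) j f.
        module R N \<and> module R L \<and>
        j \<in> mod_hom R N L \<and> inj_on j (carrier N) \<and> f \<in> mod_hom R N E \<longrightarrow>
        (\<exists>g \<in> mod_hom R L E. \<forall>x\<in>carrier N. g (j x) = f x))"

text \<open>$\cdots \to P_2 \to P_1 \to P_0 \to M \to 0$, where \<open>d i\<close> maps \<open>P (Suc i)\<close> to \<open>P i\<close>.\<close>

definition projective_resolution ::
  "('a, 'c) ring_scheme \<Rightarrow> ('a, 'm) module \<Rightarrow>
   (nat \<Rightarrow> 'a umodule) \<Rightarrow> (nat \<Rightarrow> (nat \<Rightarrow> 'a) \<Rightarrow> (nat \<Rightarrow> 'a)) \<Rightarrow> ((nat \<Rightarrow> 'a) \<Rightarrow> 'm) \<Rightarrow> bool" where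
  "projective_resolution R M P d \<epsilon> \<longleftrightarrow>
     (\<forall>i. projective_module R (P i)) \<and>
     (\<forall>i. d i \<in> mod_hom R (P (Suc i)) (P i)) \<and>
     \<epsilon> \<in> mod_hom R (P 0) M \<and>
     \<epsilon> ` carrier (P 0) = carrier M \<and>
     d 0 ` carrier (P 1) = {x \<in> carrier (P 0). \<epsilon> x = \<zero>\<^bsub>M\<^esub>} \<and>
     (\<forall>i. d (Suc i) ` carrier (P (Suc (Suc i))) =
           {x \<in> carrier (P (Suc i)). d i x = \<zero>\<^bsub>P i\<^esub>})"

definition proj_dim :: "('a, 'c) ring_scheme \<Rightarrow> ('a, 'm) module \<Rightarrow> enat" where
  "proj_dim R M =
     Inf {enat n | n. \<exists>P d \<epsilon>. projective_resolution R M P d \<epsilon> \<and>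
                              (\<forall>i>n. carrier (P i) = {\<zero>\<^bsub>P i\<^esub>})}"

text \<open>$0 \to M \to E_0 \to E_1 \to E_2 \to \cdots$, where \<open>d i\<close> maps \<open>E i\<close> to \<open>E (Suc i)\<close>.\<close>

definition injective_resolution ::
  "('a, 'c) ring_scheme \<Rightarrow> ('a, 'm) module \<Rightarrow>
   (nat \<Rightarrow> 'a umodule) \<Rightarrow> (nat \<Rightarrow> (nat \<Rightarrow> 'a) \<Rightarrow> (nat \<Rightarrow> 'a)) \<Rightarrow> ('m \<Rightarrow> (nat \<Rightarrow> 'a)) \<Rightarrow> bool" where
  "injective_resolution R M E d \<eta> \<longleftrightarrow>
     (\<forall>i. injective_module R (E i)) \<and>
     (\<forall>i. d i \<in> mod_hom R (E i) (E (Suc i))) \<and>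
     \<eta> \<in> mod_hom R M (E 0) \<and>
     inj_on \<eta> (carrier M) \<and>
     \<eta> ` carrier M = {x \<in> carrier (E 0). d 0 x = \<zero>\<^bsub>E 1\<^esub>} \<and>
     (\<forall>i. d i ` carrier (E i) =
           {x \<in> carrier (E (Suc i)). d (Suc i) x = \<zero>\<^bsub>E (Suc (Suc i))\<^esub>})"

definition inj_dim :: "('a, 'c) ring_scheme \<Rightarrow> ('a, 'm) module \<Rightarrow> enat" where
  "inj_dim R M =
     Inf {enat n | n. \<exists>E d \<eta>. injective_resolution R M E d \<eta> \<and>
                              (\<forall>i>n. carrier (E i) = {\<zero>\<^bsub>E i\<^esub>})}"

definition regular_module :: "('a, 'c) ring_scheme \<Rightarrow> ('a, 'a) module" where
  "regular_module R =
     \<lparr>carrier = carrier R, monoid.mult = monoid.mult R, one = \<one>\<^bsub>R\<^esub>,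
      ring.zero = \<zero>\<^bsub>R\<^esub>, add = add R, module.smult = monoid.mult R\<rparr>"

definition quotient_module :: "('a, 'c) ring_scheme \<Rightarrow> 'a set \<Rightarrow> ('a, 'a set) module" where
  "quotient_module Q I =
     \<lparr>carrier = carrier (Q Quot I), monoid.mult = monoid.mult (Q Quot I), one = \<one>\<^bsub>Q Quot I\<^esub>,
      ring.zero = \<zero>\<^bsub>Q Quot I\<^esub>, add = add (Q Quot I),
      module.smult = (\<lambda>c B. (I +>\<^bsub>Q\<^esub> c) \<otimes>\<^bsub>Q Quot I\<^esub> B)\<rparr>"

definition gorenstein_local_ring :: "('a, 'c) ring_scheme \<Rightarrow> bool" where
  "gorenstein_local_ring R \<longleftrightarrow>
     noetherian_ring R \<and> local_ring R \<and> inj_dim R (regular_module R) < \<infinity>"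


subsection \<open>Koszul homology\<close>

text \<open>The Koszul complex on $x_0,\dots,x_{n-1}$ is the exterior algebra on a basis
  $e_0,\dots,e_{n-1}$ of $R^n$.  The function \<open>v\<close> stands for $\sum_S v(S)\,e_S$, where
  $e_S = e_{s_1} \wedge \dots \wedge e_{s_p}$ for $S = \{s_1 < \dots < s_p\}$.  Then
  $e_S \wedge e_T = {\rm sign}(S,T)\, e_{S\cup T}$ for disjoint $S$ and $T$, and
  $\partial(e_S) = \sum_{i\in S} {\rm sign}(\{i\},S\setminus\{i\})\, x_i\, e_{S\setminus\{i\}}$.\<close>

definition koszul_sign :: "('a, 'c) ring_scheme \<Rightarrow> nat set \<Rightarrow> nat set \<Rightarrow> 'a" where
  "koszul_sign R S T = (\<ominus>\<^bsub>R\<^esub> \<one>\<^bsub>R\<^esub>) [^]\<^bsub>R\<^esub> card {(i, j). i \<in> S \<and> j \<in> T \<and> j < i}"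

definition koszul_algebra :: "('a, 'c) ring_scheme \<Rightarrow> nat \<Rightarrow> (nat set \<Rightarrow> 'a) ring" where
  "koszul_algebra R n =
     \<lparr>carrier = (Pow {..<n} \<rightarrow>\<^sub>E carrier R),
      monoid.mult = (\<lambda>u v. \<lambda>U\<in>Pow {..<n}.
        \<Oplus>\<^bsub>R\<^esub>S\<in>Pow U. koszul_sign R S (U - S) \<otimes>\<^bsub>R\<^esub> (u S \<otimes>\<^bsub>R\<^esub> v (U - S))),
      one = (\<lambda>U\<in>Pow {..<n}. if U = {} then \<one>\<^bsub>R\<^esub> else \<zero>\<^bsub>R\<^esub>),
      ring.zero = (\<lambda>U\<in>Pow {..<n}. \<zero>\<^bsub>R\<^esub>),
      add = (\<lambda>u v. \<lambda>U\<in>Pow {..<n}. u U \<oplus>\<^bsub>R\<^esub> v U)\<rparr>"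

definition koszul_diff ::
  "('a, 'c) ring_scheme \<Rightarrow> 'a list \<Rightarrow> (nat set \<Rightarrow> 'a) \<Rightarrow> (nat set \<Rightarrow> 'a)" where
  "koszul_diff R xs v = (\<lambda>T\<in>Pow {..<length xs}.
     \<Oplus>\<^bsub>R\<^esub>i\<in>{..<length xs} - T. koszul_sign R {i} T \<otimes>\<^bsub>R\<^esub> (xs ! i \<otimes>\<^bsub>R\<^esub> v (insert i T)))"

definition koszul_cycles :: "('a, 'c) ring_scheme \<Rightarrow> 'a list \<Rightarrow> (nat set \<Rightarrow> 'a) set" where
  "koszul_cycles R xs =
     {v \<in> carrier (koszul_algebra R (length xs)).
        koszul_diff R xs v = \<zero>\<^bsub>koszul_algebra R (length xs)\<^esub>}"

definition koszul_boundaries :: "('a, 'c) ring_scheme \<Rightarrow> 'a list \<Rightarrow> (nat set \<Rightarrow> 'a) set" where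
  "koszul_boundaries R xs = koszul_diff R xs ` carrier (koszul_algebra R (length xs))"

definition koszul_homology ::
  "('a, 'c) ring_scheme \<Rightarrow> 'a list \<Rightarrow> (nat set \<Rightarrow> 'a) set ring" where
  "koszul_homology R xs =
     ((koszul_algebra R (length xs))\<lparr>carrier := koszul_cycles R xs\<rparr>)
       Quot (koszul_boundaries R xs)"

definition koszul_homology_deg ::
  "('a, 'c) ring_scheme \<Rightarrow> 'a list \<Rightarrow> nat \<Rightarrow> (nat set \<Rightarrow> 'a) set set" where
  "koszul_homology_deg R xs p =
     {koszul_boundaries R xs +>\<^bsub>koszul_algebra R (length xs)\<^esub> z | z.
        z \<in> koszul_cycles R xs \<and>
        (\<forall>S. S \<subseteq> {..<length xs} \<and> card S \<noteq> p \<longrightarrow> z S = \<zero>\<^bsub>R\<^esub>)}"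


subsection \<open>The class $\mathbf{G}(r)$\<close>

text \<open>When \<open>xs\<close> generates the maximal ideal of the local ring \<open>R\<close>, the subring $A_0$ of
  $A = {\rm H}(K^R)$ is the residue field of \<open>R\<close>, so the vector space structure of $A$ is
  multiplication by elements of $A_0$.\<close>

definition homology_basis ::
  "('a, 'c) ring_scheme \<Rightarrow> 'a list \<Rightarrow> nat \<Rightarrow> (nat set \<Rightarrow> 'a) set list \<Rightarrow> bool" where
  "homology_basis R xs p bs \<longleftrightarrow>
     ring.independent (koszul_homology R xs) (koszul_homology_deg R xs 0) bs \<and>
     ring.Span (koszul_homology R xs) (koszul_homology_deg R xs 0) bs = koszul_homology_deg R xs p"

text \<open>Basis elements are indexed from 0.  As $A$ is graded-commutative and
  $|e_i|\,|f_i| = 2$ is even, $f_i e_i = e_i f_i$ (with the sign $+$).\<close>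

definition class_G :: "('a, 'c) ring_scheme \<Rightarrow> 'a set \<Rightarrow> nat \<Rightarrow> bool" where
  "class_G Q I r \<longleftrightarrow>
     2 \<le> r \<and> ideal I Q \<and> I \<subseteq> max_ideal Q \<cdot>\<^bsub>Q\<^esub> max_ideal Q \<and>
     proj_dim Q (quotient_module Q I) = 3 \<and>
     (\<exists>xs. min_gen_list (Q Quot I) (max_ideal (Q Quot I)) xs \<and>
       (let A = koszul_homology (Q Quot I) xs;
            basis = homology_basis (Q Quot I) xs;
            n = min_num_gens Q I;
            t = ring.dim A (koszul_homology_deg (Q Quot I) xs 0) (koszul_homology_deg (Q Quot I) xs 3)
        in \<exists>es fs gs.
             basis 1 es \<and> basis 2 fs \<and> basis 3 gs \<and>
             length es = n \<and> length fs + 1 = n + t \<and> length gs = t \<and>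
             r \<le> length es \<and> r \<le> length fs \<and> 1 \<le> length gs \<and>
             (\<forall>u \<in> set (es @ fs @ gs). \<forall>v \<in> set (es @ fs @ gs).
                u \<otimes>\<^bsub>A\<^esub> v =
                  (if \<exists>i<r. (u = es ! i \<and> v = fs ! i) \<or> (u = fs ! i \<and> v = es ! i)
                   then gs ! 0 else \<zero>\<^bsub>A\<^esub>))))"

end

theory Submission
  imports Defs "HOL-Library.Function_Algebras"
begin

text \<open>With the Chebyshev polynomials $U_{-1} = 0$, $U_0 = 1$, $U_{b+1} = y U_b - x z U_{b-1}$, the elements
  $x^a z^c U_b$ form a topological basis of $Q$ with dual functionals $L_{abc}$. Multiplication by
  $x$, $y$, $z$ acts on these functionals by lowering the degree of the triple, so the common kernel of
  the $L_{abc}$ over an order ideal of triples is an ideal. The order ideal $a + b < k$, $b + c < k$ gives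
  a Gorenstein ideal $g$ with the $2k + 1$ generators $x^w U_{k-w}$, $z^w U_{k-w}$ ($0 \le w \le k$) and
  socle generator $s = (xz)^{k-1}$. Adding the triple of one generator $\sigma$, either $x^k$ or
  $x^{k-1} U_1$, gives the ideal $I$ in which $\sigma$ is trimmed to its multiples by $x$, $y$, $z$.
  The socle of $R = Q/I$ is spanned by $\sigma$ and $s$, so $R$ has type 2, and explicit Koszul cycles
  pair to $s$ as required for class $G(r)$ with $r = 2k - 2$ or $r = 2k - 3$. There are no further
  classes in $A_2$, since a cycle with vanishing pairings is congruent to a multiple of $(x, y, z)$
  modulo $g$.

  Adding triples in order of degree, one at a time, builds $R$ by extensions by the residue field, so
  horseshoes with the Koszul complex produce a free resolution of length 3. A shorter one is impossible
  because $s$ gives a nonzero class in $\mathrm{Tor}_3$.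

  Suppose that $R$ has a finite injective resolution $E$. In high degrees $n$, for every ideal
  $J \supseteq I$, each $n$-cocycle killed by $J$ is the differential of an element killed by $J$.
  As $0 \to \Bbbk \to R \to Q/g \to 0$ is exact, this property passes from $g$ in degree $n+1$ to
  the maximal ideal in degree $n$, and then to $g$ in degree $n$ by extensions. In the lowest degree it
  yields $c \in R$ with $\sigma c = s$, which is impossible.\<close>

text \<open>\<open>U_b\<close> is the determinant of a tridiagonal matrix with \<open>y\<close> on
  the diagonal and \<open>x z\<close> as the product of opposite off-diagonal entries. Give
  \<open>x\<close>, \<open>y\<close>, \<open>z\<close> the weights 1, 0, -1. The generators of
  \<open>g\<close> are then indexed by their weight \<open>w\<close> from \<open>-k\<close> to
  \<open>k\<close>, and the Chebyshev recurrence becomes the three-term syzygies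
  \<open>x P(w-1) - y P(w) + z P(w+1) = 0\<close>, up to signs and without the \<open>y\<close> term
  for \<open>w = 0\<close>. The \<open>w\<close>-th syzygy gives a cycle \<open>f_w\<close> over
  \<open>Q/g\<close>, which pairs to \<open>s\<close> only with the class \<open>e_(-w)\<close> of a
  generator.

  Trimming the generator of weight \<open>j\<close> destroys the cycles whose syzygy involves
  \<open>P(j)\<close>, namely \<open>f_(j-1)\<close>, \<open>f_j\<close>, \<open>f_(j+1)\<close>,
  and leaves \<open>f_(-j)\<close> without a partner. At the end \<open>j = k\<close> of the range
  there is no \<open>f_(k+1)\<close>, so \<open>2k + 1 - 3\<close> pairs remain; for
  \<open>j = k - 1\<close> there remain \<open>2k + 1 - 4\<close>. Hence the two choices of
  \<sigma>: they give both parities of \<open>r\<close>.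

  All data are explicit and have integer coefficients, so the field is arbitrary, and membership in
  the ideals is the vanishing of finitely many functionals.\<close>

type_synonym 'k ps3 = "'k fps fps fps"

section \<open>Coordinates on k[[x,y,z]] and division by the variables\<close>

definition cst :: "'k::field \<Rightarrow> 'k ps3" where
  "cst r = fps_const (fps_const (fps_const r))"

definition vX :: "'k::field ps3" where "vX = fps_const (fps_const fps_X)"
definition vY :: "'k::field ps3" where "vY = fps_const fps_X"
definition vZ :: "'k::field ps3" where "vZ = fps_X"

abbreviation ct :: "'k::field ps3 \<Rightarrow> 'k" where "ct f \<equiv> f $ 0 $ 0 $ 0"

lemma cst_mult_nth [simp]: "(cst r * f) $ c $ b $ a = r * f $ c $ b $ a"
  by (simp add: cst_def)

lemma vX_mult_nth [simp]: "(vX * f) $ c $ b $ a = (if a = 0 then 0 else f $ c $ b $ (a - 1))"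
  by (simp add: vX_def)

lemma vY_mult_nth [simp]: "(vY * f) $ c $ b $ a = (if b = 0 then 0 else f $ c $ (b - 1) $ a)"
  by (simp add: vY_def)

lemma vZ_mult_nth [simp]: "(vZ * f) $ c $ b $ a = (if c = 0 then 0 else f $ (c - 1) $ b $ a)"
  by (simp add: vZ_def)

lemma ps3_eqI: "(\<And>a b c. f $ c $ b $ a = g $ c $ b $ a) \<Longrightarrow> f = (g :: 'k::field ps3)"
  by (simp add: fps_eq_iff)

lemma cst_0 [simp]: "cst 0 = 0" and cst_1 [simp]: "cst 1 = 1"
  and cst_add: "cst (r + s) = cst r + cst s"
  and cst_mult: "cst (r * s) = cst r * cst s"
  and cst_minus: "cst (- r) = - cst r"
  and ct_cst [simp]: "ct (cst r) = r"
  by (simp_all add: cst_def flip: fps_const_add fps_const_mult fps_const_neg)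

lemma ct_v [simp]: "ct vX = 0" "ct vY = 0" "ct vZ = 0" "vZ $ 0 = 0" "vY $ 0 $ 0 = 0"
  by (simp_all add: vX_def vY_def vZ_def)

text \<open>Division in the maximal ideal: monomials containing z go to \<open>dZ\<close>, of the
  others those containing y to \<open>dY\<close>, and the powers of x to \<open>dX\<close>. This
  choice is linear over the field, which \<open>duality\<close> exploits.\<close>

definition dX :: "'k::field ps3 \<Rightarrow> 'k ps3" where
  "dX f = fps_const (fps_const (fps_shift 1 (f $ 0 $ 0)))"
definition dY :: "'k::field ps3 \<Rightarrow> 'k ps3" where
  "dY f = fps_const (fps_shift 1 (f $ 0))"
definition dZ :: "'k::field ps3 \<Rightarrow> 'k ps3" where
  "dZ f = fps_shift 1 f"

lemma d_nth [simp]: "dX f $ c $ b $ a = (if c = 0 \<and> b = 0 then f $ 0 $ 0 $ Suc a else 0)"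
  "dY f $ c $ b $ a = (if c = 0 then f $ 0 $ Suc b $ a else 0)"
  "dZ f $ c $ b $ a = f $ Suc c $ b $ a"
  by (simp_all add: dX_def dY_def dZ_def)

lemma cst_nth [simp]: "cst r $ c $ b $ a = (if a = 0 \<and> b = 0 \<and> c = 0 then r else 0)"
  by (simp add: cst_def)

lemma ps3_decomp: "f = cst (ct f) + vX * dX f + vY * dY f + vZ * dZ f"
  by (rule ps3_eqI) (auto simp del: fps_mult_nth_0 fps_mult_nth_1')

lemma ps3_decomp0: "ct f = 0 \<Longrightarrow> f = vX * dX f + vY * dY f + vZ * dZ f"
  using ps3_decomp[of f] by simp

lemma d_add: "dX (f + g) = dX f + dX g" "dY (f + g) = dY f + dY g" "dZ (f + g) = dZ f + dZ g"
  by (rule ps3_eqI, simp)+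

lemma d_cst_mult: "dX (cst r * f) = cst r * dX f" "dY (cst r * f) = cst r * dY f"
  "dZ (cst r * f) = cst r * dZ f"
  by (rule ps3_eqI, simp del: fps_mult_nth_0 fps_mult_nth_1')+

text \<open>Inverts one variable at a time: each right inverse is the inverse of the constant term
  that the next level asks for.\<close>

lemma ps3_unit: assumes "ct f \<noteq> 0" shows "\<exists>g. f * g = (1 :: 'k::field ps3)"
proof -
  have "f $ 0 $ 0 * inverse (f $ 0 $ 0) = 1"
    using assms by (simp add: inverse_mult_eq_1')
  then have "f $ 0 * fps_right_inverse (f $ 0) (inverse (f $ 0 $ 0)) = 1"
    by (rule fps_right_inverse)
  then have "f * fps_right_inverse f (fps_right_inverse (f $ 0) (inverse (f $ 0 $ 0))) = 1"
    by (rule fps_right_inverse)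
  then show ?thesis by blast
qed

lemma vXYZ_nz [simp]: "vX \<noteq> 0" "vY \<noteq> 0" "vZ \<noteq> 0"
  by (simp_all add: vX_def vY_def vZ_def)

subsection \<open>Exactness of the Koszul complex\<close>

lemma in_vX: assumes "\<And>b c. f $ c $ b $ 0 = 0" shows "\<exists>g. f = vX * g"
proof -
  have "f = vX * Abs_fps (\<lambda>c. Abs_fps (\<lambda>b. fps_shift 1 (f $ c $ b)))"
    by (rule ps3_eqI) (use assms in simp)
  then show ?thesis by blast
qed

lemma in_vXY: assumes "\<And>c. f $ c $ 0 $ 0 = 0" shows "\<exists>g h. f = vX * g + vY * h"
proof -
  have "f = vX * Abs_fps (\<lambda>c. fps_const (fps_shift 1 (f $ c $ 0))) + vY * Abs_fps (\<lambda>c. fps_shift 1 (f $ c))"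
    by (rule ps3_eqI) (use assms in simp)
  then show ?thesis by blast
qed

text \<open>The coefficients of the relation that are free of x and y show that \<open>c\<close>
  lies in (x, y). Substituting leaves a relation between x and y alone, whose x-free coefficients
  put the second entry into (x); the first entry follows by cancelling x.\<close>

lemma koszul_exact1:
  assumes "vX * a + vY * b + vZ * c = 0"
  shows "\<exists>u v w. a = vY * w - vZ * v \<and> b = vZ * u - vX * w \<and> c = vX * v - vY * (u :: 'k::field ps3)"
proof -
  have "c $ n $ 0 $ 0 = 0" for n
    using arg_cong[OF assms, of "\<lambda>f. f $ Suc n $ 0 $ 0"] by simp
  from in_vXY[OF this] obtain v u' where c: "c = vX * v + vY * u'" by blast
  have "vX * (a + vZ * v) + vY * (b + vZ * u') = 0"
    using assms unfolding c by (simp add: algebra_simps)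
  note 1 = this
  have "(b + vZ * u') $ n $ m $ 0 = 0" for n m
    using arg_cong[OF 1, of "\<lambda>f. f $ n $ Suc m $ 0"] by simp
  from in_vX[OF this] obtain w where b: "b + vZ * u' = vX * w" by blast
  have "vX * (a + vZ * v + vY * w) = 0" using 1 unfolding b by (simp add: algebra_simps)
  then have a: "a + vZ * v + vY * w = 0" by simp
  have "a = vY * (- w) - vZ * v" 
  proof -
    have "a = (a + vZ * v + vY * w) - vZ * v - vY * w" by simp
    then show ?thesis unfolding a by simp
  qed
  moreover have "b = vZ * (- u') - vX * (- w)" using b by (simp add: eq_diff_eq flip: b)
  moreover have "c = vX * v - vY * (- u')" using c by simp
  ultimately show ?thesis by blast
qed

text \<open>By the last equation x divides \<open>a\<close>; cancelling x in the last two equations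
  gives the other entries.\<close>

lemma koszul_exact2:
  assumes "vY * c - vZ * b = 0" "vZ * a - vX * c = 0" "vX * b - vY * a = 0"
  shows "\<exists>q. a = vX * q \<and> b = vY * q \<and> c = vZ * (q :: 'k::field ps3)"
proof -
  have "a $ n $ m $ 0 = 0" for n m
    using arg_cong[OF assms(3), of "\<lambda>f. f $ n $ Suc m $ 0"] by simp
  from in_vX[OF this] obtain q where q: "a = vX * q" by blast
  have "vX * (b - vY * q) = 0" "vX * (c - vZ * q) = 0"
    using assms(2,3) unfolding q by (simp_all add: algebra_simps)
  with q show ?thesis by auto
qed

subsection \<open>Chebyshev polynomials and their dual functionals\<close>

text \<open>\<open>ball b j\<close> is the coefficient of $(xz)^j U_b$ in $y^{b+2j}$, a ballot number.\<close>

fun ball :: "nat \<Rightarrow> nat \<Rightarrow> nat" where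
  "ball b 0 = 1"
| "ball 0 (Suc j) = ball 1 j"
| "ball (Suc b) (Suc j) = ball b (Suc j) + ball (Suc (Suc b)) j"

text \<open>The coefficient of x^a z^c U_b: when y^(b+2j) is expanded, the monomial x^(a-j) z^(c-j)
  y^(b+2j) contributes \<open>ball b j\<close>. The sum is finite, so the functional is defined on
  every power series.\<close>

definition L :: "nat \<Rightarrow> nat \<Rightarrow> nat \<Rightarrow> 'k::field ps3 \<Rightarrow> 'k" where
  "L a b c f = (\<Sum>j\<le>min a c. of_nat (ball b j) * f $ (c - j) $ (b + 2 * j) $ (a - j))"

lemma L_add [simp]: "L a b c (f + g) = L a b c f + L a b c g"
  by (simp add: L_def algebra_simps sum.distrib)
lemma L_0 [simp]: "L a b c 0 = 0"
  by (simp add: L_def)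
lemma L_minus [simp]: "L a b c (- f) = - L a b c f"
  by (simp add: L_def sum_negf)
lemma L_diff [simp]: "L a b c (f - g) = L a b c f - L a b c g"
  by (simp add: L_def algebra_simps sum_subtractf)
lemma L_cst [simp]: "L a b c (cst r * f) = r * L a b c f"
  by (simp add: L_def sum_distrib_left mult.left_commute)
lemma L_sum [simp]: "L a b c (sum f A) = (\<Sum>i\<in>A. L a b c (f i))"
  by (induct A rule: infinite_finite_induct) auto
lemma L_000 [simp]: "L 0 0 0 f = ct f"
  by (simp add: L_def)

lemma L_X [simp]: "L a b c (vX * f) = (if a = 0 then 0 else L (a - 1) b c f)"
proof (cases a)
  case 0 then show ?thesis by (simp add: L_def)
next
  case (Suc a')
  show ?thesis
  proof (cases "c \<le> a'")
    case True
    then have "min a c = min a' c" using Suc by auto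
    then show ?thesis using Suc True by (auto simp: L_def intro!: sum.cong)
  next
    case False
    then have "min a c = Suc a'" "min a' c = a'" using Suc by auto
    then show ?thesis using Suc by (auto simp: L_def Suc_diff_le intro!: sum.cong)
  qed
qed

lemma L_Z [simp]: "L a b c (vZ * f) = (if c = 0 then 0 else L a b (c - 1) f)"
proof (cases c)
  case 0 then show ?thesis by (simp add: L_def)
next
  case (Suc c')
  show ?thesis
  proof (cases "a \<le> c'")
    case True
    then have "min a c = min a c'" using Suc by auto
    then show ?thesis using Suc True by (auto simp: L_def intro!: sum.cong)
  next
    case False
    then have "min a c = Suc c'" "min a c' = c'" using Suc by auto
    then show ?thesis using Suc by (auto simp: L_def Suc_diff_le intro!: sum.cong)
  qed
qed

text \<open>The transpose of y U_b = U_(b+1) + x z U_(b-1): the coefficient of y f at (a, b, c)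
  comes from (a, b-1, c) and from (a-1, b+1, c-1). Both have degree one less, as for
  \<open>L_X\<close> and \<open>L_Z\<close>.\<close>

lemma L_Y [simp]: "L a b c (vY * f) = (if b = 0 then 0 else L a (b - 1) c f)
    + (if a = 0 \<or> c = 0 then 0 else L (a - 1) (Suc b) (c - 1) f)"
proof (cases "min a c")
  case 0
  then show ?thesis by (auto simp: L_def)
next
  case (Suc m)
  then have m: "min (a - 1) (c - 1) = m" "a \<noteq> 0" "c \<noteq> 0" by auto
  show ?thesis
  proof (cases b)
    case 0
    have "L a b c (vY * f) = (\<Sum>j\<le>m. of_nat (ball 0 (Suc j)) * f $ (c - Suc j) $ (2 * Suc j - 1) $ (a - Suc j))"
      unfolding L_def Suc sum.atMost_Suc_shift using 0 by simp
    also have "\<dots> = L (a - 1) 1 (c - 1) f"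
      unfolding L_def m by simp
    finally show ?thesis using 0 m by simp
  next
    case (Suc b')
    \<comment> \<open>Splitting off \<open>j = 0\<close> leaves the values of \<open>ball\<close> to
      which its recursion applies.\<close>
    have "L a b c (vY * f) = f $ c $ b' $ a
       + (\<Sum>j\<le>m. of_nat (ball b (Suc j)) * f $ (c - Suc j) $ (b' + 2 * Suc j) $ (a - Suc j))"
      unfolding L_def \<open>min a c = Suc m\<close> sum.atMost_Suc_shift using Suc by simp
    also have "\<dots> = (f $ c $ b' $ a
       + (\<Sum>j\<le>m. of_nat (ball b' (Suc j)) * f $ (c - Suc j) $ (b' + 2 * Suc j) $ (a - Suc j)))
       + (\<Sum>j\<le>m. of_nat (ball (Suc b) j) * f $ (c - 1 - j) $ (Suc b + 2 * j) $ (a - 1 - j))"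
      using Suc by (simp add: algebra_simps sum.distrib)
    also have "\<dots> = L a b' c f + L (a - 1) (Suc b) (c - 1) f"
      unfolding L_def \<open>min a c = Suc m\<close> m sum.atMost_Suc_shift by simp
    finally show ?thesis using Suc m by simp
  qed
qed

text \<open>\<open>V (Suc b)\<close> is the Chebyshev polynomial $U_b$.\<close>

fun V :: "nat \<Rightarrow> 'k::field ps3" where
  "V 0 = 0"
| "V (Suc 0) = 1"
| "V (Suc (Suc n)) = vY * V (Suc n) - vX * (vZ * V n)"

lemma Y_V: "vY * V (Suc n) = V (Suc (Suc n)) + vX * (vZ * V n)"
  by simp

declare V.simps(3) [simp del]

lemma V_2 [simp]: "V (Suc (Suc 0)) = vY"
  by (simp add: V.simps(3))

lemma L_one: "L a b c (1 :: 'k::field ps3) = (if a = 0 \<and> b = 0 \<and> c = 0 then 1 else 0)"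
proof -
  have "L a b c (1 :: 'k ps3) = (\<Sum>j\<le>min a c. if j = 0 then (if a = 0 \<and> b = 0 \<and> c = 0 then 1 else 0) else 0)"
    unfolding L_def by (rule sum.cong) auto
  then show ?thesis by simp
qed

lemma L_V: "L a b c (V (Suc n) :: 'k::field ps3) = (if a = 0 \<and> b = n \<and> c = 0 then 1 else 0)"
proof (induct n arbitrary: a b c rule: less_induct)
  case (less n)
  consider "n = 0" | "n = 1" | m where "n = Suc (Suc m)" by (metis One_nat_def not0_implies_Suc)
  then show ?case
  proof cases
    case 1 then show ?thesis by (simp add: L_one)
  next
    case 2
    have "V (Suc n) = (vY * 1 :: 'k ps3)" using 2 by (simp add: V.simps(3))
    also have "L a b c \<dots> = (if a = 0 \<and> b = n \<and> c = 0 then 1 else 0)"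
      by (subst L_Y) (auto simp: L_one 2)
    finally show ?thesis .
  next
    case 3
    show ?thesis unfolding 3 V.simps(3)[of "Suc m"] by (auto simp: less 3)
  qed
qed

text \<open>The transpose of multiplication by U_b, applied to a functional with middle index 0,
  obeys the recurrence of U_b and so arrives at middle index b alone. This is the source of the
  nondegenerate form on Q/g.\<close>

lemma L_V_mult: "L A 0 C (V (Suc b) * f) = (if b \<le> A \<and> b \<le> C then L (A - b) b (C - b) f else 0)"
proof (induct b arbitrary: A C f rule: less_induct)
  case (less b)
  consider "b = 0" | "b = 1" | m where "b = Suc (Suc m)" by (metis One_nat_def not0_implies_Suc)
  then show ?case
  proof cases
    case 1 then show ?thesis by simp
  next
    case 2 then show ?thesis by (auto simp: V.simps(3))
  next
    case 3
    have "V (Suc b) * f = V (Suc (Suc m)) * (vY * f) - vX * (vZ * (V (Suc m) * f))"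
      unfolding 3 V.simps(3)[of "Suc m"] by (simp add: algebra_simps)
    also have "L A 0 C \<dots> = L A 0 C (V (Suc (Suc m)) * (vY * f)) - L A 0 C (vX * (vZ * (V (Suc m) * f)))"
      by simp
    also have "L A 0 C (V (Suc (Suc m)) * (vY * f)) = (if Suc m \<le> A \<and> Suc m \<le> C then L (A - Suc m) (Suc m) (C - Suc m) (vY * f) else 0)"
      by (rule less) (simp add: 3)
    also have "L A 0 C (vX * (vZ * (V (Suc m) * f))) = (if A = 0 \<or> C = 0 then 0 else
       if m \<le> A - 1 \<and> m \<le> C - 1 then L (A - 1 - m) m (C - 1 - m) f else 0)"
      using less[of m "A - 1" "C - 1" f] by (simp add: 3)
    finally show ?thesis unfolding 3 by auto
  qed
qed

lemma L_Xpow [simp]: "L a b c (vX ^ i * f) = (if i \<le> a then L (a - i) b c f else 0)"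
  by (induct i arbitrary: a) (auto simp: mult.assoc)
lemma L_Zpow [simp]: "L a b c (vZ ^ i * f) = (if i \<le> c then L a b (c - i) f else 0)"
  by (induct i arbitrary: c) (auto simp: mult.assoc)

definition W :: "nat \<Rightarrow> nat \<Rightarrow> nat \<Rightarrow> 'k::field ps3" where
  "W a b c = vX ^ a * (vZ ^ c * V (Suc b))"

lemma L_W: "L a b c (W a' b' c') = (if a = a' \<and> b = b' \<and> c = c' then 1 else 0)"
  by (auto simp: W_def L_V)

lemma X_W: "vX * W a b c = W (Suc a) b c" by (simp add: W_def mult.assoc)
lemma Z_W: "vZ * W a b c = W a b (Suc c)" by (simp add: W_def algebra_simps)
lemma Y_W: "vY * W a b c = W a (Suc b) c + (if b = 0 then 0 else W (Suc a) (b - 1) (Suc c))"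
proof -
  have "vY * W a b c = vX ^ a * (vZ ^ c * (vY * V (Suc b)))" by (simp add: W_def algebra_simps)
  then show ?thesis by (cases b) (simp_all add: Y_V W_def algebra_simps)
qed

text \<open>The first factor is the basis element complementary to (a, b, c) for the socle form. The
  natural subtractions are genuine because a + b < k and b + c < k, the conditions that define
  \<open>LamG k\<close>.\<close>

lemma phi_W: assumes "a + b < k" "b + c < k"
  shows "L (k - 1) 0 (k - 1) (W (k - 1 - a - b) b (k - 1 - b - c) * f) = L a b c f"
proof -
  have *: "W (k - 1 - a - b) b (k - 1 - b - c) * f
      = vX ^ (k - 1 - a - b) * (vZ ^ (k - 1 - b - c) * (V (Suc b) * f))" by (simp only: W_def mult.assoc)
  show ?thesis unfolding * L_Xpow L_Zpow L_V_mult using assms by auto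
qed

definition ordge :: "nat \<Rightarrow> 'k::field ps3 \<Rightarrow> bool" where
  "ordge d f \<longleftrightarrow> (\<forall>a b c. a + b + c < d \<longrightarrow> f $ c $ b $ a = 0)"

lemma ordge_L: "ordge d f \<Longrightarrow> a + b + c < d \<Longrightarrow> L a b c f = 0"
  unfolding L_def by (rule sum.neutral) (auto simp: ordge_def)

text \<open>In a fixed degree the functionals are unitriangular in the coefficients:
  \<open>L a b c f\<close> is the coefficient at (a, b, c) plus terms with smaller exponent of
  x.\<close>

lemma L_ordge: assumes "\<And>a b c. a + b + c < d \<Longrightarrow> L a b c f = 0" shows "ordge d f"
  unfolding ordge_def
proof (intro allI impI)
  fix a b c :: nat assume "a + b + c < d"
  then show "f $ c $ b $ a = 0"
  proof (induct a arbitrary: b c rule: less_induct)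
    case (less a)
    have "L a b c f = (\<Sum>j\<le>min a c. if j = 0 then f $ c $ b $ a else 0)"
      unfolding L_def using less by (intro sum.cong) auto
    then show ?case using assms[OF less(2)] by simp
  qed
qed

lemma ordge_L_iff: "ordge d f \<longleftrightarrow> (\<forall>a b c. a + b + c < d \<longrightarrow> L a b c f = 0)"
  using ordge_L L_ordge by blast

subsection \<open>Order ideals\<close>

fun LT :: "nat \<times> nat \<times> nat \<Rightarrow> 'k::field ps3 \<Rightarrow> 'k" where "LT (a, b, c) f = L a b c f"
fun WT :: "nat \<times> nat \<times> nat \<Rightarrow> 'k::field ps3" where "WT (a, b, c) = W a b c"
fun tdeg :: "nat \<times> nat \<times> nat \<Rightarrow> nat" where "tdeg (a, b, c) = a + b + c"

lemma LT_add [simp]: "LT l (f + g) = LT l f + LT l g"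
  and LT_diff [simp]: "LT l (f - g) = LT l f - LT l g"
  and LT_minus [simp]: "LT l (- f) = - LT l f"
  and LT_0 [simp]: "LT l 0 = 0"
  and LT_cst [simp]: "LT l (cst r * f) = r * LT l f"
  and LT_sum [simp]: "LT l (sum F A) = (\<Sum>i\<in>A. LT l (F i))"
  by (cases l; simp)+

lemma LT_WT: "LT l (WT m) = (if l = m then 1 else 0)"
  by (cases l; cases m) (simp add: L_W)

text \<open>The moves by which multiplication by a variable shifts a functional; the last one is the
  second term of \<open>L_Y\<close>.\<close>

definition order_closed :: "(nat \<times> nat \<times> nat) set \<Rightarrow> bool" where
  "order_closed A \<longleftrightarrow> (\<forall>a b c. (a, b, c) \<in> A \<longrightarrow>
     (a > 0 \<longrightarrow> (a - 1, b, c) \<in> A) \<and> (c > 0 \<longrightarrow> (a, b, c - 1) \<in> A) \<and>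
     (b > 0 \<longrightarrow> (a, b - 1, c) \<in> A) \<and> (a > 0 \<and> c > 0 \<longrightarrow> (a - 1, Suc b, c - 1) \<in> A))"

definition IL :: "(nat \<times> nat \<times> nat) set \<Rightarrow> 'k::field ps3 set" where
  "IL A = {f. \<forall>l\<in>A. LT l f = 0}"

lemma IL_add: "f \<in> IL A \<Longrightarrow> g \<in> IL A \<Longrightarrow> f + g \<in> IL A"
  and IL_diff: "f \<in> IL A \<Longrightarrow> g \<in> IL A \<Longrightarrow> f - g \<in> IL A"
  and IL_minus: "f \<in> IL A \<Longrightarrow> - f \<in> IL A"
  and IL_0 [simp]: "0 \<in> IL A"
  and IL_sum: "(\<And>i. i \<in> B \<Longrightarrow> F i \<in> IL A) \<Longrightarrow> sum F B \<in> IL A"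
  by (auto simp: IL_def)

text \<open>Apart from its constant term, \<open>h\<close> is a combination of the variables, and
  each variable turns a functional of the order ideal into functionals of smaller degree in the same
  order ideal. The cofactors change along the way, so the induction on the degree generalises over
  \<open>h\<close>.\<close>

lemma IL_mult: assumes A: "order_closed A" and f: "f \<in> IL A" shows "h * f \<in> IL A"
proof -
  have "L a b c (h * f) = 0" if "(a, b, c) \<in> A" for a b c h
    using that
  proof (induct "a + b + c" arbitrary: a b c h rule: less_induct)
    case less
    have L0: "L a b c f = 0" using less(2) f by (force simp: IL_def)
    have "h * f = (cst (ct h) + vX * dX h + vY * dY h + vZ * dZ h) * f"
      using ps3_decomp[of h] by simp
    also have "\<dots> = cst (ct h) * f + vX * (dX h * f) + vY * (dY h * f) + vZ * (dZ h * f)"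
      by (simp add: algebra_simps)
    also have "L a b c \<dots> = 0"
      using A less(2) L0 by (auto simp: order_closed_def less(1))
    finally show ?case .
  qed
  then show ?thesis by (auto simp: IL_def)
qed

lemma IL_mult': "order_closed A \<Longrightarrow> f \<in> IL A \<Longrightarrow> f * h \<in> IL A"
  using IL_mult by (metis mult.commute)

lemma ps3_mult_in_IL:
  assumes "order_closed A" "ct h = 0" "vX * f \<in> IL A" "vY * f \<in> IL A" "vZ * f \<in> IL A"
  shows "h * f \<in> IL A"
proof -
  have "h * f = (vX * dX h + vY * dY h + vZ * dZ h) * f" using ps3_decomp0[OF assms(2)] by simp
  then have "h * f = dX h * (vX * f) + dY h * (vY * f) + dZ h * (vZ * f)" by (simp add: algebra_simps)
  then show ?thesis using assms by (auto intro!: IL_add IL_mult)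
qed

lemma vX_WT: "vX * WT (a, b, c) = WT (Suc a, b, c)"
  and vZ_WT: "vZ * WT (a, b, c) = WT (a, b, Suc c)"
  and vY_WT: "vY * WT (a, b, c) = WT (a, Suc b, c) + (if b = 0 then 0 else WT (Suc a, b - 1, Suc c))"
  by (simp_all add: X_W Y_W Z_W)

lemma WT_in_IL: "m \<notin> A \<Longrightarrow> WT m \<in> IL A"
  by (auto simp: IL_def LT_WT)

text \<open>A variable times \<open>WT m\<close> is a sum of basis elements of larger degree, whose
  triples lie outside \<open>A\<close>. For \<open>m\<close> in \<open>A\<close> the class of
  \<open>WT m\<close> therefore spans a copy of the residue field.\<close>

lemma top_WT_mult:
  assumes "order_closed A" "\<And>l. l \<in> A \<Longrightarrow> tdeg l \<le> tdeg m" "ct h = 0"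
  shows "h * WT m \<in> IL A"
proof (cases m)
  case (fields a b c)
  have *: "tdeg l > tdeg m \<Longrightarrow> WT l \<in> IL A" for l :: "nat \<times> nat \<times> nat"
    using assms(2)[of l] by (intro WT_in_IL) auto
  show ?thesis unfolding fields
    by (rule ps3_mult_in_IL[OF assms(1,3)])
      (auto simp only: vX_WT vY_WT vZ_WT fields intro!: IL_add * split: if_splits, auto simp: fields)
qed

lemma IL_remove:
  assumes "f \<in> IL (A - {m})" shows "f - cst (LT m f) * WT m \<in> IL A"
  using assms by (auto simp: IL_def LT_WT)

lemma IL_expand:
  assumes "finite A" shows "f - (\<Sum>l\<in>A. cst (LT l f) * WT l) \<in> IL A"
proof -
  have "(\<Sum>i\<in>A. LT i f * LT l (WT i)) = LT l f" if "l \<in> A" for l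
    using assms that by (simp add: LT_WT if_distrib cong: if_cong)
  then show ?thesis by (simp add: IL_def)
qed

lemma order_closed_remove:
  assumes "order_closed A" "\<And>l. l \<in> A \<Longrightarrow> tdeg l \<le> tdeg m"
  shows "order_closed (A - {m})"
  unfolding order_closed_def
proof (intro allI impI)
  fix a b c assume 1: "(a, b, c) \<in> A - {m}"
  have 2: "a + b + c \<le> tdeg m" using assms(2) 1 by force
  show "(a > 0 \<longrightarrow> (a - 1, b, c) \<in> A - {m}) \<and> (c > 0 \<longrightarrow> (a, b, c - 1) \<in> A - {m}) \<and>
     (b > 0 \<longrightarrow> (a, b - 1, c) \<in> A - {m}) \<and> (a > 0 \<and> c > 0 \<longrightarrow> (a - 1, Suc b, c - 1) \<in> A - {m})"
    using 1 2 assms(1) by (auto simp: order_closed_def)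
qed

text \<open>Removing a triple of maximal degree keeps the set an order ideal and splits off one
  residue field. Both the free resolutions and the vanishing of Ext are obtained along this
  filtration.\<close>

lemma order_closed_induct [consumes 2, case_names empty remove]:
  assumes "finite A" "order_closed A" and "P {}"
    and step: "\<And>A m. finite A \<Longrightarrow> order_closed A \<Longrightarrow> m \<in> A \<Longrightarrow> order_closed (A - {m}) \<Longrightarrow>
      (\<And>l. l \<in> A \<Longrightarrow> tdeg l \<le> tdeg m) \<Longrightarrow> P (A - {m}) \<Longrightarrow> P A"
  shows "P A"
  using assms(1,2)
proof (induct "card A" arbitrary: A)
  case 0 then show ?case using assms(3) by simp
next
  case (Suc n)
  then have ne: "A \<noteq> {}" by auto
  have "Max (tdeg ` A) \<in> tdeg ` A" using Suc(3) ne by (intro Max_in) auto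
  then obtain m where "m \<in> A" "tdeg m = Max (tdeg ` A)" by auto
  then have m: "m \<in> A" "\<And>l. l \<in> A \<Longrightarrow> tdeg l \<le> tdeg m"
    using Suc(3) by auto
  have oc: "order_closed (A - {m})" by (rule order_closed_remove[OF Suc(4) m(2)])
  show ?case
    by (rule step[OF Suc(3,4) m(1) oc m(2)]) (use Suc m(1) oc in auto)
qed

subsection \<open>Rings of a type class as carriers\<close>

abbreviation TA :: "'a::comm_ring_1 ring" where "TA \<equiv> ring_of_type_algebra"

lemma TA_simps [simp]: "carrier TA = UNIV" "monoid.mult TA = (*)" "one TA = 1" "ring.zero TA = 0" "add TA = (+)"
  by (auto simp: ring_of_type_algebra_def fun_eq_iff)

lemma TA_cring: "cring (TA :: 'a::comm_ring_1 ring)" and TA_ring: "ring (TA :: 'a::comm_ring_1 ring)"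
  by (rule cring_from_type_algebra, rule ring_from_type_algebra)

lemma TA_a_inv [simp]: "\<ominus>\<^bsub>TA\<^esub> x = - (x :: 'a::comm_ring_1)"
proof -
  interpret cring "TA :: 'a ring" by (rule TA_cring)
  show ?thesis by (rule minus_equality) auto
qed

definition tideal :: "'a::comm_ring_1 set \<Rightarrow> bool" where
  "tideal I \<longleftrightarrow> 0 \<in> I \<and> (\<forall>a\<in>I. \<forall>b\<in>I. a + b \<in> I) \<and> (\<forall>a\<in>I. \<forall>h. h * a \<in> I)"

lemma tidealD: assumes "tideal I"
  shows "0 \<in> I" "a \<in> I \<Longrightarrow> b \<in> I \<Longrightarrow> a + b \<in> I" "a \<in> I \<Longrightarrow> h * a \<in> I" "a \<in> I \<Longrightarrow> a * h \<in> I"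
    "a \<in> I \<Longrightarrow> - a \<in> I" "a \<in> I \<Longrightarrow> b \<in> I \<Longrightarrow> a - b \<in> I"
proof -
  show 1: "0 \<in> I" "a \<in> I \<Longrightarrow> b \<in> I \<Longrightarrow> a + b \<in> I" "a \<in> I \<Longrightarrow> h * a \<in> I" for a b h
    using assms by (auto simp: tideal_def)
  show "a \<in> I \<Longrightarrow> a * h \<in> I" using 1(3)[of a h] by (simp add: mult.commute)
  show 2: "a \<in> I \<Longrightarrow> - a \<in> I" for a using 1(3)[of a "-1"] by simp
  show "a \<in> I \<Longrightarrow> b \<in> I \<Longrightarrow> a - b \<in> I" using 1(2)[of a "- b"] 2[of b] by simp
qed

lemma ideal_TA: "ideal I TA \<longleftrightarrow> tideal (I :: 'a::comm_ring_1 set)"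
proof
  assume "ideal I TA"
  then interpret ideal I TA .
  show "tideal I" unfolding tideal_def
  proof (intro conjI ballI allI)
    show "0 \<in> I" using additive_subgroup.zero_closed[OF is_additive_subgroup] by simp
    show "a + b \<in> I" if "a \<in> I" "b \<in> I" for a b
      using additive_subgroup.a_closed[OF is_additive_subgroup that] by simp
    show "h * a \<in> I" if "a \<in> I" for a h
      using I_l_closed[OF that, of h] by simp
  qed
next
  assume I: "tideal I"
  have "subgroup I (add_monoid TA)"
  proof (rule group.subgroupI)
    interpret cring "TA :: 'a ring" by (rule TA_cring)
    show "Group.group (add_monoid (TA :: 'a ring))" by (rule a_group)
    show "inv\<^bsub>add_monoid TA\<^esub> a \<in> I" if "a \<in> I" for a
      using tidealD(5)[OF I that] unfolding TA_a_inv[of a, symmetric] a_inv_def .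
  qed (use tidealD(1)[OF I] in \<open>auto intro: tidealD(2)[OF I]\<close>)
  then show "ideal I TA" by (rule idealI[OF TA_ring]) (auto intro: tidealD(3,4)[OF I])
qed

lemma tideal_gen: "tideal {\<Sum>s\<in>S. h s * (s :: 'a::comm_ring_1) | h. True}"
  unfolding tideal_def
proof (intro conjI ballI allI)
  show "0 \<in> {\<Sum>s\<in>S. h s * s |h. True}" by (rule CollectI, rule exI[of _ "\<lambda>_. 0"]) simp
next
  fix a b assume "a \<in> {\<Sum>s\<in>S. h s * s |h. True}" "b \<in> {\<Sum>s\<in>S. h s * s |h. True}"
  then obtain h h' where "a = (\<Sum>s\<in>S. h s * s)" "b = (\<Sum>s\<in>S. h' s * s)" by auto
  then have "a + b = (\<Sum>s\<in>S. (h s + h' s) * s)" by (simp add: distrib_right sum.distrib)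
  then show "a + b \<in> {\<Sum>s\<in>S. h s * s |h. True}" by (intro CollectI exI conjI TrueI)
next
  fix a x assume "a \<in> {\<Sum>s\<in>S. h s * s |h. True}"
  then obtain h where "a = (\<Sum>s\<in>S. h s * s)" by auto
  then have "x * a = (\<Sum>s\<in>S. (x * h s) * s)" by (simp add: sum_distrib_left mult.assoc)
  then show "x * a \<in> {\<Sum>s\<in>S. h s * s |h. True}" by (intro CollectI exI conjI TrueI)
qed

lemma tideal_sum: "tideal I \<Longrightarrow> (\<And>s. s \<in> S \<Longrightarrow> F s \<in> I) \<Longrightarrow> sum F S \<in> I"
  by (induct S rule: infinite_finite_induct) (auto intro: tidealD)

lemma genideal_TA:
  assumes "finite S" shows "genideal TA S = {\<Sum>s\<in>S. h s * (s :: 'a::comm_ring_1) | h. True}"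
proof -
  interpret cring "TA :: 'a ring" by (rule TA_cring)
  have "S \<subseteq> {\<Sum>s\<in>S. h s * s |h. True}"
  proof
    fix t assume "t \<in> S"
    then have "t = (\<Sum>s\<in>S. (if s = t then 1 else 0) * s)"
      using assms by (simp add: if_distrib[of "\<lambda>x. x * _"] cong: if_cong)
    then show "t \<in> {\<Sum>s\<in>S. h s * s |h. True}" by (intro CollectI exI conjI TrueI)
  qed
  then have "genideal TA S \<subseteq> {\<Sum>s\<in>S. h s * s |h. True}"
    using genideal_minimal[of "{\<Sum>s\<in>S. h s * s |h. True}" S] tideal_gen[of S] unfolding ideal_TA by blast
  moreover have "tideal (genideal TA S)" using genideal_ideal[of S] by (simp add: ideal_TA)
  then have "{\<Sum>s\<in>S. h s * s |h. True} \<subseteq> genideal TA S"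
    using genideal_self[of S] by (auto intro!: tideal_sum tidealD(3))
  ultimately show ?thesis by blast
qed

lemma max_idealI:
  fixes R (structure)
  assumes "cring R" "ideal M R" "M \<noteq> carrier R" "\<And>x. x \<in> carrier R - M \<Longrightarrow> x \<in> Units R"
  shows "max_ideal R = M"
proof -
  interpret cring R by fact
  have *: "J = carrier R" if J: "ideal J R" "\<not> J \<subseteq> M" for J
  proof -
    have "J \<subseteq> carrier R" using J(1) by (simp add: additive_subgroup.a_subset ideal.axioms(1))
    then obtain x where "x \<in> J" "x \<in> carrier R - M" using J(2) by auto
    then have "x \<in> J" "x \<in> Units R" using assms(4) by blast+
    then have "\<one> \<in> J" using ideal.I_l_closed[OF J(1), of x "inv x"] Units_inv_closed Units_l_inv by force
    then show ?thesis by (rule ideal.one_imp_carrier[OF J(1)])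
  qed
  have M: "maximalideal M R"
    by (rule maximalidealI) (use assms(2,3) * in blast)+
  have "m = M" if "maximalideal m R" for m
  proof -
    interpret m: maximalideal m R by fact
    have "m \<subseteq> M" using *[OF m.ideal_axioms] m.I_notcarr by blast
    then show ?thesis
      using m.I_maximal[OF assms(2)] assms(3) ideal.Icarr[OF assms(2)] by blast
  qed
  from M this show ?thesis unfolding max_ideal_def by (rule the_equality)
qed

subsection \<open>Minimal number of generators\<close>

text \<open>A form of Nakayama: by \<open>scale\<close> the functionals \<theta> factor through I /
  n I with n the maximal ideal, so their value vectors on \<open>S'\<close> span those on
  \<open>S\<close>, and the latter are standard basis vectors by \<open>dual\<close>.\<close>

lemma card_generators_ge:
  fixes S S' :: "'k::field ps3 set"
  assumes fin: "finite S" "finite S'" and SI: "S \<subseteq> genideal TA S'" and S': "S' \<subseteq> I"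
    and add: "\<And>s f g. s \<in> S \<Longrightarrow> f \<in> I \<Longrightarrow> g \<in> I \<Longrightarrow> \<theta> s (f + g) = (\<theta> s f + \<theta> s g :: 'k)"
    and scale: "\<And>s f h. s \<in> S \<Longrightarrow> f \<in> I \<Longrightarrow> \<theta> s (h * f) = ct h * \<theta> s f"
    and dual: "\<And>s t. s \<in> S \<Longrightarrow> t \<in> S \<Longrightarrow> \<theta> s t = (if s = t then 1 else 0)"
    and I: "tideal I"
  shows "card S \<le> card S'"
proof -
  interpret vs: vector_space "\<lambda>(r :: 'k) (f :: 'k ps3 \<Rightarrow> 'k) s. r * f s"
    by unfold_locales (auto simp: fun_eq_iff algebra_simps)
  define c where "c t = (\<lambda>s. if s \<in> S then \<theta> s t else 0)" for t
  have csum: "c (\<Sum>t\<in>T. h t * t) = (\<Sum>t\<in>T. (\<lambda>s. ct (h t) * c t s))" if "T \<subseteq> S'" for T h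
    using finite_subset[OF that fin(2)] that
  proof (induct T rule: finite_induct)
    case empty
    have "\<theta> s 0 = 0" if "s \<in> S" for s using scale[OF that, of 0 0] tidealD(1)[OF I] by simp
    then show ?case by (auto simp: c_def fun_eq_iff)
  next
    case (insert t T)
    have "t \<in> I" "(\<Sum>t\<in>T. h t * t) \<in> I"
      using insert S' by (auto intro!: tideal_sum[OF I] tidealD(3)[OF I])
    then have "c (h t * t + (\<Sum>t\<in>T. h t * t)) = (\<lambda>s. ct (h t) * c t s) + c (\<Sum>t\<in>T. h t * t)"
      by (auto simp: c_def fun_eq_iff add scale tidealD(3)[OF I])
    then show ?case using insert by simp
  qed
  have inj: "inj_on c S"
    by (rule inj_onI) (metis c_def dual zero_neq_one)
  have cS: "s \<in> S \<Longrightarrow> c s = (\<lambda>t. if t = s then 1 else 0)" for s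
    by (auto simp: c_def fun_eq_iff dual)
  have "vs.independent (c ` S)"
  proof -
    have "u v = 0" if u: "(\<Sum>v\<in>c ` S. (\<lambda>s. u v * v s)) = 0" and v: "v \<in> c ` S" for u v
    proof -
      obtain s where s: "s \<in> S" "v = c s" using v by auto
      have "(\<Sum>t\<in>S. (\<lambda>s. u (c t) * c t s)) = 0"
        using u by (simp add: sum.reindex[OF inj])
      then have "(\<Sum>t\<in>S. (\<lambda>s. u (c t) * c t s)) s = 0" by simp
      moreover have "(\<Sum>t\<in>S. (\<lambda>s. u (c t) * c t s)) s = (\<Sum>t\<in>S. u (c t) * c t s)"
        using fin(1) by (induct S rule: finite_induct) auto
      moreover have "\<dots> = (\<Sum>t\<in>S. if t = s then u (c t) else 0)"
        by (rule sum.cong) (auto simp: cS s)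
      ultimately show ?thesis using s fin by simp
    qed
    then show ?thesis using vs.independent_if_scalars_zero[of "c ` S"] fin(1) by auto
  qed
  moreover have "c ` S \<subseteq> vs.span (c ` S')"
  proof
    fix v assume "v \<in> c ` S"
    then obtain s where s: "s \<in> S" "v = c s" by auto
    then obtain h where "s = (\<Sum>t\<in>S'. h t * t)" using SI genideal_TA[OF fin(2)] by auto
    then have "v = (\<Sum>t\<in>S'. (\<lambda>s. ct (h t) * c t s))" using csum[of S'] s by simp
    then show "v \<in> vs.span (c ` S')"
      by (simp only:) (intro vs.span_sum vs.span_scale vs.span_base imageI)
  qed
  ultimately have "card (c ` S) \<le> card (c ` S')"
    using vs.independent_span_bound[of "c ` S'" "c ` S"] fin by auto
  then show ?thesis using card_image[OF inj] card_image_le[OF fin(2), of c] by simp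
qed

lemma min_num_gens_eq:
  fixes S :: "'k::field ps3 set"
  assumes fin: "finite S" and gen: "genideal TA S = I"
    and add: "\<And>s f g. s \<in> S \<Longrightarrow> f \<in> I \<Longrightarrow> g \<in> I \<Longrightarrow> \<theta> s (f + g) = (\<theta> s f + \<theta> s g :: 'k)"
    and scale: "\<And>s f h. s \<in> S \<Longrightarrow> f \<in> I \<Longrightarrow> \<theta> s (h * f) = ct h * \<theta> s f"
    and dual: "\<And>s t. s \<in> S \<Longrightarrow> t \<in> S \<Longrightarrow> \<theta> s t = (if s = t then 1 else 0)"
  shows "min_num_gens TA I = card S"
  unfolding min_num_gens_def
proof (rule Least_equality)
  show "\<exists>S'. S' \<subseteq> carrier TA \<and> finite S' \<and> card S' = card S \<and> genideal TA S' = I"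
    using fin gen by auto
next
  fix n assume "\<exists>S'. S' \<subseteq> carrier TA \<and> finite S' \<and> card S' = n \<and> genideal TA S' = I"
  then obtain S' where S': "finite S'" "card S' = n" "genideal TA S' = I" by auto
  interpret cring "TA :: 'k ps3 ring" by (rule TA_cring)
  have "tideal I" using genideal_ideal[of S] gen by (simp add: ideal_TA)
  then show "card S \<le> n"
    using card_generators_ge[OF fin S'(1) _ _ add scale dual] S' gen genideal_self[of S] genideal_self[of S']
    by auto
qed

subsection \<open>Quotients of rings of a type class\<close>

abbreviation qm :: "'a::comm_ring_1 set \<Rightarrow> 'a \<Rightarrow> 'a set" where
  "qm I f \<equiv> I +>\<^bsub>TA\<^esub> f"

lemma qm_def': "qm I f = {i + f | i. i \<in> I}"
  by (auto simp: a_r_coset_def')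

lemma carrier_quot: "carrier (TA Quot I) = range (qm I)"
  by (auto simp: FactRing_def A_RCOSETS_def RCOSETS_def a_r_coset_def)

context
  fixes I :: "'a::comm_ring_1 set"
  assumes I: "tideal I"
begin

lemma qm_eq: "qm I f = qm I g \<longleftrightarrow> f - g \<in> I"
proof
  assume "qm I f = qm I g"
  moreover have "f \<in> qm I f" using tidealD(1)[OF I] by (auto simp: qm_def')
  ultimately show "f - g \<in> I" by (auto simp: qm_def')
next
  have *: "qm I f \<subseteq> qm I g" if fg: "f - g \<in> I" for f g
  proof
    fix z assume "z \<in> qm I f"
    then obtain i where "i \<in> I" "z = i + f" by (auto simp: qm_def')
    then have "z = (i + (f - g)) + g" "i + (f - g) \<in> I" using tidealD(2)[OF I] fg by auto
    then show "z \<in> qm I g" unfolding qm_def' by blast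
  qed
  assume "f - g \<in> I"
  with *[of f g] *[of g f] show "qm I f = qm I g" using tidealD(5)[OF I, of "f - g"] by auto
qed

lemma qm_ring_hom: "qm I \<in> ring_hom TA (TA Quot I)"
  using ideal.rcos_ring_hom[of I TA] I by (simp add: ideal_TA)

lemma quot_cring: "cring (TA Quot I)"
  using ideal.quotient_is_cring[of I TA] I TA_cring by (simp add: ideal_TA)

lemma qm_mult: "qm I f \<otimes>\<^bsub>TA Quot I\<^esub> qm I g = qm I (f * g)"
  and qm_add: "qm I f \<oplus>\<^bsub>TA Quot I\<^esub> qm I g = qm I (f + g)"
  and qm_one: "\<one>\<^bsub>TA Quot I\<^esub> = qm I 1"
  using ring_hom_mult[OF qm_ring_hom, of f g] ring_hom_add[OF qm_ring_hom, of f g]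
    ring_hom_one[OF qm_ring_hom] by simp_all

lemma qm_zero: "\<zero>\<^bsub>TA Quot I\<^esub> = qm I 0"
  by (auto simp: FactRing_def qm_def')

lemma qm_0_iff: "qm I f = \<zero>\<^bsub>TA Quot I\<^esub> \<longleftrightarrow> f \<in> I"
  by (simp add: qm_zero qm_eq)

lemma qm_minus: "\<ominus>\<^bsub>TA Quot I\<^esub> qm I f = qm I (- f)"
proof -
  interpret cring "TA Quot I" by (rule quot_cring)
  show ?thesis by (rule minus_equality) (auto simp: carrier_quot qm_add qm_zero)
qed

lemma qm_carrier [simp]: "qm I f \<in> carrier (TA Quot I)"
  by (simp add: carrier_quot)

lemma qm_pow: "qm I f [^]\<^bsub>TA Quot I\<^esub> (n :: nat) = qm I (f ^ n)"
proof -
  interpret cring "TA Quot I" by (rule quot_cring)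
  show ?thesis by (induct n) (simp_all add: qm_one qm_mult mult.commute)
qed

lemma qm_finsum: "finite S \<Longrightarrow> (\<Oplus>\<^bsub>TA Quot I\<^esub>s\<in>S. qm I (F s)) = qm I (sum F S)"
proof -
  interpret cring "TA Quot I" by (rule quot_cring)
  show "finite S \<Longrightarrow> (\<Oplus>\<^bsub>TA Quot I\<^esub>s\<in>S. qm I (F s)) = qm I (sum F S)"
    by (induct S rule: finite_induct) (simp_all add: qm_zero qm_add)
qed

lemma koszul_sign_quot:
  "koszul_sign (TA Quot I) S T = qm I ((- 1) ^ card {(i, j). i \<in> S \<and> j \<in> T \<and> j < i})"
  by (simp add: koszul_sign_def qm_one qm_minus qm_pow)

end

subsection \<open>The Koszul algebra on three generators\<close>

text \<open>\<open>Kos s a1 a2 a3 b1 b2 b3 t\<close> stands for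
  $s + \sum a_i e_i + b_1 e_2 e_3 + b_2 e_3 e_1 + b_3 e_1 e_2 + t e_1 e_2 e_3$, so that products and
  differentials are given by the usual dot and cross products.\<close>

datatype 'a kos = Kos (ks: 'a) (ka1: 'a) (ka2: 'a) (ka3: 'a) (kb1: 'a) (kb2: 'a) (kb3: 'a) (kt: 'a)

lemma kos_eqI: "ks u = ks v \<Longrightarrow> ka1 u = ka1 v \<Longrightarrow> ka2 u = ka2 v \<Longrightarrow> ka3 u = ka3 v \<Longrightarrow>
  kb1 u = kb1 v \<Longrightarrow> kb2 u = kb2 v \<Longrightarrow> kb3 u = kb3 v \<Longrightarrow> kt u = kt v \<Longrightarrow> u = v"
  by (cases u; cases v) simp

instantiation kos :: (comm_ring_1) ring_1
begin

definition "0 = Kos 0 0 0 0 0 0 0 0"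
definition "1 = Kos 1 0 0 0 0 0 0 0"
definition "u + v = Kos (ks u + ks v) (ka1 u + ka1 v) (ka2 u + ka2 v) (ka3 u + ka3 v)
  (kb1 u + kb1 v) (kb2 u + kb2 v) (kb3 u + kb3 v) (kt u + kt v)"
definition "- u = Kos (- ks u) (- ka1 u) (- ka2 u) (- ka3 u) (- kb1 u) (- kb2 u) (- kb3 u) (- kt u)"
definition "u - v = Kos (ks u - ks v) (ka1 u - ka1 v) (ka2 u - ka2 v) (ka3 u - ka3 v)
  (kb1 u - kb1 v) (kb2 u - kb2 v) (kb3 u - kb3 v) (kt u - kt v)"
definition "u * v = Kos (ks u * ks v)
  (ks u * ka1 v + ka1 u * ks v) (ks u * ka2 v + ka2 u * ks v) (ks u * ka3 v + ka3 u * ks v)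
  (ks u * kb1 v + kb1 u * ks v + ka2 u * ka3 v - ka3 u * ka2 v)
  (ks u * kb2 v + kb2 u * ks v + ka3 u * ka1 v - ka1 u * ka3 v)
  (ks u * kb3 v + kb3 u * ks v + ka1 u * ka2 v - ka2 u * ka1 v)
  (ks u * kt v + kt u * ks v + ka1 u * kb1 v + ka2 u * kb2 v + ka3 u * kb3 v
    + kb1 u * ka1 v + kb2 u * ka2 v + kb3 u * ka3 v)"

lemmas kos_defs = zero_kos_def one_kos_def plus_kos_def uminus_kos_def minus_kos_def times_kos_def

instance
proof
  fix u v w :: "'a kos"
  show "u * v * w = u * (v * w)" by (rule kos_eqI) (simp_all add: kos_defs algebra_simps)
  show "(0 :: 'a kos) \<noteq> 1" by (simp add: kos_defs)
qed (rule kos_eqI; simp add: kos_defs algebra_simps; fail)+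

end

lemma kos_sel [simp]:
  "ks 0 = 0" "ka1 0 = 0" "ka2 0 = 0" "ka3 0 = 0" "kb1 0 = 0" "kb2 0 = 0" "kb3 0 = 0" "kt 0 = 0"
  "ks (u + v) = ks u + ks v" "ka1 (u + v) = ka1 u + ka1 v" "ka2 (u + v) = ka2 u + ka2 v"
  "ka3 (u + v) = ka3 u + ka3 v" "kb1 (u + v) = kb1 u + kb1 v" "kb2 (u + v) = kb2 u + kb2 v"
  "kb3 (u + v) = kb3 u + kb3 v" "kt (u + v) = kt u + kt v"
  "ks (u - v) = ks u - ks v" "ka1 (u - v) = ka1 u - ka1 v" "ka2 (u - v) = ka2 u - ka2 v"
  "ka3 (u - v) = ka3 u - ka3 v" "kb1 (u - v) = kb1 u - kb1 v" "kb2 (u - v) = kb2 u - kb2 v"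
  "kb3 (u - v) = kb3 u - kb3 v" "kt (u - v) = kt u - kt v"
  "ks (- u) = - ks u" "ka1 (- u) = - ka1 u" "ka2 (- u) = - ka2 u" "ka3 (- u) = - ka3 u"
  "kb1 (- u) = - kb1 u" "kb2 (- u) = - kb2 u" "kb3 (- u) = - kb3 u" "kt (- u) = - kt u"
  by (simp_all add: kos_defs)

text \<open>The sign at {0, 2} is that of e_3 e_1 = - e_1 e_3.\<close>

definition kc :: "'a::comm_ring_1 kos \<Rightarrow> nat set \<Rightarrow> 'a" where
  "kc v S = (if 0 \<in> S then (if Suc 0 \<in> S then (if 2 \<in> S then kt v else kb3 v)
      else (if 2 \<in> S then - kb2 v else ka1 v))
    else (if Suc 0 \<in> S then (if 2 \<in> S then kb1 v else ka2 v) else (if 2 \<in> S then ka3 v else ks v)))"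

lemma lt3: "{..<3::nat} = {0, Suc 0, 2}" by auto

lemma ball_Pow3: "(\<forall>U\<in>Pow {..<3::nat}. P U) \<longleftrightarrow> P {} \<and> P {0} \<and> P {Suc 0} \<and> P {2} \<and> P {0, Suc 0} \<and>
   P {0, 2} \<and> P {Suc 0, 2} \<and> P {0, Suc 0, 2}"
  unfolding lt3 by (simp add: Pow_insert) blast

lemma sum_Pow_insert: "finite A \<Longrightarrow> a \<notin> A \<Longrightarrow>
   sum F (Pow (insert a A)) = sum F (Pow A) + (\<Sum>S\<in>Pow A. F (insert a S))"
proof -
  assume A: "finite A" "a \<notin> A"
  have "inj_on (insert a) (Pow A)" by (rule inj_onI) (metis A(2) PowD insert_ident subsetD)
  then show ?thesis unfolding Pow_insert using A by (subst sum.union_disjoint) (auto simp: sum.reindex)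
qed

lemma card_inv: "finite S \<Longrightarrow> finite T \<Longrightarrow>
    card {(i :: nat, j). i \<in> S \<and> j \<in> T \<and> j < i} = (\<Sum>i\<in>S. \<Sum>j\<in>T. if j < i then 1 else 0)"
proof -
  assume f: "finite S" "finite T"
  have "{(i, j). i \<in> S \<and> j \<in> T \<and> j < i} = Sigma S (\<lambda>i. {j \<in> T. j < i})" by auto
  then show ?thesis using f by (simp add: sum.If_cases Int_def)
qed

text \<open>The sign of \<open>koszul_sign\<close> with the inversions counted by a double sum,
  which the simplifier can evaluate on each of the eight subsets.\<close>

definition sg :: "nat set \<Rightarrow> nat set \<Rightarrow> 'a::comm_ring_1" where
  "sg S T = (- 1) ^ (\<Sum>i\<in>S. \<Sum>j\<in>T. if j < i then 1 else 0)"

lemma kc_mult: "U \<in> Pow {..<3} \<Longrightarrow> (\<Sum>S\<in>Pow U. sg S (U - S) * (kc u S * kc v (U - S))) = kc (u * v) U"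
proof -
  have "\<forall>U\<in>Pow {..<3}. (\<Sum>S\<in>Pow U. sg S (U - S) * (kc u S * kc v (U - S))) = kc (u * v) U"
    unfolding ball_Pow3
    by (simp add: sum_Pow_insert sg_def insert_Diff_if kc_def times_kos_def algebra_simps)
  then show "U \<in> Pow {..<3} \<Longrightarrow> ?thesis" by blast
qed

definition dk :: "'k::field ps3 kos \<Rightarrow> 'k ps3 kos" where
  "dk v = Kos (vX * ka1 v + vY * ka2 v + vZ * ka3 v)
     (vZ * kb2 v - vY * kb3 v) (vX * kb3 v - vZ * kb1 v) (vY * kb1 v - vX * kb2 v)
     (vX * kt v) (vY * kt v) (vZ * kt v) 0"

lemma kc_dk: "U \<in> Pow {..<3} \<Longrightarrow>
   (\<Sum>i\<in>{..<3} - U. sg {i} U * ([vX, vY, vZ] ! i * kc v (insert i U))) = kc (dk v) U"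
proof -
  have "\<forall>U\<in>Pow {..<3}. (\<Sum>i\<in>{..<3} - U. sg {i} U * ([vX, vY, vZ] ! i * kc v (insert i U))) = kc (dk v) U"
    unfolding ball_Pow3 unfolding lt3
    by (simp add: sg_def insert_Diff_if kc_def dk_def algebra_simps)
  then show "U \<in> Pow {..<3} \<Longrightarrow> ?thesis" by blast
qed

lemma dk_add: "dk (u + v) = dk u + dk v" and dk_diff: "dk (u - v) = dk u - dk v"
  and dk_minus: "dk (- u) = - dk u"
  by (rule kos_eqI; simp add: dk_def algebra_simps)+

lemma dk_dk: "dk (dk v) = 0"
  by (rule kos_eqI) (simp_all add: dk_def algebra_simps)

text \<open>The sign (-1)^p in degree p that the graded Leibniz rule \<open>dk_mult\<close>
  requires.\<close>

definition galt :: "'a::comm_ring_1 kos \<Rightarrow> 'a kos" where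
  "galt v = Kos (ks v) (- ka1 v) (- ka2 v) (- ka3 v) (kb1 v) (kb2 v) (kb3 v) (- kt v)"

lemma galt_galt: "galt (galt v) = v"
  by (rule kos_eqI) (simp_all add: galt_def)

lemma dk_mult: "dk (u * v) = dk u * v + galt u * dk v"
  by (rule kos_eqI) (simp_all add: dk_def galt_def times_kos_def algebra_simps)

definition kin :: "'a::comm_ring_1 set \<Rightarrow> 'a kos \<Rightarrow> bool" where
  "kin I v \<longleftrightarrow> ks v \<in> I \<and> ka1 v \<in> I \<and> ka2 v \<in> I \<and> ka3 v \<in> I \<and> kb1 v \<in> I \<and> kb2 v \<in> I \<and> kb3 v \<in> I \<and> kt v \<in> I"

lemma kin_simps: assumes I: "tideal I"
  shows "kin I 0" "kin I u \<Longrightarrow> kin I v \<Longrightarrow> kin I (u + v)" "kin I u \<Longrightarrow> kin I v \<Longrightarrow> kin I (u - v)"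
    "kin I u \<Longrightarrow> kin I (- u)" "kin I u \<Longrightarrow> kin I (u * v)" "kin I v \<Longrightarrow> kin I (u * v)" "kin I u \<Longrightarrow> kin I (galt u)"
  unfolding kin_def galt_def times_kos_def
  by (auto intro!: tidealD(2,5,6)[OF I] simp: tidealD(1)[OF I] tidealD(3,4)[OF I])

lemma kin_dk: "tideal I \<Longrightarrow> kin I u \<Longrightarrow> kin I (dk u)"
  unfolding kin_def dk_def
  by (auto intro!: tidealD(2,5,6) simp: tidealD(1) tidealD(3,4))

text \<open>\<open>TA\<close> requires a commutative type, which the exterior algebra is not; this
  record serves to transport the ring axioms in \<open>KA_ring\<close>.\<close>

definition KTA :: "'a::comm_ring_1 kos ring" where
  "KTA = \<lparr>carrier = UNIV, monoid.mult = (*), one = 1, ring.zero = 0, add = (+)\<rparr>"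

lemma KTA_ring: "ring (KTA :: 'a::comm_ring_1 kos ring)"
proof (rule ringI)
  show "abelian_group (KTA :: 'a kos ring)"
    by (rule abelian_groupI) (auto simp: KTA_def algebra_simps intro: exI[of _ "- _"])
  show "Group.monoid (KTA :: 'a kos ring)"
    by (rule monoidI) (auto simp: KTA_def algebra_simps)
qed (auto simp: KTA_def algebra_simps)

subsection \<open>Koszul homology of a quotient of the power series ring\<close>

lemma ordge_2D: "ordge 2 f \<Longrightarrow> ct f = 0 \<and> f $ 0 $ 0 $ Suc 0 = 0 \<and> f $ 0 $ Suc 0 $ 0 = 0 \<and> f $ Suc 0 $ 0 $ 0 = 0"
  by (simp add: ordge_def)

lemma tideal_ct: "tideal {f :: 'k::field ps3. ct f = 0}"
  by (auto simp: tideal_def)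

lemma Units_TA: "ct f \<noteq> 0 \<Longrightarrow> f \<in> Units (TA :: 'k::field ps3 ring)"
  using ps3_unit[of f] by (auto simp: Units_def mult.commute)

lemma max_ideal_TA: "max_ideal (TA :: 'k::field ps3 ring) = {f. ct f = 0}"
proof (rule max_idealI[OF TA_cring])
  show "ideal {f :: 'k ps3. ct f = 0} TA" by (simp add: ideal_TA tideal_ct)
  have "(1 :: 'k ps3) \<notin> {f. ct f = 0}" by simp
  then show "{f :: 'k ps3. ct f = 0} \<noteq> carrier TA" by (metis TA_simps(1) UNIV_I)
qed (use Units_TA in auto)

text \<open>Order at least two for the elements of \<open>I\<close> makes the three variables a
  minimal generating set of the maximal ideal of the quotient and puts \<open>I\<close> into the
  square of the maximal ideal of Q.\<close>

locale ps3_quot =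
  fixes I :: "'k::field ps3 set"
  assumes I: "tideal I" and I2: "f \<in> I \<Longrightarrow> ordge 2 f"
begin

abbreviation "R \<equiv> TA Quot I"
abbreviation "xs \<equiv> [qm I vX, qm I vY, qm I vZ]"
abbreviation "KA \<equiv> koszul_algebra R 3"

lemma I_ct: "f \<in> I \<Longrightarrow> ct f = 0"
  using I2[of f] ordge_2D by blast

lemma cring_R: "cring R" by (rule quot_cring[OF I])

lemma qm_ideal: "tideal J \<Longrightarrow> ideal (qm I ` J) R"
  using ring.ring_ideal_imp_quot_ideal[OF TA_ring, of I J] I by (simp add: ideal_TA)

lemma Units_R: "ct f \<noteq> 0 \<Longrightarrow> qm I f \<in> Units R"
proof -
  assume "ct f \<noteq> 0"
  then obtain g where g: "f * g = 1" using ps3_unit by blast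
  then have "g * f = 1" by (simp add: mult.commute)
  with g show ?thesis unfolding Units_def
    by (intro CollectI conjI bexI[of _ "qm I g"]) (simp_all add: qm_mult[OF I] qm_one[OF I] I)
qed

lemma max_ideal_R: "max_ideal R = qm I ` {f. ct f = 0}"
proof (rule max_idealI[OF cring_R qm_ideal[OF tideal_ct]])
  have "qm I 1 \<notin> qm I ` {f. ct f = 0}"
    using I_ct by (force simp: qm_eq[OF I])
  then show "qm I ` {f. ct f = 0} \<noteq> carrier R" using qm_carrier[OF I, of 1] by blast
  show "x \<in> Units R" if "x \<in> carrier R - qm I ` {f. ct f = 0}" for x
    using that Units_R unfolding carrier_quot by blast
qed

text \<open>Here \<kappa> is the coefficient of the omitted variable \<open>v\<close>. It vanishes
  on the remaining generators, and together with the constant term it cuts out an ideal that misses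
  \<open>v\<close>.\<close>

lemma proper_gen:
  assumes "tideal {f. ct f = 0 \<and> \<kappa> f = (0 :: 'k)}" "\<And>f. f \<in> I \<Longrightarrow> \<kappa> f = 0" "\<And>f g. \<kappa> (f - g) = \<kappa> f - \<kappa> g"
    and "S \<subseteq> qm I ` {f. ct f = 0 \<and> \<kappa> f = 0}" "\<kappa> v = 1" "ct v = 0"
  shows "genideal R S \<noteq> max_ideal R"
proof -
  interpret cring R by (rule cring_R)
  have "genideal R S \<subseteq> qm I ` {f. ct f = 0 \<and> \<kappa> f = 0}"
    using genideal_minimal[OF qm_ideal[OF assms(1)] assms(4)] .
  moreover have "qm I v \<in> max_ideal R" using assms(6) by (simp add: max_ideal_R)
  moreover have "qm I v \<notin> qm I ` {f. ct f = 0 \<and> \<kappa> f = 0}"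
    using assms(2,3,5) by (auto simp: qm_eq[OF I]) (metis diff_zero zero_neq_one)
  ultimately show ?thesis by blast
qed

lemma min_gen_xs: "min_gen_list R (max_ideal R) xs"
  unfolding min_gen_list_def
proof (intro conjI allI impI)
  interpret cring R by (rule cring_R)
  have coeffs [simp]: "vX $ 0 $ 0 $ Suc 0 = (1 :: 'k)" "vY $ 0 $ 0 $ Suc 0 = (0 :: 'k)" "vZ $ 0 $ 0 $ Suc 0 = (0 :: 'k)"
    "vX $ 0 $ Suc 0 $ 0 = (0 :: 'k)" "vY $ 0 $ Suc 0 $ 0 = (1 :: 'k)" "vZ $ 0 $ Suc 0 $ 0 = (0 :: 'k)"
    "vX $ Suc 0 $ 0 $ 0 = (0 :: 'k)" "vY $ Suc 0 $ 0 $ 0 = (0 :: 'k)" "vZ $ Suc 0 $ 0 $ 0 = (1 :: 'k)"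
    by (simp_all add: vX_def vY_def vZ_def)
  show xsR: "set xs \<subseteq> carrier R" using I by simp
  have "vX - vY \<notin> I" "vX - vZ \<notin> I" "vY - vZ \<notin> I"
    by (auto dest!: I2 ordge_2D)
  then show "distinct xs" by (simp add: qm_eq[OF I])
  have "qm I f \<in> genideal R (set xs)" if "ct f = 0" for f
  proof -
    interpret J: ideal "genideal R (set xs)" R by (rule genideal_ideal[OF xsR])
    have v: "qm I vX \<in> genideal R (set xs)" "qm I vY \<in> genideal R (set xs)" "qm I vZ \<in> genideal R (set xs)"
      using genideal_self[OF xsR] by auto
    have "qm I f = qm I vX \<otimes>\<^bsub>R\<^esub> qm I (dX f) \<oplus>\<^bsub>R\<^esub> qm I vY \<otimes>\<^bsub>R\<^esub> qm I (dY f) \<oplus>\<^bsub>R\<^esub> qm I vZ \<otimes>\<^bsub>R\<^esub> qm I (dZ f)"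
      using ps3_decomp0[OF that] by (simp add: qm_mult[OF I] qm_add[OF I])
    also have "\<dots> \<in> genideal R (set xs)"
      by (intro J.a_closed J.I_r_closed v qm_carrier[OF I])
    finally show ?thesis .
  qed
  then have "max_ideal R \<subseteq> genideal R (set xs)" by (auto simp: max_ideal_R)
  moreover have "genideal R (set xs) \<subseteq> max_ideal R"
    unfolding max_ideal_R by (rule genideal_minimal[OF qm_ideal[OF tideal_ct]]) auto
  ultimately show "genideal R (set xs) = max_ideal R" by blast
  fix S assume S: "S \<subset> set xs"
  then consider "S \<subseteq> {qm I vY, qm I vZ}" | "S \<subseteq> {qm I vX, qm I vZ}" | "S \<subseteq> {qm I vX, qm I vY}" by auto
  then show "genideal R S \<noteq> max_ideal R"
  proof cases
    case 1
    show ?thesis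
      by (rule proper_gen[of "\<lambda>f. f $ 0 $ 0 $ Suc 0" _ vX]) (use 1 ordge_2D[OF I2] in \<open>auto simp: tideal_def\<close>)
  next
    case 2
    show ?thesis
      by (rule proper_gen[of "\<lambda>f. f $ 0 $ Suc 0 $ 0" _ vY]) (use 2 ordge_2D[OF I2] in \<open>auto simp: tideal_def\<close>)
  next
    case 3
    show ?thesis
      by (rule proper_gen[of "\<lambda>f. f $ Suc 0 $ 0 $ 0" _ vZ]) (use 3 ordge_2D[OF I2] in \<open>auto simp: tideal_def\<close>)
  qed
qed

definition emb :: "'k ps3 kos \<Rightarrow> nat set \<Rightarrow> 'k ps3 set" where
  "emb v = (\<lambda>U\<in>Pow {..<3}. qm I (kc v U))"

lemma len_xs: "length xs = 3" by simp

lemma koszul_sign_R: "finite S \<Longrightarrow> finite T \<Longrightarrow> koszul_sign R S T = qm I (sg S T)"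
  by (simp add: koszul_sign_quot[OF I] sg_def card_inv)

lemma fin3: "U \<in> Pow {..<3::nat} \<Longrightarrow> finite U"
  using finite_subset by auto

lemma emb_eq: "emb u = emb v \<longleftrightarrow> kin I (u - v)"
proof -
  have "emb u = emb v \<longleftrightarrow> (\<forall>U\<in>Pow {..<3}. qm I (kc u U) = qm I (kc v U))"
    unfolding emb_def by (auto simp: fun_eq_iff restrict_def)
  also have "\<dots> \<longleftrightarrow> kin I (u - v)"
    unfolding ball_Pow3 qm_eq[OF I] using tidealD(5)[OF I, of "kb2 u - kb2 v"] tidealD(5)[OF I, of "kb2 v - kb2 u"]
    by (auto simp: kc_def kin_def)
  finally show ?thesis .
qed

lemma emb_surj: "carrier KA = range emb"
proof
  show "range emb \<subseteq> carrier KA" 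
    by (simp add: koszul_algebra_def emb_def PiE_def extensional_def Pi_def image_subset_iff qm_carrier[OF I])
  show "carrier KA \<subseteq> range emb"
  proof
    fix w assume w: "w \<in> carrier KA"
    then have "\<forall>U\<in>Pow {..<3}. w U \<in> range (qm I)"
      unfolding koszul_algebra_def carrier_quot by (simp add: PiE_def Pi_def)
    then have "\<forall>U\<in>Pow {..<3}. \<exists>f. w U = qm I f" by (simp add: image_iff)
    then obtain r where r: "\<And>U. U \<in> Pow {..<3} \<Longrightarrow> w U = qm I (r U)" by metis
    define u where "u = Kos (r {}) (r {0}) (r {Suc 0}) (r {2}) (r {Suc 0, 2}) (- r {0, 2}) (r {0, Suc 0}) (r {0, Suc 0, 2})"
    have "\<forall>U\<in>Pow {..<3}. r U = kc u U" unfolding ball_Pow3 by (simp add: u_def kc_def)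
    then have "w = emb u" using r w
      by (auto simp: emb_def fun_eq_iff restrict_def koszul_algebra_def PiE_def extensional_def)
    then show "w \<in> range emb" by blast
  qed
qed

lemma emb_mult: "emb u \<otimes>\<^bsub>KA\<^esub> emb v = emb (u * v)"
proof -
  have "(\<Oplus>\<^bsub>R\<^esub>S\<in>Pow U. koszul_sign R S (U - S) \<otimes>\<^bsub>R\<^esub> (emb u S \<otimes>\<^bsub>R\<^esub> emb v (U - S))) = qm I (kc (u * v) U)"
    if U: "U \<in> Pow {..<3}" for U
  proof -
    interpret cring R by (rule cring_R)
    have "(\<Oplus>\<^bsub>R\<^esub>S\<in>Pow U. koszul_sign R S (U - S) \<otimes>\<^bsub>R\<^esub> (emb u S \<otimes>\<^bsub>R\<^esub> emb v (U - S)))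
       = (\<Oplus>\<^bsub>R\<^esub>S\<in>Pow U. qm I (sg S (U - S) * (kc u S * kc v (U - S))))"
    proof (rule finsum_cong')
      show "(\<lambda>S. qm I (sg S (U - S) * (kc u S * kc v (U - S)))) \<in> Pow U \<rightarrow> carrier R" using I by auto
      fix S assume "S \<in> Pow U"
      then have "S \<in> Pow {..<3}" "U - S \<in> Pow {..<3}" using U by auto
      then show "koszul_sign R S (U - S) \<otimes>\<^bsub>R\<^esub> (emb u S \<otimes>\<^bsub>R\<^esub> emb v (U - S)) = qm I (sg S (U - S) * (kc u S * kc v (U - S)))"
        using fin3[of S] fin3[of "U - S"] by (simp only: koszul_sign_R emb_def restrict_apply if_True qm_mult[OF I])
    qed simp
    also have "\<dots> = qm I (kc (u * v) U)" using fin3[OF U] by (simp add: qm_finsum[OF I] kc_mult[OF U])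
    finally show ?thesis .
  qed
  then show ?thesis by (auto simp: koszul_algebra_def emb_def[of "u * v"] intro!: restrict_ext)
qed

lemma emb_diff: "koszul_diff R xs (emb v) = emb (dk v)"
proof -
  have "(\<Oplus>\<^bsub>R\<^esub>i\<in>{..<3} - T. koszul_sign R {i} T \<otimes>\<^bsub>R\<^esub> (xs ! i \<otimes>\<^bsub>R\<^esub> emb v (insert i T))) = qm I (kc (dk v) T)"
    if T: "T \<in> Pow {..<3}" for T
  proof -
    interpret cring R by (rule cring_R)
    have "(\<Oplus>\<^bsub>R\<^esub>i\<in>{..<3} - T. koszul_sign R {i} T \<otimes>\<^bsub>R\<^esub> (xs ! i \<otimes>\<^bsub>R\<^esub> emb v (insert i T)))
       = (\<Oplus>\<^bsub>R\<^esub>i\<in>{..<3} - T. qm I (sg {i} T * ([vX, vY, vZ] ! i * kc v (insert i T))))"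
    proof (rule finsum_cong')
      show "(\<lambda>i. qm I (sg {i} T * ([vX, vY, vZ] ! i * kc v (insert i T)))) \<in> {..<3} - T \<rightarrow> carrier R" using I by auto
      fix i assume i: "i \<in> {..<3} - T"
      then have x: "xs ! i = qm I ([vX, vY, vZ] ! i)" using nth_map[of i "[vX, vY, vZ]" "qm I"] by simp
      have "insert i T \<in> Pow {..<3}" using T i by auto
      then show "koszul_sign R {i} T \<otimes>\<^bsub>R\<^esub> (xs ! i \<otimes>\<^bsub>R\<^esub> emb v (insert i T)) = qm I (sg {i} T * ([vX, vY, vZ] ! i * kc v (insert i T)))"
        using fin3[OF T] unfolding x
        by (simp only: koszul_sign_R emb_def restrict_apply if_True qm_mult[OF I] finite.intros)
    qed simp
    also have "\<dots> = qm I (kc (dk v) T)" by (simp add: qm_finsum[OF I] kc_dk[OF T])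
    finally show ?thesis .
  qed
  then show ?thesis unfolding koszul_diff_def len_xs emb_def[of "dk v"] by (rule restrict_ext)
qed

lemma emb_add: "emb u \<oplus>\<^bsub>KA\<^esub> emb v = emb (u + v)"
proof -
  have "\<forall>U\<in>Pow {..<3}. kc u U + kc v U = kc (u + v) U" unfolding ball_Pow3 by (simp add: kc_def)
  then show ?thesis by (auto simp: koszul_algebra_def emb_def qm_add[OF I] intro!: restrict_ext)
qed

lemma emb_zero: "\<zero>\<^bsub>KA\<^esub> = emb 0"
proof -
  have "\<forall>U\<in>Pow {..<3::nat}. kc 0 U = (0 :: 'k ps3)" unfolding ball_Pow3 by (simp add: kc_def)
  then show ?thesis by (auto simp: koszul_algebra_def emb_def qm_zero[OF I] intro!: restrict_ext)
qed

lemma emb_one: "\<one>\<^bsub>KA\<^esub> = emb 1"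
proof -
  have "\<forall>U\<in>Pow {..<3::nat}. kc 1 U = (if U = {} then 1 else 0 :: 'k ps3)"
    unfolding ball_Pow3 by (simp add: kc_def one_kos_def)
  then have "(if U = {} then \<one>\<^bsub>R\<^esub> else \<zero>\<^bsub>R\<^esub>) = qm I (kc 1 U)" if "U \<in> Pow {..<3}" for U
    using that by (simp add: qm_zero[OF I] qm_one[OF I])
  then have "(\<lambda>U\<in>Pow {..<3}. if U = {} then \<one>\<^bsub>R\<^esub> else \<zero>\<^bsub>R\<^esub>) = emb 1"
    unfolding emb_def by (rule restrict_ext)
  then show ?thesis by (simp add: koszul_algebra_def)
qed

text \<open>\<open>emb\<close> is a surjective homomorphism from the Koszul algebra over Q, so the
  axioms need no computation with cosets.\<close>

lemma KA_ring: "ring KA"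
proof -
  have "emb \<in> ring_hom KTA KA"
    by (rule ring_hom_memI) (auto simp: KTA_def emb_surj emb_mult emb_add emb_one)
  from ring.ring_hom_imp_img_ring[OF KTA_ring this]
  have "ring (KA\<lparr>carrier := range emb, zero := emb 0\<rparr>)" by (simp add: KTA_def)
  moreover have "KA\<lparr>carrier := range emb, zero := emb 0\<rparr> = KA"
    by (simp flip: emb_surj emb_zero)
  ultimately show ?thesis by simp
qed

lemma emb_minus: "\<ominus>\<^bsub>KA\<^esub> emb u = emb (- u)"
proof -
  interpret ring KA by (rule KA_ring)
  show ?thesis by (rule minus_equality) (auto simp: emb_surj emb_add emb_zero)
qed

text \<open>Preimages over Q of the cycles and of the boundaries. From here on homology is computed
  with power series modulo \<open>B\<close>.\<close>

definition "Z = {v. kin I (dk v)}"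
definition "B = {dk w + i | w i. kin I i}"

lemma cycles: "koszul_cycles R xs = emb ` Z"
  unfolding koszul_cycles_def len_xs emb_surj emb_zero by (auto simp: emb_diff emb_eq Z_def)

lemma emb_B: "emb ` B = range (emb \<circ> dk)"
proof -
  have "emb (dk w + i) = emb (dk w)" if "kin I i" for w i using that by (simp add: emb_eq)
  moreover have "dk w \<in> B" for w using kin_simps(1)[OF I] by (force simp: B_def)
  ultimately show ?thesis by (auto simp: B_def)
qed

lemma boundaries: "koszul_boundaries R xs = emb ` B"
  unfolding koszul_boundaries_def len_xs emb_surj emb_B by (simp add: image_image emb_diff comp_def)

lemma Z_simps: "0 \<in> Z" "1 \<in> Z" "u \<in> Z \<Longrightarrow> v \<in> Z \<Longrightarrow> u + v \<in> Z" "u \<in> Z \<Longrightarrow> - u \<in> Z" "u \<in> Z \<Longrightarrow> v \<in> Z \<Longrightarrow> u * v \<in> Z"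
  "u \<in> Z \<Longrightarrow> v \<in> Z \<Longrightarrow> u - v \<in> Z"
  using kin_simps[OF I] by (auto simp: Z_def dk_add dk_diff dk_minus dk_mult)
    (auto simp: kin_def dk_def one_kos_def tidealD(1)[OF I])

lemma B_add: "u \<in> B \<Longrightarrow> v \<in> B \<Longrightarrow> u + v \<in> B"
proof -
  assume "u \<in> B" "v \<in> B"
  then obtain w i w' i' where *: "u = dk w + i" "v = dk w' + i'" "kin I i" "kin I i'" by (auto simp: B_def)
  then have "u + v = dk (w + w') + (i + i')" by (simp add: dk_add)
  then show "u + v \<in> B" using * kin_simps(2)[OF I] unfolding B_def by blast
qed

lemma B_minus: "u \<in> B \<Longrightarrow> - u \<in> B"
proof -
  assume "u \<in> B"
  then obtain w i where *: "u = dk w + i" "kin I i" by (auto simp: B_def)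
  then have "- u = dk (- w) + (- i)" by (simp add: dk_minus)
  then show "- u \<in> B" using * kin_simps(4)[OF I] unfolding B_def by blast
qed

lemma kin_B: "kin I i \<Longrightarrow> i \<in> B"
proof -
  assume "kin I i"
  moreover have "i = dk 0 + i" by (simp add: dk_def kos_defs kos.expand)
  ultimately show ?thesis unfolding B_def by blast
qed

lemma dk_B: "dk w \<in> B"
  using kin_simps(1)[OF I] unfolding B_def by force

lemma B_Z: "u \<in> B \<Longrightarrow> u \<in> Z"
  using kin_dk[OF I] by (auto simp: B_def Z_def dk_add dk_dk)

lemma B_mult: assumes "u \<in> B" "v \<in> Z" shows "u * v \<in> B" "v * u \<in> B"
proof -
  obtain w i where u: "u = dk w + i" "kin I i" using assms(1) by (auto simp: B_def)
  have v: "kin I (dk v)" using assms(2) by (simp add: Z_def)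
  have "u * v = dk (w * v) + (i * v - galt w * dk v)" by (simp add: u dk_mult algebra_simps)
  moreover have "kin I (i * v - galt w * dk v)"
    by (rule kin_simps(3)[OF I kin_simps(5)[OF I u(2)] kin_simps(6)[OF I v]])
  ultimately show "u * v \<in> B" unfolding B_def by blast
  \<comment> \<open>Since \<open>dk\<close> and \<open>galt\<close> anticommute, the Leibniz rule
    for \<open>galt v * w\<close> leaves the wanted term \<open>v * dk w\<close>.\<close>
  have g: "dk (galt v) = - galt (dk v)" by (rule kos_eqI) (simp_all add: dk_def galt_def algebra_simps)
  have "v * u = dk (galt v * w) + (v * i + galt (dk v) * w)"
    by (simp add: u dk_mult g galt_galt algebra_simps)
  moreover have "kin I (v * i + galt (dk v) * w)"
    by (rule kin_simps(2)[OF I kin_simps(6)[OF I u(2)] kin_simps(5)[OF I kin_simps(7)[OF I v]]])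
  ultimately show "v * u \<in> B" unfolding B_def by blast
qed

abbreviation "KZ \<equiv> KA\<lparr>carrier := emb ` Z\<rparr>"
abbreviation "A \<equiv> koszul_homology R xs"

lemma subring_Z: "subring (emb ` Z) KA"
proof -
  interpret ring KA by (rule KA_ring)
  show ?thesis
    by (rule subringI) (auto simp: emb_surj emb_one emb_minus emb_mult emb_add intro!: imageI Z_simps)
qed

lemma KZ_ring: "ring KZ"
  using ring.subring_is_ring[OF KA_ring subring_Z] .

lemma KZ_minus: "u \<in> Z \<Longrightarrow> \<ominus>\<^bsub>KZ\<^esub> emb u = emb (- u)"
proof -
  interpret ring KZ by (rule KZ_ring)
  assume "u \<in> Z"
  then show ?thesis by (intro minus_equality) (auto simp: emb_add emb_zero Z_simps)
qed

lemma ideal_B: "ideal (emb ` B) KZ"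
proof (rule idealI[OF KZ_ring])
  interpret ring KZ by (rule KZ_ring)
  have "0 \<in> B" by (rule kin_B[OF kin_simps(1)[OF I]])
  show "subgroup (emb ` B) (add_monoid KZ)"
  proof (rule group.subgroupI[OF a_group])
    show "inv\<^bsub>add_monoid KZ\<^esub> a \<in> emb ` B" if "a \<in> emb ` B" for a
    proof -
      obtain b where b: "b \<in> B" "a = emb b" using \<open>a \<in> emb ` B\<close> by blast
      show ?thesis using KZ_minus[OF B_Z[OF b(1)]] B_minus[OF b(1)] unfolding b(2) a_inv_def by simp
    qed
  qed (use \<open>0 \<in> B\<close> in \<open>auto simp: emb_add intro!: imageI B_Z B_add\<close>)
qed (auto simp: emb_mult intro: imageI B_mult)

lemma A_eq: "A = KZ Quot (emb ` B)"
  unfolding koszul_homology_def len_xs cycles boundaries ..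

definition hc :: "'k ps3 kos \<Rightarrow> (nat set \<Rightarrow> 'k ps3 set) set" where
  "hc v = emb ` B +>\<^bsub>KA\<^esub> emb v"

lemma hc_KZ: "hc v = emb ` B +>\<^bsub>KZ\<^esub> emb v"
  by (simp add: hc_def a_r_coset_def')

lemma hc_hom: "(\<lambda>w. emb ` B +>\<^bsub>KZ\<^esub> w) \<in> ring_hom KZ A"
  unfolding A_eq by (rule ideal.rcos_ring_hom[OF ideal_B])

lemma hc_mult: "u \<in> Z \<Longrightarrow> v \<in> Z \<Longrightarrow> hc u \<otimes>\<^bsub>A\<^esub> hc v = hc (u * v)"
  and hc_add: "u \<in> Z \<Longrightarrow> v \<in> Z \<Longrightarrow> hc u \<oplus>\<^bsub>A\<^esub> hc v = hc (u + v)"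
  using ring_hom_mult[OF hc_hom, of "emb u" "emb v"] ring_hom_add[OF hc_hom, of "emb u" "emb v"]
  by (auto simp: hc_KZ emb_mult emb_add)

lemma hc_one: "\<one>\<^bsub>A\<^esub> = hc 1"
  using ring_hom_one[OF hc_hom] by (simp add: hc_KZ emb_one)

lemma carrier_A: "carrier A = hc ` Z"
  unfolding A_eq by (auto simp: FactRing_def A_RCOSETS_def RCOSETS_def a_r_coset_def hc_KZ)

lemma hc_eq: "hc u = hc v \<longleftrightarrow> u - v \<in> B"
proof
  have "0 \<in> B" by (rule kin_B[OF kin_simps(1)[OF I]])
  assume "hc u = hc v"
  then have "emb u \<in> hc v" using \<open>0 \<in> B\<close> emb_add[of 0 u] by (force simp: hc_def a_r_coset_def')
  then obtain b where b: "b \<in> B" "emb u = emb (b + v)" by (auto simp: hc_def a_r_coset_def' emb_add)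
  then have "kin I (u - (b + v))" by (simp add: emb_eq)
  from B_add[OF kin_B[OF this] b(1)] show "u - v \<in> B" by simp
next
  have *: "hc u \<subseteq> hc v" if uv: "u - v \<in> B" for u v
  proof
    fix z assume "z \<in> hc u"
    then obtain b where b: "b \<in> B" "z = emb (b + u)" by (auto simp: hc_def a_r_coset_def' emb_add)
    have "z = emb (b + (u - v)) \<oplus>\<^bsub>KA\<^esub> emb v" using b by (simp add: emb_add)
    then show "z \<in> hc v" using B_add[OF b(1) uv] by (auto simp: hc_def a_r_coset_def')
  qed
  assume "u - v \<in> B"
  with *[of u v] *[of v u] B_minus[of "u - v"] show "hc u = hc v" by auto
qed

lemma hc_zero: "\<zero>\<^bsub>A\<^esub> = hc 0"
proof -
  have "\<zero>\<^bsub>A\<^esub> = emb ` B" unfolding A_eq by (simp add: FactRing_def[of KZ])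
  also have "\<dots> = hc 0"
    by (auto simp: hc_def a_r_coset_def' emb_add)
  finally show ?thesis .
qed

lemma A_ring: "ring A"
  unfolding A_eq by (rule ideal.quotient_is_ring[OF ideal_B])

end

section \<open>Degrees, linear combinations and bases in Koszul homology\<close>

definition sc :: "'a::comm_ring_1 \<Rightarrow> 'a kos" where "sc c = Kos c 0 0 0 0 0 0 0"

lemma sc_sel [simp]: "ks (sc c) = c" "ka1 (sc c) = 0" "ka2 (sc c) = 0" "ka3 (sc c) = 0"
  "kb1 (sc c) = 0" "kb2 (sc c) = 0" "kb3 (sc c) = 0" "kt (sc c) = 0"
  by (simp_all add: sc_def)

lemma times_kos_sel:
  "ks (u * v) = ks u * ks v"
  "ka1 (u * v) = ks u * ka1 v + ka1 u * ks v" "ka2 (u * v) = ks u * ka2 v + ka2 u * ks v"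
  "ka3 (u * v) = ks u * ka3 v + ka3 u * ks v"
  "kb1 (u * v) = ks u * kb1 v + kb1 u * ks v + ka2 u * ka3 v - ka3 u * ka2 v"
  "kb2 (u * v) = ks u * kb2 v + kb2 u * ks v + ka3 u * ka1 v - ka1 u * ka3 v"
  "kb3 (u * v) = ks u * kb3 v + kb3 u * ks v + ka1 u * ka2 v - ka2 u * ka1 v"
  "kt (u * v) = ks u * kt v + kt u * ks v + ka1 u * kb1 v + ka2 u * kb2 v + ka3 u * kb3 v
    + kb1 u * ka1 v + kb2 u * ka2 v + kb3 u * ka3 v"
  by (simp_all add: times_kos_def)

lemma sc_mult_sel [simp]: "ks (sc c * v) = c * ks v" "ka1 (sc c * v) = c * ka1 v" "ka2 (sc c * v) = c * ka2 v"
  "ka3 (sc c * v) = c * ka3 v" "kb1 (sc c * v) = c * kb1 v" "kb2 (sc c * v) = c * kb2 v"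
  "kb3 (sc c * v) = c * kb3 v" "kt (sc c * v) = c * kt v"
  by (simp_all add: times_kos_sel)

lemma sc_1: "sc 1 = 1" and sc_0: "sc 0 = 0" and sc_mult: "sc c * sc d = sc (c * d)"
  and sc_add: "sc c + sc d = sc (c + d)" and sc_minus: "- sc c = sc (- c)"
  by (simp_all add: sc_def kos_defs)

lemma dk_sc: "dk (sc c) = 0"
  by (rule kos_eqI) (simp_all add: dk_def)

definition kdeg :: "nat \<Rightarrow> 'a::comm_ring_1 kos \<Rightarrow> bool" where
  "kdeg p v \<longleftrightarrow> (p \<noteq> 0 \<longrightarrow> ks v = 0) \<and> (p \<noteq> 1 \<longrightarrow> ka1 v = 0 \<and> ka2 v = 0 \<and> ka3 v = 0) \<and>
     (p \<noteq> 2 \<longrightarrow> kb1 v = 0 \<and> kb2 v = 0 \<and> kb3 v = 0) \<and> (p \<noteq> 3 \<longrightarrow> kt v = 0)"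

definition ktrunc :: "nat \<Rightarrow> 'a::comm_ring_1 kos \<Rightarrow> 'a kos" where
  "ktrunc p v = Kos (if p = 0 then ks v else 0)
     (if p = 1 then ka1 v else 0) (if p = 1 then ka2 v else 0) (if p = 1 then ka3 v else 0)
     (if p = 2 then kb1 v else 0) (if p = 2 then kb2 v else 0) (if p = 2 then kb3 v else 0)
     (if p = 3 then kt v else 0)"

lemma kdeg_0: "kdeg 0 v \<longleftrightarrow> (\<exists>c. v = sc c)"
  by (cases v) (auto simp: kdeg_def sc_def)

text \<open>The coefficients are taken in Q instead of the residue field; by
  \<open>max_kills\<close> only their constant terms matter for cycles modulo boundaries.\<close>

definition comb :: "(nat \<Rightarrow> 'a::comm_ring_1) \<Rightarrow> 'a kos list \<Rightarrow> 'a kos" where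
  "comb c vs = (\<Sum>i<length vs. sc (c i) * vs ! i)"

lemma comb_Nil [simp]: "comb c [] = 0"
  by (simp add: comb_def)
lemma comb_Cons: "comb c (v # vs) = sc (c 0) * v + comb (\<lambda>i. c (Suc i)) vs"
  unfolding comb_def by (simp add: sum.lessThan_Suc_shift del: sum.lessThan_Suc)
lemma comb_minus: "comb (\<lambda>i. - c i) vs = - comb c vs"
  by (simp add: comb_def sum_negf flip: sc_minus)

context ps3_quot
begin

abbreviation "A0 \<equiv> koszul_homology_deg R xs 0"

lemma sc_Z [simp]: "sc c \<in> Z"
  using kin_simps(1)[OF I] by (simp add: Z_def dk_sc)

lemma sc_mult_Z: "v \<in> Z \<Longrightarrow> sc c * v \<in> Z"
  by (simp add: Z_simps)

lemma comb_Z: "set vs \<subseteq> Z \<Longrightarrow> comb c vs \<in> Z"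
  by (induct vs arbitrary: c) (auto simp: comb_Cons Z_simps sc_mult_Z)

text \<open>A scalar without constant term is itself a boundary, and boundaries form an ideal in the
  cycles.\<close>

lemma max_kills: assumes "ct c = 0" "v \<in> Z" shows "sc c * v \<in> B"
proof -
  have "sc c = dk (Kos 0 (dX c) (dY c) (dZ c) 0 0 0 0)"
    using ps3_decomp0[OF assms(1)] by (simp add: sc_def dk_def)
  then have "sc c \<in> B" by (simp add: dk_B)
  then show ?thesis by (rule B_mult(1)[OF _ assms(2)])
qed

lemma one_notin_B: "1 \<notin> B"
proof
  assume "1 \<in> B"
  then obtain w i where "1 = dk w + i" "kin I i" by (auto simp: B_def)
  then have "1 = ks (dk w) + ks i" "ks i \<in> I" by (auto simp: kin_def kos_defs)
  then have "ct (1 :: 'k ps3) = ct (ks (dk w)) + ct (ks i)" by (metis fps_add_nth)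
  also have "\<dots> = 0" using I_ct[OF \<open>ks i \<in> I\<close>] by (simp add: dk_def)
  finally show False by simp
qed

text \<open>The components outside degree \<open>p\<close> vanish only modulo \<open>I\<close>.
  Truncating changes the cycle by an element of \<open>B\<close>, so every class has a
  representative over Q that is truly homogeneous.\<close>

lemma hdeg: "koszul_homology_deg R xs p = hc ` {v \<in> Z. kdeg p v}"
proof -
  have deg: "(\<forall>S. S \<subseteq> {..<3} \<and> card S \<noteq> p \<longrightarrow> emb u S = \<zero>\<^bsub>R\<^esub>) \<longleftrightarrow> kin I (u - ktrunc p u)" for u
  proof -
    have "(\<forall>S. S \<subseteq> {..<3} \<and> card S \<noteq> p \<longrightarrow> emb u S = \<zero>\<^bsub>R\<^esub>) \<longleftrightarrow> (\<forall>S\<in>Pow {..<3}. card S \<noteq> p \<longrightarrow> kc u S \<in> I)"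
      by (auto simp: emb_def qm_0_iff[OF I])
    also have "\<dots> \<longleftrightarrow> kin I (u - ktrunc p u)"
      unfolding ball_Pow3
      using tidealD(5)[OF I, of "kb2 u"] tidealD(5)[OF I, of "- kb2 u"] tidealD(1)[OF I]
      by (auto simp: kin_def ktrunc_def kc_def)
    finally show ?thesis .
  qed
  have "koszul_homology_deg R xs p = {hc u | u. u \<in> Z \<and> kin I (u - ktrunc p u)}"
  proof
    show "koszul_homology_deg R xs p \<subseteq> {hc u | u. u \<in> Z \<and> kin I (u - ktrunc p u)}"
      unfolding koszul_homology_deg_def len_xs cycles boundaries deg[symmetric]
      by (auto simp: hc_def)
    show "{hc u | u. u \<in> Z \<and> kin I (u - ktrunc p u)} \<subseteq> koszul_homology_deg R xs p"
    proof safe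
      fix u assume "u \<in> Z" "kin I (u - ktrunc p u)"
      then show "hc u \<in> koszul_homology_deg R xs p"
        unfolding koszul_homology_deg_def len_xs cycles boundaries deg[symmetric] hc_def by blast
    qed
  qed
  also have "\<dots> = hc ` {v \<in> Z. kdeg p v}"
  proof safe
    fix u assume u: "u \<in> Z" "kin I (u - ktrunc p u)"
    have "ktrunc p u = u - (u - ktrunc p u)" by simp
    then have "ktrunc p u \<in> Z" using Z_simps(6)[OF u(1) B_Z[OF kin_B[OF u(2)]]] by simp
    moreover have "hc u = hc (ktrunc p u)" using kin_B[OF u(2)] by (simp add: hc_eq)
    moreover have "kdeg p (ktrunc p u)" by (simp add: kdeg_def ktrunc_def)
    ultimately show "hc u \<in> hc ` {v \<in> Z. kdeg p v}" by blast
  next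
    fix v assume v: "v \<in> Z" "kdeg p v"
    have "ktrunc p v = v" using v(2) by (intro kos_eqI) (auto simp: kdeg_def ktrunc_def)
    then show "\<exists>u. hc v = hc u \<and> u \<in> Z \<and> kin I (u - ktrunc p u)"
      using v kin_simps(1)[OF I] by force
  qed
  finally show ?thesis .
qed

lemma A0_eq: "A0 = {hc (sc c) | c. True}"
  unfolding hdeg kdeg_0 by auto

lemma Span_A: "set vs \<subseteq> Z \<Longrightarrow> ring.Span A A0 (map hc vs) = {hc (comb c vs) | c. True}"
proof (induct vs)
  case Nil
  then show ?case by (simp add: ring.Span.simps[OF A_ring] hc_zero)
next
  case (Cons v vs)
  have v: "v \<in> Z" "set vs \<subseteq> Z" using Cons by auto
  have "ring.Span A A0 (map hc (v # vs)) = ring.line_extension A A0 (hc v) (ring.Span A A0 (map hc vs))"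
    by (simp add: ring.Span.simps[OF A_ring])
  also have "\<dots> = {hc (sc d) \<otimes>\<^bsub>A\<^esub> hc v \<oplus>\<^bsub>A\<^esub> hc (comb c vs) | c d. True}"
    unfolding ring.line_extension_def[OF A_ring] Cons(1)[OF v(2)] unfolding A0_eq
    by (auto simp: set_add_def set_mult_def r_coset_def)
  also have "\<dots> = {hc (sc d * v + comb c vs) | c d. True}"
    by (simp add: hc_mult hc_add v comb_Z sc_mult_Z)
  also have "\<dots> = {hc (comb c (v # vs)) | c. True}"
  proof safe
    fix c d
    have "sc d * v + comb c vs = comb (case_nat d c) (v # vs)" by (simp add: comb_Cons)
    then show "\<exists>c'. hc (sc d * v + comb c vs) = hc (comb c' (v # vs)) \<and> True" by metis
  next
    fix c
    show "\<exists>c' d. hc (comb c (v # vs)) = hc (sc d * v + comb c' vs) \<and> True"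
      unfolding comb_Cons by blast
  qed
  finally show ?case .
qed

lemma indep_A:
  "set vs \<subseteq> Z \<Longrightarrow> (\<And>c i. comb c vs \<in> B \<Longrightarrow> i < length vs \<Longrightarrow> ct (c i) = 0) \<Longrightarrow>
    ring.independent A A0 (map hc vs)"
proof (induct vs)
  case Nil
  then show ?case using ring.independent.intros(1)[OF A_ring] by simp
next
  case (Cons v vs)
  have v: "v \<in> Z" "set vs \<subseteq> Z" using Cons(2) by auto
  have "ring.independent A A0 (map hc vs)"
  proof (rule Cons(1)[OF v(2)])
    fix c i assume c: "comb c vs \<in> B" "i < length vs"
    have "comb (case_nat 0 c) (v # vs) = comb c vs" by (simp add: comb_Cons sc_0)
    then show "ct (c i) = 0" using Cons(3)[of "case_nat 0 c" "Suc i"] c by simp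
  qed
  moreover have "hc v \<notin> ring.Span A A0 (map hc vs)"
  proof
    assume "hc v \<in> ring.Span A A0 (map hc vs)"
    then obtain c where "v - comb c vs \<in> B" using Span_A[OF v(2)] by (auto simp: hc_eq)
    \<comment> \<open>The head coefficient 1 has nonzero constant term, against the hypothesis on
      combinations in \<open>B\<close>.\<close>
    then have "comb (case_nat 1 (\<lambda>i. - c i)) (v # vs) \<in> B" by (simp add: comb_Cons sc_1 comb_minus)
    from Cons(3)[OF this, of 0] show False by simp
  qed
  moreover have "hc v \<in> carrier A" using v by (simp add: carrier_A)
  ultimately show ?case using ring.independent.intros(2)[OF A_ring] by simp
qed

lemma hc_minus: "v \<in> Z \<Longrightarrow> \<ominus>\<^bsub>A\<^esub> hc v = hc (- v)"
proof -
  interpret ring A by (rule A_ring)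
  assume "v \<in> Z"
  then show ?thesis by (intro minus_equality) (auto simp: hc_add hc_zero carrier_A Z_simps)
qed

text \<open>This is the residue field: scalars with nonzero constant term are units already in Q,
  and all others are zero by \<open>max_kills\<close>. The dimension in \<open>class_G\<close> is
  computed over this subfield.\<close>

lemma A0_subfield: "subfield A0 A"
proof (rule ring.subfieldI[OF A_ring])
  show "subcring A0 A"
  proof (rule ring.subcringI[OF A_ring ring.subringI[OF A_ring]])
    show "\<one>\<^bsub>A\<^esub> \<in> A0" unfolding A0_eq hc_one sc_1[symmetric] by blast
  qed (auto simp: A0_eq carrier_A hc_minus hc_mult hc_add sc_minus sc_mult sc_add mult.commute)
  interpret ring A by (rule A_ring)
  have ne: "hc 1 \<noteq> hc 0" using one_notin_B by (simp add: hc_eq)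
  show "Units (A\<lparr>carrier := A0\<rparr>) = A0 - {\<zero>\<^bsub>A\<^esub>}"
  proof (intro equalityI subsetI)
    fix x assume x: "x \<in> Units (A\<lparr>carrier := A0\<rparr>)"
    then have "x \<in> A0" by (simp add: Units_def)
    moreover have "\<zero>\<^bsub>A\<^esub> \<notin> Units (A\<lparr>carrier := A0\<rparr>)"
    proof
    assume "\<zero>\<^bsub>A\<^esub> \<in> Units (A\<lparr>carrier := A0\<rparr>)"
    then obtain y where y: "y \<in> A0" "y \<otimes>\<^bsub>A\<^esub> \<zero>\<^bsub>A\<^esub> = \<one>\<^bsub>A\<^esub>" by (auto simp: Units_def)
    then obtain c where "y = hc (sc c)" unfolding A0_eq by blast
    then have "y \<otimes>\<^bsub>A\<^esub> \<zero>\<^bsub>A\<^esub> = hc 0" unfolding hc_zero by (simp add: hc_mult Z_simps(1))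
    with y ne show False unfolding hc_one by simp
    qed
    ultimately show "x \<in> A0 - {\<zero>\<^bsub>A\<^esub>}" using x by blast
  next
    fix x assume x: "x \<in> A0 - {\<zero>\<^bsub>A\<^esub>}"
    then obtain c where c: "x = hc (sc c)" by (auto simp: A0_eq)
    have "ct c \<noteq> 0" using max_kills[of c 1] x by (auto simp: c hc_zero hc_eq Z_simps)
      then obtain g where "c * g = 1" using ps3_unit by blast
      then have "x \<otimes>\<^bsub>A\<^esub> hc (sc g) = \<one>\<^bsub>A\<^esub>" "hc (sc g) \<otimes>\<^bsub>A\<^esub> x = \<one>\<^bsub>A\<^esub>"
        by (simp_all add: c hc_mult sc_mult hc_one sc_1 mult.commute)
      moreover have "hc (sc g) \<in> A0" by (auto simp: A0_eq)
      ultimately show "x \<in> Units (A\<lparr>carrier := A0\<rparr>)" using x by (auto simp: Units_def)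
  qed
qed

lemma homology_basisI:
  assumes "\<And>v. v \<in> set vs \<Longrightarrow> v \<in> Z \<and> kdeg p v"
    and "\<And>v. v \<in> Z \<Longrightarrow> kdeg p v \<Longrightarrow> \<exists>c. v - comb c vs \<in> B"
    and "\<And>c i. comb c vs \<in> B \<Longrightarrow> i < length vs \<Longrightarrow> ct (c i) = 0"
  shows "homology_basis R xs p (map hc vs)"
proof -
  have vs: "set vs \<subseteq> Z" using assms(1) by auto
  have deg: "kdeg p (comb c vs)" for c
    using assms(1)
  proof (induct vs arbitrary: c)
    case Nil then show ?case by (simp add: kdeg_def)
  next
    case (Cons a vs)
    then have "kdeg p a" "kdeg p (comb (\<lambda>i. c (Suc i)) vs)" by auto
    then show ?case unfolding comb_Cons by (auto simp: kdeg_def)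
  qed
  have "{hc (comb c vs) | c. True} = hc ` {v \<in> Z. kdeg p v}"
    using deg comb_Z[OF vs] assms(2) by (auto simp: hc_eq[symmetric])
  then show ?thesis
    unfolding homology_basis_def Span_A[OF vs] using indep_A[OF vs] assms(3) by (simp add: hdeg)
qed

lemma basis_dim:
  assumes "homology_basis R xs p bs"
  shows "ring.dim A A0 (koszul_homology_deg R xs p) = length bs"
proof -
  have "ring.dimension A (length bs) A0 (koszul_homology_deg R xs p)"
    using ring.dimensionI[OF A_ring A0_subfield] assms unfolding homology_basis_def by blast
  from ring.dimI[OF A_ring A0_subfield this] show ?thesis by (simp add: over_def)
qed

lemma I_sub_square: "I \<subseteq> max_ideal TA \<cdot>\<^bsub>TA\<^esub> max_ideal TA"
proof
  fix f assume f: "f \<in> I"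
  have c: "ct f = 0" "ct (dX f) = 0" "ct (dY f) = 0" "ct (dZ f) = 0"
    using ordge_2D[OF I2[OF f]] by auto
  let ?P = "ideal_prod TA (max_ideal TA) (max_ideal TA) :: 'k ps3 set"
  have p: "a \<in> max_ideal TA \<Longrightarrow> b \<in> max_ideal TA \<Longrightarrow> a * b \<in> ?P" for a b :: "'k ps3"
    using ideal_prod.prod[of a "max_ideal TA" b "max_ideal TA" TA] by simp
  have s: "a \<in> ?P \<Longrightarrow> b \<in> ?P \<Longrightarrow> a + b \<in> ?P" for a b :: "'k ps3"
    using ideal_prod.sum[of a TA "max_ideal TA" "max_ideal TA" b] by simp
  have "vX * dX f + vY * dY f + vZ * dZ f \<in> ?P"
    by (intro s p) (simp_all add: max_ideal_TA c del: d_nth)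
  then show "f \<in> ?P" using ps3_decomp0[OF c(1)] by simp
qed

text \<open>Only the products of \<open>E\<close> with \<open>E\<close> and with \<open>F\<close>
  carry information. Products within \<open>F\<close>, and products of \<open>G\<close> with
  anything of positive degree, vanish in the exterior algebra on three generators, and elements of
  degrees 1 and 2 commute.\<close>

lemma class_GI:
  assumes r: "2 \<le> r" "r \<le> length E" "r \<le> length F" "1 \<le> length G"
    and len: "min_num_gens TA I = length E" "length F + 1 = length E + length G"
    and pd: "proj_dim TA (quotient_module TA I) = 3"
    and E: "\<And>v. v \<in> set E \<Longrightarrow> v \<in> Z \<and> kdeg 1 v"
    and F: "\<And>v. v \<in> set F \<Longrightarrow> v \<in> Z \<and> kdeg 2 v"
    and G: "\<And>v. v \<in> set G \<Longrightarrow> v \<in> Z \<and> kdeg 3 v"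
    and span: "\<And>v. v \<in> Z \<Longrightarrow> kdeg 1 v \<Longrightarrow> \<exists>c. v - comb c E \<in> B"
      "\<And>v. v \<in> Z \<Longrightarrow> kdeg 2 v \<Longrightarrow> \<exists>c. v - comb c F \<in> B"
      "\<And>v. v \<in> Z \<Longrightarrow> kdeg 3 v \<Longrightarrow> \<exists>c. v - comb c G \<in> B"
    and indep: "\<And>c i. comb c E \<in> B \<Longrightarrow> i < length E \<Longrightarrow> ct (c i) = 0"
      "\<And>c i. comb c F \<in> B \<Longrightarrow> i < length F \<Longrightarrow> ct (c i) = 0"
      "\<And>c i. comb c G \<in> B \<Longrightarrow> i < length G \<Longrightarrow> ct (c i) = 0"
    and EE: "\<And>u v. u \<in> set E \<Longrightarrow> v \<in> set E \<Longrightarrow> u * v \<in> B"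
    and EF: "\<And>i j. i < length E \<Longrightarrow> j < length F \<Longrightarrow> E ! i * F ! j - (if i = j \<and> i < r then G ! 0 else 0) \<in> B"
  shows "class_G TA I r"
proof -
  have basis: "homology_basis R xs 1 (map hc E)" "homology_basis R xs 2 (map hc F)" "homology_basis R xs 3 (map hc G)"
    by (rule homology_basisI; (use E F G span indep in blast))+
  have Q: "hc u \<otimes>\<^bsub>A\<^esub> hc v = (if \<exists>i<r. (hc u = hc (E ! i) \<and> hc v = hc (F ! i)) \<or> (hc u = hc (F ! i) \<and> hc v = hc (E ! i))
                   then hc (G ! 0) else \<zero>\<^bsub>A\<^esub>)" (is "_ = (if ?C then _ else _)")
    if uv: "u \<in> set E \<union> set F \<union> set G" "v \<in> set E \<union> set F \<union> set G" for u v
  proof -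
    have Zm: "w \<in> Z" if "w \<in> set E \<union> set F \<union> set G" for w using E F G that by blast
    have B0: "0 \<in> B" by (rule kin_B[OF kin_simps(1)[OF I]])
    have comm: "a * b = b * a" if "a \<in> set E" "b \<in> set F" for a b
      using E[OF that(1)] F[OF that(2)] by (intro kos_eqI) (simp_all add: kdeg_def times_kos_sel)
    have EFm: "hc (E ! i * F ! j) = (if i = j \<and> i < r then hc (G ! 0) else hc 0)" if "i < length E" "j < length F" for i j
      using EF[OF that] by (auto simp: hc_eq split: if_splits)
    show ?thesis
    proof (cases ?C)
      \<comment> \<open>The condition compares homology classes, so \<open>u\<close> and
        \<open>v\<close> are replaced by list entries with the same classes before
        multiplying.\<close>
      case True
      then obtain i where i: "i < r" "(hc u = hc (E ! i) \<and> hc v = hc (F ! i)) \<or> (hc u = hc (F ! i) \<and> hc v = hc (E ! i))" by blast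
      have m: "E ! i \<in> set E" "F ! i \<in> set F" using i r by auto
      have "hc u \<otimes>\<^bsub>A\<^esub> hc v = hc (E ! i * F ! i)"
        using i(2) m Zm comm[OF m] by (auto simp: hc_mult)
      then show ?thesis using True EFm[of i i] i r by simp
    next
      case False
      have "hc (u * v) = hc 0"
      proof -
        consider "u \<in> set E" "v \<in> set E" | "u \<in> set E" "v \<in> set F" | "u \<in> set F" "v \<in> set E"
          | "u \<in> set F" "v \<in> set F" | "u \<in> set G" | "v \<in> set G" using uv by blast
        then show ?thesis
        proof cases
          case 1 then show ?thesis using EE by (simp add: hc_eq)
        next
          case 2
          then obtain i j where ij: "i < length E" "j < length F" "u = E ! i" "v = F ! j" by (metis in_set_conv_nth)
          then have n: "\<not> (i = j \<and> i < r)" using False by blast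
          show ?thesis unfolding ij(3,4) EFm[OF ij(1,2)] by (rule if_not_P[OF n])
        next
          case 3
          then obtain i j where ij: "i < length E" "j < length F" "v = E ! i" "u = F ! j" by (metis in_set_conv_nth)
          then have n: "\<not> (i = j \<and> i < r)" using False by blast
          show ?thesis unfolding comm[OF 3(2,1), symmetric] unfolding ij(3,4) EFm[OF ij(1,2)] by (rule if_not_P[OF n])
        next
          case 4
          then have "u * v = 0" using F[of u] F[of v] by (intro kos_eqI) (simp_all add: kdeg_def times_kos_sel)
          then show ?thesis by simp
        next
          case 5
          have "ks v = 0" using uv(2) E[of v] F[of v] G[of v] by (auto simp: kdeg_def)
          then have "u * v = 0" using G[OF 5] by (intro kos_eqI) (simp_all add: kdeg_def times_kos_sel)
          then show ?thesis by simp
        next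
          case 6
          have "ks u = 0" using uv(1) E[of u] F[of u] G[of u] by (auto simp: kdeg_def)
          then have "u * v = 0" using G[OF 6] by (intro kos_eqI) (simp_all add: kdeg_def times_kos_sel)
          then show ?thesis by simp
        qed
      qed
      then have "hc u \<otimes>\<^bsub>A\<^esub> hc v = \<zero>\<^bsub>A\<^esub>"
        unfolding hc_zero hc_mult[OF Zm[OF uv(1)] Zm[OF uv(2)]] .
      then show ?thesis unfolding if_not_P[OF False] .
    qed
  qed
  have prod: "\<forall>u \<in> set (map hc E @ map hc F @ map hc G). \<forall>v \<in> set (map hc E @ map hc F @ map hc G).
                u \<otimes>\<^bsub>A\<^esub> v =
                  (if \<exists>i<r. (u = map hc E ! i \<and> v = map hc F ! i) \<or> (u = map hc F ! i \<and> v = map hc E ! i)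
                   then map hc G ! 0 else \<zero>\<^bsub>A\<^esub>)"
  proof (intro ballI)
    fix u v assume "u \<in> set (map hc E @ map hc F @ map hc G)" "v \<in> set (map hc E @ map hc F @ map hc G)"
    then obtain u' v' where u': "u = hc u'" "u' \<in> set E \<union> set F \<union> set G" and v': "v = hc v'" "v' \<in> set E \<union> set F \<union> set G"
      by auto
    have n: "i < r \<Longrightarrow> map hc E ! i = hc (E ! i)" "i < r \<Longrightarrow> map hc F ! i = hc (F ! i)" for i using r by auto
    have n0: "map hc G ! 0 = hc (G ! 0)" using r(4) by (cases G) auto
    have c: "(\<exists>i<r. (u = map hc E ! i \<and> v = map hc F ! i) \<or> (u = map hc F ! i \<and> v = map hc E ! i)) \<longleftrightarrow>
      (\<exists>i<r. (u = hc (E ! i) \<and> v = hc (F ! i)) \<or> (u = hc (F ! i) \<and> v = hc (E ! i)))"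
      using n by metis
    show "u \<otimes>\<^bsub>A\<^esub> v = (if \<exists>i<r. (u = map hc E ! i \<and> v = map hc F ! i) \<or> (u = map hc F ! i \<and> v = map hc E ! i)
                   then map hc G ! 0 else \<zero>\<^bsub>A\<^esub>)"
      unfolding c n0 using Q[OF u'(2) v'(2)] u'(1) v'(1) by simp
  qed
  have t: "ring.dim A A0 (koszul_homology_deg R xs 3) = length G"
    using basis_dim[OF basis(3)] by simp
  show ?thesis
    unfolding class_G_def Let_def
    apply (intro conjI)
        apply (rule r(1))
       apply (simp add: ideal_TA I)
      apply (rule I_sub_square)
     apply (rule pd)
    apply (rule exI[of _ xs], intro conjI, rule min_gen_xs)
    apply (rule exI[of _ "map hc E"], rule exI[of _ "map hc F"], rule exI[of _ "map hc G"])
    apply (unfold t)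
    apply (intro conjI basis prod)
    using r len by simp_all
qed

end

section \<open>Order of vanishing\<close>

lemma ordge_mono: "ordge d f \<Longrightarrow> e \<le> d \<Longrightarrow> ordge e f"
  by (auto simp: ordge_def)
lemma ordge_0 [simp]: "ordge 0 f"
  by (simp add: ordge_def)
lemma ordge_zero [simp]: "ordge d 0"
  by (simp add: ordge_def)
lemma ordge_add: "ordge d f \<Longrightarrow> ordge d g \<Longrightarrow> ordge d (f + g)"
  and ordge_diff: "ordge d f \<Longrightarrow> ordge d g \<Longrightarrow> ordge d (f - g)"
  and ordge_minus: "ordge d f \<Longrightarrow> ordge d (- f)"
  by (auto simp: ordge_def)
lemma ordge_v: "ordge d f \<Longrightarrow> ordge (Suc d) (vX * f)" "ordge d f \<Longrightarrow> ordge (Suc d) (vY * f)"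
  "ordge d f \<Longrightarrow> ordge (Suc d) (vZ * f)"
  by (auto simp: ordge_def)
lemma ordge_d: "ordge (Suc d) f \<Longrightarrow> ordge d (dX f)" "ordge (Suc d) f \<Longrightarrow> ordge d (dY f)"
  "ordge (Suc d) f \<Longrightarrow> ordge d (dZ f)"
  by (auto simp: ordge_def)
lemma ordge_ct: "ordge (Suc d) f \<Longrightarrow> ct f = 0"
  by (auto simp: ordge_def)

lemma ordge_mult: "ordge a f \<Longrightarrow> ordge b g \<Longrightarrow> ordge (a + b) (f * g)"
proof (induct a arbitrary: f b g)
  case 0
  have "ordge b (f * g)"
    using 0(2)
  proof (induct b arbitrary: g)
    case (Suc b)
    have "f * g = vX * (f * dX g) + vY * (f * dY g) + vZ * (f * dZ g)"
      using arg_cong[OF ps3_decomp0[OF ordge_ct[OF Suc(2)]], of "\<lambda>t. f * t"] by (simp only: algebra_simps)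
    also have "ordge (Suc b) \<dots>" by (intro ordge_add ordge_v Suc(1) ordge_d Suc(2))
    finally show ?case .
  qed simp
  then show ?case by simp
next
  case (Suc a)
  have "f * g = vX * (dX f * g) + vY * (dY f * g) + vZ * (dZ f * g)"
    using arg_cong[OF ps3_decomp0[OF ordge_ct[OF Suc(2)]], of "\<lambda>t. t * g"] by (simp only: algebra_simps)
  also have "ordge (Suc (a + b)) \<dots>" by (intro ordge_add ordge_v Suc(1) ordge_d Suc(2,3))
  finally show ?case by simp
qed

lemma ordge_W: "d \<le> a + b + c \<Longrightarrow> ordge d (W a b c)"
  by (auto simp: ordge_L_iff L_W)

text \<open>A series of order \<open>d\<close> is a finite combination of the monomials of degree
  \<open>d\<close> with power series coefficients. One variable is split off at a time, and the
  induction continues with the colon ideal of \<open>J\<close> by that variable.\<close>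

lemma ordge_in_tideal:
  assumes "tideal J" "\<And>a b c. a + b + c = d \<Longrightarrow> vX ^ a * (vZ ^ c * vY ^ b) \<in> J" "ordge d f"
  shows "f \<in> J"
  using assms
proof (induct d arbitrary: J f)
  case 0
  then have "1 \<in> J" using 0(2)[of 0 0 0] by simp
  then show ?case using tidealD(3)[OF 0(1), of 1 f] by simp
next
  case (Suc d)
  have *: "v * h \<in> J" if h: "ordge d h"
    and v: "\<And>a b c. a + b + c = d \<Longrightarrow> v * (vX ^ a * (vZ ^ c * vY ^ b)) \<in> J" for v h
  proof -
    have "tideal {h. v * h \<in> J}"
      unfolding tideal_def using tidealD(1,2,3)[OF Suc(2)]
      by (simp add: distrib_left mult.left_commute[of v])
    then have "h \<in> {h. v * h \<in> J}" by (rule Suc(1)) (use v h in auto)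
    then show ?thesis by simp
  qed
  have m: "vX * (vX ^ a * (vZ ^ c * vY ^ b)) \<in> J" "vY * (vX ^ a * (vZ ^ c * vY ^ b)) \<in> J"
      "vZ * (vX ^ a * (vZ ^ c * vY ^ b)) \<in> J" if "a + b + c = d" for a b c
    using Suc(3)[of "Suc a" b c] Suc(3)[of a "Suc b" c] Suc(3)[of a b "Suc c"] that
    by (simp_all add: algebra_simps)
  have "f = vX * dX f + vY * dY f + vZ * dZ f" using ps3_decomp0[OF ordge_ct[OF Suc(4)]] .
  moreover have "vX * dX f \<in> J" by (rule *[OF ordge_d(1)[OF Suc(4)] m(1)])
  moreover have "vY * dY f \<in> J" by (rule *[OF ordge_d(2)[OF Suc(4)] m(2)])
  moreover have "vZ * dZ f \<in> J" by (rule *[OF ordge_d(3)[OF Suc(4)] m(3)])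
  ultimately show ?case using tidealD(2)[OF Suc(2)] by metis
qed

subsection \<open>The trimmed Gorenstein ideal\<close>

definition LamG :: "nat \<Rightarrow> (nat \<times> nat \<times> nat) set" where
  "LamG k = {(a, b, c). a + b < k \<and> b + c < k}"

text \<open>The triple of the trimmed generator: \<open>be = 0\<close> stands for \<sigma> = x^k and
  \<open>be = 1\<close> for \<sigma> = x^(k-1) U_1.\<close>

definition sig :: "nat \<Rightarrow> nat \<Rightarrow> nat \<times> nat \<times> nat" where
  "sig k be = (k - be, be, 0)"

definition Lam :: "nat \<Rightarrow> nat \<Rightarrow> (nat \<times> nat \<times> nat) set" where
  "Lam k be = insert (sig k be) (LamG k)"

lemma finite_LamG: "finite (LamG k)"
proof -
  have "LamG k \<subseteq> {..k} \<times> {..k} \<times> {..k}" by (auto simp: LamG_def)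
  then show ?thesis by (rule finite_subset) auto
qed

lemma order_closed_LamG: "order_closed (LamG k)"
  by (auto simp: order_closed_def LamG_def)

locale trim = ps3_quot I for I :: "'k::field ps3 set" +
  fixes k be :: nat
  assumes k: "3 \<le> k" and be: "be \<le> 1" and I_eq: "I = IL (Lam k be)"
begin

abbreviation "sgm \<equiv> sig k be"
abbreviation "tpm \<equiv> (k - 1, 0 :: nat, k - 1)"
abbreviation "g \<equiv> IL (LamG k) :: 'k ps3 set"
abbreviation \<phi> :: "'k ps3 \<Rightarrow> 'k" where "\<phi> \<equiv> L (k - 1) 0 (k - 1)"

lemma be_cases: obtains "be = 0" | "be = 1" using be by linarith

lemma Lam_iff: "(a, b, c) \<in> Lam k be \<longleftrightarrow> (a = k - be \<and> b = be \<and> c = 0) \<or> (a + b < k \<and> b + c < k)"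
  by (auto simp: Lam_def LamG_def sig_def)

lemma finite_Lam: "finite (Lam k be)"
  by (simp add: Lam_def finite_LamG)

lemma order_closed_Lam: "order_closed (Lam k be)"
  unfolding order_closed_def Lam_iff using k be by auto

lemma Lam_tdeg: "l \<in> Lam k be \<Longrightarrow> tdeg l < 2 * k - 1"
  using k be by (cases l) (auto simp: Lam_iff)

text \<open>The two inequalities add up to a + 2 b + c <= 2 k - 2, so degree 2 k - 2 forces b = 0
  and a = c = k - 1. The triple of \<sigma> has degree k, which is smaller because k >= 3.\<close>

lemma Lam_tdeg': "l \<in> Lam k be \<Longrightarrow> l \<noteq> tpm \<Longrightarrow> tdeg l < 2 * k - 2"
  using k be by (cases l) (auto simp: Lam_iff)

lemma ordge_LT: "ordge d f \<Longrightarrow> tdeg l < d \<Longrightarrow> LT l f = 0"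
  by (cases l) (simp add: ordge_L)

lemma ordge_I: "ordge (2 * k - 1) f \<Longrightarrow> f \<in> I"
  unfolding I_eq IL_def using ordge_LT Lam_tdeg by blast

lemma g_sub: "I \<subseteq> g" by (auto simp: I_eq IL_def Lam_def)

lemma WT_I: "m \<notin> Lam k be \<Longrightarrow> WT m \<in> I"
  unfolding I_eq by (rule WT_in_IL)
lemma WT_g: "m \<notin> LamG k \<Longrightarrow> WT m \<in> g"
  by (rule WT_in_IL)

lemma g_mult: "f \<in> g \<Longrightarrow> h * f \<in> g" "f \<in> g \<Longrightarrow> f * h \<in> g"
  using IL_mult[OF order_closed_LamG] IL_mult'[OF order_closed_LamG] by auto

lemma phi_g: "f \<in> g \<Longrightarrow> \<phi> f = 0"
proof -
  assume "f \<in> g"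
  moreover have "tpm \<in> LamG k" using k by (auto simp: LamG_def)
  ultimately have "LT tpm f = 0" unfolding IL_def by blast
  then show ?thesis by simp
qed

lemma phi_I: "f \<in> I \<Longrightarrow> \<phi> f = 0" using phi_g g_sub by blast

lemma LT_I: "f \<in> I \<Longrightarrow> l \<in> Lam k be \<Longrightarrow> LT l f = 0"
  by (simp add: I_eq IL_def)

lemma sig_notin: "sgm \<notin> LamG k" using be k by (auto simp: sig_def LamG_def)

lemma g_remove: "f \<in> g \<Longrightarrow> f - cst (LT sgm f) * WT sgm \<in> I"
proof -
  assume "f \<in> g"
  moreover have "LamG k = Lam k be - {sgm}" using sig_notin by (auto simp: Lam_def)
  ultimately show ?thesis unfolding I_eq by (intro IL_remove) simp
qed

text \<open>The generator of \<open>g\<close> of weight \<open>w\<close>, where x, y, z have weights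
  1, 0, -1: the triple of x^w U_(k-w) for w >= 0 and of z^(-w) U_(k+w) for w < 0.\<close>

definition cn :: "int \<Rightarrow> nat \<times> nat \<times> nat" where
  "cn w = (nat w, k - nat \<bar>w\<bar>, nat (- w))"
abbreviation "js \<equiv> int k - int be"
abbreviation "rng \<equiv> {- int k .. int k}"
text \<open>Trimming replaces \<sigma> by x \<sigma>, y \<sigma> and z \<sigma>. These are already
  generated by the other corners, except for x^(k+1) when \<sigma> = x^k.\<close>

definition "Cs = cn ` (rng - {js}) \<union> (if be = 0 then {(k + 1, 0, 0)} else {})"

lemma cn_inj: "inj cn"
  by (rule inj_on_inverseI[where g = "\<lambda>(a, b, c). int a - int c"]) (auto simp: cn_def)

lemma cn_js: "cn js = sgm"
  using k be by (auto simp: cn_def sig_def)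

lemma cn_cases:
  assumes "w \<in> rng"
  obtains a where "a \<le> k" "cn w = (a, k - a, 0)" "w = int a" | c where "c \<le> k" "c > 0" "cn w = (0, k - c, c)" "w = - int c"
proof (cases "w \<ge> 0")
  case True
  then show ?thesis using that(1)[of "nat w"] assms by (auto simp: cn_def)
next
  case False
  then show ?thesis using that(2)[of "nat (- w)"] assms by (auto simp: cn_def)
qed

lemma cn_notin_LamG: "w \<in> rng \<Longrightarrow> cn w \<notin> LamG k"
  by (erule cn_cases) (auto simp: LamG_def)

lemma Cs_Lam: "m \<in> Cs \<Longrightarrow> m \<notin> Lam k be"
proof -
  assume m: "m \<in> Cs"
  have "cn w \<noteq> sgm" if "w \<in> rng - {js}" for w
    using that cn_js cn_inj by (metis DiffE injD insertI1)
  then show ?thesis using m cn_notin_LamG be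
    by (auto simp: Cs_def Lam_def split: if_splits) (auto simp: LamG_def sig_def)
qed

lemma cn_Cs: "w \<in> rng \<Longrightarrow> w \<noteq> js \<Longrightarrow> cn w \<in> Cs"
  by (auto simp: Cs_def)

lemma Cs_L: "(a, k - a, 0) \<in> Cs" if "a \<le> k" "(a, k - a, 0) \<noteq> sgm"
proof -
  have "cn (int a) = (a, k - a, 0)" by (simp add: cn_def)
  then show ?thesis using that cn_Cs[of "int a"] cn_js by fastforce
qed

lemma Cs_R: "(0, k - c, c) \<in> Cs" if "c \<le> k" "0 < c"
proof -
  have "cn (- int c) = (0, k - c, c)" using that by (simp add: cn_def)
  then show ?thesis using that cn_Cs[of "- int c"] be k by fastforce
qed

text \<open>A corner is a minimal triple outside the order ideal: every move leads from it into
  \<open>Lam k be\<close>, where \<open>I\<close> vanishes. So \<open>LT m\<close> kills the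
  products of \<open>I\<close> with the maximal ideal; these are the functionals that count minimal
  generators.\<close>

lemma corner_scale:
  assumes m: "m \<in> Cs" and f: "f \<in> I"
  shows "LT m (h * f) = ct h * LT m f"
proof -
  have v: "LT m (vX * f) = 0 \<and> LT m (vY * f) = 0 \<and> LT m (vZ * f) = 0" if f: "f \<in> I" for f
  proof -
    have L0: "L a b c f = 0" if "(a, b, c) \<in> Lam k be" for a b c using LT_I[OF f that] by simp
    have "m \<in> cn ` (rng - {js}) \<or> be = 0 \<and> m = (k + 1, 0, 0)"
      using m by (auto simp: Cs_def split: if_splits)
    then consider w where "w \<in> rng" "w \<noteq> js" "m = cn w" | "be = 0" "m = (k + 1, 0, 0)"
      by blast
    then show ?thesis
    proof cases
      case 1
      from 1(1) show ?thesis
      proof (cases rule: cn_cases)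
        case (1 a)
        show ?thesis unfolding \<open>m = cn w\<close> 1(2) using 1(1) by (auto simp: L0 Lam_iff)
      next
        case (2 c)
        show ?thesis unfolding \<open>m = cn w\<close> 2(3) using 2(1,2) by (auto simp: L0 Lam_iff)
      qed
    next
      case 2
      have "(k, 0, 0) \<in> Lam k be" using 2(1) unfolding Lam_iff by simp
      then show ?thesis unfolding 2(2) by (simp add: L0)
    qed
  qed
  have "h * f = cst (ct h) * f + vX * (dX h * f) + vY * (dY h * f) + vZ * (dZ h * f)"
    using arg_cong[OF ps3_decomp[of h], of "\<lambda>t. t * f"] by (simp only: algebra_simps)
  then show ?thesis using v[OF tidealD(3)[OF I f]] by (simp only: LT_add LT_cst add_0_right)
qed

text \<open>Weight 3 for \<open>b\<close> and 2 for \<open>a\<close> and \<open>c\<close> lets the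
  measure drop both under division by x or z and under the recurrence, which lowers \<open>b\<close>
  by two while raising \<open>a\<close> and \<open>c\<close> by one.\<close>

lemma WT_in_gen:
  assumes J: "tideal J" and gen: "\<And>m. m \<in> Cs \<Longrightarrow> WT m \<in> J"
  shows "(a, b, c) \<notin> Lam k be \<Longrightarrow> WT (a, b, c) \<in> (J :: 'k ps3 set)"
proof (induct "2 * a + 2 * c + 3 * b" arbitrary: a b c rule: less_induct)
  case less
  have X: "WT (a, b, c) \<in> J" if "a = Suc a'" "(a', b, c) \<notin> Lam k be" for a'
    using less(1)[OF _ that(2)] that tidealD(3)[OF J] by (simp del: WT.simps flip: vX_WT)
  have Z: "WT (a, b, c) \<in> J" if "c = Suc c'" "(a, b, c') \<notin> Lam k be" for c'
    using less(1)[OF _ that(2)] that tidealD(3)[OF J] by (simp del: WT.simps flip: vZ_WT)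
  have nG: "a + b \<ge> k \<or> b + c \<ge> k" using less(2) by (auto simp: Lam_iff)
  show ?case
  proof (cases "b > k")
    case True
    then obtain b' where b': "b = Suc (Suc b')" "Suc b' \<ge> k" using that[of "b - 2"] True k by (simp add: numeral_2_eq_2)
    have 1: "WT (a, Suc b', c) \<in> J" by (rule less(1)) (use b' k be in \<open>auto simp: Lam_iff\<close>)
    have 2: "WT (Suc a, b', Suc c) \<in> J" by (rule less(1)) (use b' k be in \<open>auto simp: Lam_iff\<close>)
    have eq: "WT (a, b, c) = vY * WT (a, Suc b', c) - WT (Suc a, b', Suc c)"
      unfolding vY_WT by (simp add: b')
    show ?thesis unfolding eq by (rule tidealD(6)[OF J tidealD(3)[OF J 1] 2])
  next
    case False
    show ?thesis
    proof (cases "b + c \<ge> k")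
      case bc: True
      show ?thesis
      proof (cases a)
        case 0
        show ?thesis
        proof (cases "b + c = k")
          case True
          show ?thesis
          proof (cases "c = 0")
            case True
            then show ?thesis using \<open>b + c = k\<close> 0 Cs_L[of 0] gen[of "(0, k, 0)"] less(2) by (auto simp: Lam_def)
          next
            case False
            then show ?thesis using \<open>b + c = k\<close> 0 Cs_R[of c] gen[of "(0, k - c, c)"]
              by (metis add_diff_cancel_right' bot_nat_0.not_eq_extremum le_add2)
          qed
        next
          case neq: False
          then obtain c' where c': "c = Suc c'" using bc \<open>\<not> b > k\<close> by (cases c) auto
          show ?thesis by (rule Z[OF c']) (use bc neq c' 0 k be in \<open>auto simp: Lam_iff\<close>)
        qed
      next
        case (Suc a')
        show ?thesis
        proof (cases "(a', b, c) \<notin> Lam k be")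
          case True then show ?thesis by (rule X[OF Suc])
        next
          case False
          then have "c = 0" "b = be" using bc by (auto simp: Lam_iff)
          then show ?thesis using bc be k by simp
        qed
      qed
    next
      case bc: False
      then have ab: "a + b \<ge> k" using nG by simp
      show ?thesis
      proof (cases c)
        case 0
        show ?thesis
        proof (cases "a + b = k")
          case True
          then have "(a, b, c) = (a, k - a, 0)" "a \<le> k" using 0 by auto
          then show ?thesis using Cs_L[of a] gen less(2) by (metis Lam_def insertI1)
        next
          case neq: False
          then obtain a' where a': "a = Suc a'" using ab \<open>\<not> b > k\<close> by (cases a) auto
          show ?thesis
          proof (cases "(a', b, c) \<notin> Lam k be")
            case True then show ?thesis by (rule X[OF a'])
          next
            case False
            \<comment> \<open>The triple is that of x \<sigma>: the extra generator x^(k+1) if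
              \<sigma> = x^k, and y x^k otherwise.\<close>
            then have s: "a' = k - be" "b = be" using neq ab a' by (auto simp: Lam_iff)
            show ?thesis
            proof (cases rule: be_cases)
              case 1
              have "(a, b, c) \<in> Cs" unfolding Cs_def using 1 s a' 0 by auto
              then show ?thesis by (rule gen)
            next
              case 2
              have "WT (k, 0, 0) \<in> J" by (rule gen) (use Cs_L[of k] 2 in \<open>simp add: sig_def\<close>)
              from tidealD(3)[OF J this, of vY] have "WT (k, 1, 0) \<in> J" by (simp add: Y_W)
              then show ?thesis using s a' 0 2 k by simp
            qed
          qed
        qed
      next
        case (Suc c')
        show ?thesis
        proof (cases "(a, b, c') \<notin> Lam k be")
          case True then show ?thesis by (rule Z[OF Suc])
        next
          case False
          \<comment> \<open>The triple is that of z \<sigma>. The recurrence yields it from the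
            corners of weights \<open>js - 1\<close> and \<open>js - 2\<close>, which are both
            nonnegative as k >= 3.\<close>
          then have s: "a = k - be" "b = be" "c' = 0" using ab by (auto simp: Lam_iff)
          obtain n where n: "k - be = Suc (Suc n)" using that[of "k - be - 2"] k be by (simp add: numeral_2_eq_2)
          have n': "n = k - (be + 2)" "be + 2 \<le> k" using n by auto
          have 1: "WT (Suc n, Suc be, 0) \<in> J"
            by (rule gen) (use Cs_L[of "Suc n"] n n' be in \<open>simp add: sig_def Suc_diff_le\<close>)
          have "WT (n, Suc (Suc be), 0) \<in> J"
            by (rule gen) (use Cs_L[of n] n n' be in \<open>simp add: sig_def\<close>)
          from tidealD(3)[OF J this, of vX] have 2: "WT (Suc n, Suc (Suc be), 0) \<in> J" by (simp add: X_W)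
          have eq: "WT (a, b, c) = vY * WT (Suc n, Suc be, 0) - WT (Suc n, Suc (Suc be), 0)"
            unfolding vY_WT using s n Suc by simp
          show ?thesis unfolding eq by (rule tidealD(6)[OF J tidealD(3)[OF J 1] 2])
        qed
      qed
    qed
  qed
qed

text \<open>The expansion of \<open>f\<close> below degree 2 k - 1 involves only triples outside the
  order ideal, treated by \<open>WT_in_gen\<close>. The remainder has order 2 k - 1, and all
  monomials of that degree lie in \<open>J\<close>.\<close>

lemma I_le_gen:
  assumes J: "tideal J" and gen: "\<And>m. m \<in> Cs \<Longrightarrow> WT m \<in> J"
  shows "I \<subseteq> (J :: 'k ps3 set)"
proof
  fix f assume f: "f \<in> I"
  have W: "l \<notin> Lam k be \<Longrightarrow> WT l \<in> J" for l using WT_in_gen[OF J gen] by (cases l) blast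
  \<comment> \<open>Powers of y are absorbed into basis elements one factor at a time; the total
    degree stays beyond that of every triple in \<open>Lam k be\<close>.\<close>
  have mono: "vY ^ e * WT (a, b, c) \<in> J" if "2 * k - 1 \<le> e + a + b + c" for e a b c
    using that
  proof (induct e arbitrary: a b c)
    case 0
    then have "(a, b, c) \<notin> Lam k be" using Lam_tdeg[of "(a, b, c)"] by auto
    then show ?case using W by (simp del: WT.simps)
  next
    case (Suc e)
    have "vY ^ Suc e * WT (a, b, c) = vY ^ e * (vY * WT (a, b, c))" by (simp only: power_Suc2 mult.assoc)
    also have "\<dots> = vY ^ e * WT (a, Suc b, c) + (if b = 0 then 0 else vY ^ e * WT (Suc a, b - 1, Suc c))"
      unfolding vY_WT by (simp add: distrib_left)
    also have "\<dots> \<in> J" using Suc by (auto intro!: tidealD(2)[OF J] simp: tidealD(1)[OF J] simp del: WT.simps)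
    finally show ?case .
  qed
  have big: "h \<in> J" if "ordge (2 * k - 1) h" for h
  proof (rule ordge_in_tideal[OF J _ that])
    fix a b c assume "a + b + c = 2 * k - 1"
    then have "vY ^ b * WT (a, 0, c) \<in> J" by (intro mono) auto
    then show "vX ^ a * (vZ ^ c * vY ^ b) \<in> J" by (simp add: W_def algebra_simps)
  qed
  define D where "D = {l. tdeg l < 2 * k - 1}"
  have "D \<subseteq> {..2*k} \<times> {..2*k} \<times> {..2*k}" by (auto simp: D_def)
  then have "finite D" by (rule finite_subset) auto
  from IL_expand[OF this, of f] have "f - (\<Sum>l\<in>D. cst (LT l f) * WT l) \<in> IL D" .
  then have "ordge (2 * k - 1) (f - (\<Sum>l\<in>D. cst (LT l f) * WT l))"
    unfolding ordge_L_iff IL_def D_def by (metis (mono_tags, lifting) LT.simps mem_Collect_eq tdeg.simps)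
  from big[OF this] have 1: "f - (\<Sum>l\<in>D. cst (LT l f) * WT l) \<in> J" .
  have "(\<Sum>l\<in>D. cst (LT l f) * WT l) \<in> J"
  proof (rule tideal_sum[OF J])
    fix l show "cst (LT l f) * WT l \<in> J"
      using LT_I[OF f, of l] W[of l] tidealD(1,3)[OF J] by (cases "l \<in> Lam k be") auto
  qed
  from tidealD(2)[OF J 1 this] show "f \<in> J" by simp
qed

lemma finite_Cs: "finite Cs" by (simp add: Cs_def)

lemma WT_inj: "inj (WT :: _ \<Rightarrow> 'k ps3)"
  by (rule injI) (metis LT_WT zero_neq_one)

lemma gen_I: "genideal TA (WT ` Cs) = I"
proof -
  interpret cring "TA :: 'k ps3 ring" by (rule TA_cring)
  have "genideal TA (WT ` Cs) \<subseteq> I"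
    by (rule genideal_minimal) (use I WT_I Cs_Lam in \<open>auto simp: ideal_TA\<close>)
  moreover have "I \<subseteq> genideal TA (WT ` Cs)"
    using genideal_ideal[of "WT ` Cs"] genideal_self[of "WT ` Cs"]
    by (intro I_le_gen) (auto simp: ideal_TA)
  ultimately show ?thesis by blast
qed

lemma min_num_gens_I: "min_num_gens TA I = card Cs"
proof -
  have inv: "inv_into Cs WT (WT m :: 'k ps3) = m" if "m \<in> Cs" for m
    by (rule inv_into_f_f[OF inj_on_subset[OF WT_inj] that]) auto
  have "min_num_gens TA I = card (WT ` Cs :: 'k ps3 set)"
    by (rule min_num_gens_eq[of _ _ "\<lambda>s. LT (inv_into Cs WT s)"])
      (use finite_Cs gen_I corner_scale inv in \<open>auto simp: LT_WT inj_eq[OF WT_inj] simp del: LT.simps WT.simps\<close>)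
  then show ?thesis by (simp add: card_image inj_on_subset[OF WT_inj])
qed

end

section \<open>Explicit Koszul cycles and their pairing into the socle\<close>

definition kA :: "'a::comm_ring_1 \<Rightarrow> 'a \<Rightarrow> 'a \<Rightarrow> 'a kos" where "kA a b c = Kos 0 a b c 0 0 0 0"
definition kB :: "'a::comm_ring_1 \<Rightarrow> 'a \<Rightarrow> 'a \<Rightarrow> 'a kos" where "kB a b c = Kos 0 0 0 0 a b c 0"
definition kT :: "'a::comm_ring_1 \<Rightarrow> 'a kos" where "kT t = Kos 0 0 0 0 0 0 0 t"

lemma kABT_sel [simp]:
  "ks (kA a b c) = 0" "ka1 (kA a b c) = a" "ka2 (kA a b c) = b" "ka3 (kA a b c) = c"
  "kb1 (kA a b c) = 0" "kb2 (kA a b c) = 0" "kb3 (kA a b c) = 0" "kt (kA a b c) = 0"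
  "ks (kB a b c) = 0" "ka1 (kB a b c) = 0" "ka2 (kB a b c) = 0" "ka3 (kB a b c) = 0"
  "kb1 (kB a b c) = a" "kb2 (kB a b c) = b" "kb3 (kB a b c) = c" "kt (kB a b c) = 0"
  "ks (kT t) = 0" "ka1 (kT t) = 0" "ka2 (kT t) = 0" "ka3 (kT t) = 0"
  "kb1 (kT t) = 0" "kb2 (kT t) = 0" "kb3 (kT t) = 0" "kt (kT t) = t"
  by (simp_all add: kA_def kB_def kT_def)

lemma kdeg_ABT [simp]: "kdeg 1 (kA a b c)" "kdeg (Suc 0) (kA a b c)" "kdeg 2 (kB a b c)" "kdeg 3 (kT t)"
  by (simp_all add: kdeg_def)

lemma kdeg_eq: "kdeg 1 v \<Longrightarrow> v = kA (ka1 v) (ka2 v) (ka3 v)" "kdeg 2 v \<Longrightarrow> v = kB (kb1 v) (kb2 v) (kb3 v)"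
  "kdeg 3 v \<Longrightarrow> v = kT (kt v)"
  by (intro kos_eqI; simp add: kdeg_def)+

lemma dk_sel [simp]: "ks (dk v) = vX * ka1 v + vY * ka2 v + vZ * ka3 v"
  "ka1 (dk v) = vZ * kb2 v - vY * kb3 v" "ka2 (dk v) = vX * kb3 v - vZ * kb1 v" "ka3 (dk v) = vY * kb1 v - vX * kb2 v"
  "kb1 (dk v) = vX * kt v" "kb2 (dk v) = vY * kt v" "kb3 (dk v) = vZ * kt v" "kt (dk v) = 0"
  by (simp_all add: dk_def)

definition Spn :: "'a::comm_ring_1 kos list \<Rightarrow> 'a kos set" where "Spn vs = {comb c vs | c. True}"

lemma Spn_0: "0 \<in> Spn vs"
proof -
  have "comb (\<lambda>_. 0) vs = 0" by (simp add: comb_def sc_0)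
  then show ?thesis unfolding Spn_def by (intro CollectI exI[of _ "\<lambda>_. 0"]) simp
qed

lemma Spn_add: "u \<in> Spn vs \<Longrightarrow> v \<in> Spn vs \<Longrightarrow> u + v \<in> Spn vs"
proof -
  assume "u \<in> Spn vs" "v \<in> Spn vs"
  then obtain c d where "u = comb c vs" "v = comb d vs" by (auto simp: Spn_def)
  then have "u + v = comb (\<lambda>i. c i + d i) vs"
    by (simp add: comb_def sum.distrib distrib_right flip: sc_add)
  then show ?thesis unfolding Spn_def by blast
qed

lemma Spn_mem: "u \<in> set vs \<Longrightarrow> sc r * u \<in> Spn vs"
proof -
  assume "u \<in> set vs"
  then obtain i where i: "i < length vs" "u = vs ! i" by (metis in_set_conv_nth)
  have "comb (\<lambda>j. if j = i then r else 0) vs = (\<Sum>j<length vs. if j = i then sc r * u else 0)"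
    unfolding comb_def by (rule sum.cong) (auto simp: i sc_0)
  also have "\<dots> = sc r * u" using i by simp
  finally show ?thesis unfolding Spn_def by (metis (mono_tags, lifting) mem_Collect_eq)
qed

lemma Spn_sum: "(\<And>w. w \<in> S \<Longrightarrow> F w \<in> Spn vs) \<Longrightarrow> sum F S \<in> Spn vs"
  by (induct S rule: infinite_finite_induct) (auto intro: Spn_0 Spn_add)

context ps3_quot
begin

text \<open>Functionals that are linear over the field suffice: on a cycle, replacing a coefficient
  by its constant term changes the vector by a boundary.\<close>

lemma indepI:
  assumes vs: "set vs \<subseteq> Z"
    and \<theta>: "\<And>i. i < length vs \<Longrightarrow> \<exists>\<theta> :: 'k ps3 kos \<Rightarrow> 'k. (\<forall>u v. \<theta> (u + v) = \<theta> u + \<theta> v) \<and>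
      (\<forall>r v. \<theta> (sc (cst r) * v) = r * \<theta> v) \<and> (\<forall>v\<in>B. \<theta> v = 0) \<and>
      (\<forall>j<length vs. \<theta> (vs ! j) = (if i = j then 1 else 0))"
    and c: "comb c vs \<in> B" "i < length vs"
  shows "ct (c i) = 0"
proof -
  obtain \<theta> :: "'k ps3 kos \<Rightarrow> 'k" where add: "\<And>u v. \<theta> (u + v) = \<theta> u + \<theta> v"
    and sc: "\<And>r v. \<theta> (sc (cst r) * v) = r * \<theta> v" and B: "\<And>v. v \<in> B \<Longrightarrow> \<theta> v = 0"
    and vsj: "\<And>j. j < length vs \<Longrightarrow> \<theta> (vs ! j) = (if i = j then 1 else 0)"
    using \<theta>[OF c(2)] by metis
  have s: "\<theta> (sc r * v) = ct r * \<theta> v" if "v \<in> Z" for r v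
  proof -
    have "sc r * v = sc (cst (ct r)) * v + sc (r - cst (ct r)) * v"
      by (simp add: sc_add flip: distrib_right)
    moreover have "sc (r - cst (ct r)) * v \<in> B" by (rule max_kills[OF _ that]) simp
    ultimately show ?thesis using add sc B by simp
  qed
  have \<theta>0: "\<theta> 0 = 0" using sc[of 0 0] by simp
  have "\<theta> (\<Sum>j<n. sc (c j) * vs ! j) = (\<Sum>j<n. \<theta> (sc (c j) * vs ! j))" for n
    by (induct n) (simp_all add: \<theta>0 add)
  then have "\<theta> (comb c vs) = (\<Sum>j<length vs. \<theta> (sc (c j) * vs ! j))"
    unfolding comb_def .
  also have "\<dots> = (\<Sum>j<length vs. if j = i then ct (c i) else 0)"
    by (rule sum.cong) (use vs in \<open>auto simp: s vsj subset_iff\<close>)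
  also have "\<dots> = ct (c i)" using c(2) by simp
  finally show ?thesis using B[OF c(1)] by simp
qed

end

context trim
begin

text \<open>The coefficient of e_1 e_2 e_3 in the product of a 1-chain and a 2-chain.\<close>

definition dt :: "'k ps3 kos \<Rightarrow> 'k ps3 kos \<Rightarrow> 'k ps3" where
  "dt u f = ka1 u * kb1 f + ka2 u * kb2 f + ka3 u * kb3 f"

text \<open>A 1-chain with boundary the generator of weight \<open>w\<close>: one factor x or z is
  removed, and for w = 0 the identity U_k = y U_(k-1) - x z U_(k-2) is used.\<close>

definition ev :: "int \<Rightarrow> 'k ps3 kos" where
  "ev w = (if w > 0 then kA (W (nat w - 1) (k - nat w) 0) 0 0
    else if w < 0 then kA 0 0 (W 0 (k - nat (- w)) (nat (- w) - 1))
    else kA 0 (W 0 (k - 1) 0) (- W 1 (k - 2) 0))"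

text \<open>A 2-chain whose boundary has the entries P(w-1), P(w), P(w+1) up to sign; applying
  \<open>dk\<close> once more gives the \<open>w\<close>-th syzygy of \<open>g\<close>. The zero
  entries at the ends of the range come from U_(-1) = 0.\<close>

definition fv :: "int \<Rightarrow> 'k ps3 kos" where
  "fv w = (if w > 0 then kB 0 (if nat w = k then 0 else W (nat w) (k - nat w - 1) 0) (W (nat w - 1) (k - nat w) 0)
    else if w < 0 then kB (W 0 (k - nat (- w)) (nat (- w) - 1)) (if nat (- w) = k then 0 else W 0 (k - nat (- w) - 1) (nat (- w))) 0
    else kB 0 (W 0 (k - 1) 0) 0)"

definition P :: "int \<Rightarrow> 'k ps3" where "P w = (if w \<in> rng then WT (cn w) else 0)"

lemma phi_WW: "\<phi> (W a b c * W a' b' c') = (if b = b' \<and> a + a' + b = k - 1 \<and> c + c' + b = k - 1 then 1 else 0)"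
proof -
  have "W a b c * W a' b' c' = vX ^ (a + a') * (vZ ^ (c + c') * (V (Suc b) * V (Suc b') :: 'k ps3))"
    by (simp add: W_def power_add algebra_simps)
  then show ?thesis by (auto simp: L_V_mult L_V)
qed

text \<open>With weights 1, 0, -1 for e_1, e_2, e_3 the product has weight w + w', while \<phi> sees
  only weight 0. On the antidiagonal exactly one of the three summands contributes.\<close>

lemma pairing: assumes "w \<in> rng" "w' \<in> rng" shows "\<phi> (dt (ev w') (fv w)) = (if w' = - w then 1 else 0)"
proof -
  have *: thesis if "\<And>n. u = int n \<Longrightarrow> 0 < n \<Longrightarrow> n \<le> k \<Longrightarrow> thesis" "u = 0 \<Longrightarrow> thesis"
    "\<And>n. u = - int n \<Longrightarrow> 0 < n \<Longrightarrow> n \<le> k \<Longrightarrow> thesis" "u \<in> rng" for u thesis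
    using that(1)[of "nat u"] that(2) that(3)[of "nat (- u)"] that(4) by (cases "u > 0"; cases "u = 0") auto
  note defs = ev_def fv_def dt_def phi_WW[unfolded One_nat_def]
  show ?thesis
  proof (rule *[OF _ _ _ assms(1)])
    fix n assume n: "w = int n" "0 < n" "n \<le> k"
    show ?thesis
    proof (rule *[OF _ _ _ assms(2)])
      fix m assume "w' = - int m" "0 < m" "m \<le> k"
      then show ?thesis using n k by (auto simp: defs)
    qed (use n k in \<open>auto simp: defs\<close>)
  next
    assume n: "w = 0"
    show ?thesis by (rule *[OF _ _ _ assms(2)]) (use n k in \<open>auto simp: defs\<close>)
  next
    fix n assume n: "w = - int n" "0 < n" "n \<le> k"
    show ?thesis
    proof (rule *[OF _ _ _ assms(2)])
      fix m assume "w' = int m" "0 < m" "m \<le> k"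
      then show ?thesis using n k by (auto simp: defs)
    qed (use n k in \<open>auto simp: defs\<close>)
  qed
qed

lemma dk_ev: assumes "w \<in> rng" shows "dk (ev w) = sc (WT (cn w))"
proof -
  obtain k' where k': "k = Suc (Suc k')" using that[of "k - 2"] k by (simp add: numeral_2_eq_2)
  have "vX * W (nat w - 1) (k - nat w) 0 = (W (nat w) (k - nat w) 0 :: 'k ps3)" if "w > 0"
    using that by (simp add: X_W)
  moreover have "vZ * W 0 (k - nat (- w)) (nat (- w) - 1) = (W 0 (k - nat (- w)) (nat (- w)) :: 'k ps3)" if "w < 0"
    using that by (simp add: Z_W)
  moreover have "vY * W 0 (k - 1) 0 - vZ * W 1 (k - 2) 0 = (W 0 k 0 :: 'k ps3)"
    by (simp add: k' Y_W Z_W)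
  ultimately show ?thesis
    by (intro kos_eqI) (auto simp: ev_def cn_def)
qed

lemma dk_fv:
  assumes "w \<in> rng"
  shows "dk (fv w) = kA ((if w > 0 then - 1 else 1) * P (w - 1)) ((if w > 0 then 1 else if w < 0 then - 1 else 0) * P w)
    ((if w < 0 then 1 else - 1) * P (w + 1))"
proof -
  consider n where "w = int (Suc n)" "Suc n \<le> k" | n where "w = - int (Suc n)" "Suc n \<le> k" | "w = 0"
  proof -
    assume a: "\<And>n. w = int (Suc n) \<Longrightarrow> Suc n \<le> k \<Longrightarrow> thesis" "\<And>n. w = - int (Suc n) \<Longrightarrow> Suc n \<le> k \<Longrightarrow> thesis" "w = 0 \<Longrightarrow> thesis"
    show thesis
      using a(1)[of "nat (w - 1)"] a(2)[of "nat (- w - 1)"] a(3) assms by (cases "w > 0"; cases "w < 0") auto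
  qed
  then show ?thesis
  proof cases
    case (1 n)
    \<comment> \<open>The case \<open>m = 0\<close> is the end of the range, where one neighbour is
      missing.\<close>
    obtain m where m: "k = Suc (n + m)" using 1(2) by (metis add_Suc le_Suc_ex)
    have e: "nat w = Suc n" "w - 1 = int n" "w + 1 = int (Suc (Suc n))" using 1 by auto
    show ?thesis using 1 unfolding fv_def P_def cn_def
      by (intro kos_eqI; cases m) (auto simp: e m X_W Y_W Z_W nat_add_distrib)
  next
    case (2 n)
    obtain m where m: "k = Suc (n + m)" using 2(2) by (metis add_Suc le_Suc_ex)
    have e: "nat (- w) = Suc n" "w + 1 = - int n" "w - 1 = - int (Suc (Suc n))" using 2 by auto
    show ?thesis using 2 unfolding fv_def P_def cn_def
      by (intro kos_eqI; cases m) (auto simp: e m X_W Y_W Z_W nat_add_distrib)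
  next
    case 3
    obtain k' where k': "k = Suc (Suc k')" using that[of "k - 2"] k by (simp add: numeral_2_eq_2)
    show ?thesis using 3 unfolding fv_def P_def cn_def
      by (intro kos_eqI) (auto simp: k' X_W Z_W)
  qed
qed

lemma P_g: "P w \<in> g"
  using WT_g cn_notin_LamG by (simp add: P_def)

lemma P_I: "w \<noteq> js \<Longrightarrow> P w \<in> I"
  using WT_I[OF Cs_Lam[OF cn_Cs]] tidealD(1)[OF I] by (auto simp: P_def)

lemma LT_sig_P: "LT sgm (P w) = (if w = js then 1 else 0)"
proof -
  have "cn w = sgm \<longleftrightarrow> w = js" using cn_js cn_inj by (metis injD)
  then show ?thesis using be k by (auto simp: P_def LT_WT)
qed

lemma fv_Z: "w \<in> rng \<Longrightarrow> w \<notin> {js - 1, js, js + 1} \<Longrightarrow> fv w \<in> Z"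
  unfolding Z_def using P_I[of "w - 1"] P_I[of w] P_I[of "w + 1"] tidealD(1,3,5)[OF I]
  by (auto simp: dk_fv kin_def simp del: dk_sel)

lemma ev_deg: "kdeg 1 (ev w)" and fv_deg: "kdeg 2 (fv w)"
  by (simp_all add: ev_def fv_def)

lemma ev_ord: "ordge (k - 1) (ka1 (ev w))" "ordge (k - 1) (ka2 (ev w))" "ordge (k - 1) (ka3 (ev w))" if "w \<in> rng"
  using that k by (auto simp: ev_def intro!: ordge_W ordge_minus)
lemma fv_ord: "ordge (k - 1) (kb1 (fv w))" "ordge (k - 1) (kb2 (fv w))" "ordge (k - 1) (kb3 (fv w))" if "w \<in> rng"
  using that k by (auto simp: fv_def intro!: ordge_W ordge_minus)

subsection \<open>Duality\<close>

text \<open>Over Q such an \<open>a\<close> is a Koszul boundary, and its differential can be moved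
  over to \<open>f\<close>. So \<open>dt a f\<close> modulo \<open>g\<close> depends only on the
  boundary of \<open>a\<close>.\<close>

lemma dt_syz:
  assumes f: "ka1 (dk f) \<in> g" "ka2 (dk f) \<in> g" "ka3 (dk f) \<in> g" and a: "ks (dk a) = 0"
  shows "dt a f \<in> g"
proof -
  obtain u v w where uvw: "ka1 a = vY * w - vZ * v" "ka2 a = vZ * u - vX * w" "ka3 a = vX * v - vY * u"
    using koszul_exact1[of "ka1 a" "ka2 a" "ka3 a"] a by auto
  have "dt a f = u * ka1 (dk f) + v * ka2 (dk f) + w * ka3 (dk f)"
    unfolding dt_def uvw by (simp add: algebra_simps)
  then show ?thesis using f by (simp add: IL_add g_mult del: dk_sel)
qed

text \<open>The product of two cycles modulo \<open>g\<close> is a 3-cycle, and the coefficient of a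
  3-cycle is killed by every variable.\<close>

lemma dt_kill:
  assumes f: "ka1 (dk f) \<in> g" "ka2 (dk f) \<in> g" "ka3 (dk f) \<in> g" and a: "ks (dk a) \<in> g" and h: "ct h = 0"
  shows "h * dt a f \<in> g"
proof (rule ps3_mult_in_IL[OF order_closed_LamG h])
  have "vX * dt a f = ks (dk a) * kb1 f - ka2 a * ka3 (dk f) + ka3 a * ka2 (dk f)"
    "vY * dt a f = ks (dk a) * kb2 f + ka1 a * ka3 (dk f) - ka3 a * ka1 (dk f)"
    "vZ * dt a f = ks (dk a) * kb3 f - ka1 a * ka2 (dk f) + ka2 a * ka1 (dk f)"
    by (simp_all add: dt_def algebra_simps)
  then show "vX * dt a f \<in> g" "vY * dt a f \<in> g" "vZ * dt a f \<in> g"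
    using f a by (auto intro!: IL_add IL_diff intro: g_mult simp del: dk_sel)
qed

lemma phi_dt_scale:
  assumes f: "ka1 (dk f) \<in> g" "ka2 (dk f) \<in> g" "ka3 (dk f) \<in> g" and a: "ks (dk a) \<in> g"
  shows "\<phi> (h * dt a f) = ct h * \<phi> (dt a f)"
proof -
  have "h * dt a f = cst (ct h) * dt a f + (h - cst (ct h)) * dt a f" by (simp add: algebra_simps)
  moreover have "\<phi> ((h - cst (ct h)) * dt a f) = 0" by (rule phi_g[OF dt_kill[OF f a]]) simp
  ultimately show ?thesis by simp
qed

lemma g_le:
  assumes J: "tideal J" and P: "\<And>w. w \<in> rng \<Longrightarrow> P w \<in> J" shows "g \<subseteq> J"
proof
  have js: "js \<in> rng" using be k by auto
  have 1: "WT (cn w) \<in> J" if "w \<in> rng" for w using P[OF that] that by (simp add: P_def)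
  have "I \<subseteq> J"
  proof (rule I_le_gen[OF J])
    fix m assume "m \<in> Cs"
    then have "m \<in> cn ` rng \<or> m = (k + 1, 0, 0)" by (auto simp: Cs_def split: if_splits)
    moreover have "WT (k + 1, 0, 0) \<in> J"
    proof -
      have "cn (int k) = (k, 0, 0)" by (simp add: cn_def)
      then have "WT (k, 0, 0) \<in> J" using 1[of "int k"] by simp
      from tidealD(3)[OF J this, of vX] show ?thesis by (simp add: X_W)
    qed
    ultimately show "WT m \<in> J" using 1 by blast
  qed
  fix s assume "s \<in> g"
  from g_remove[OF this] \<open>I \<subseteq> J\<close> have "s - cst (LT sgm s) * WT sgm \<in> J" by blast
  moreover have "cst (LT sgm s) * WT sgm \<in> J" using tidealD(3)[OF J 1[OF js]] by (simp add: cn_js)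
  ultimately show "s \<in> J" using tidealD(2)[OF J] by fastforce
qed

text \<open>Nondegeneracy of the form \<phi>(f h) on Q/g: by \<open>phi_W\<close> every functional
  defining \<open>g\<close> is \<phi> after multiplication by a complementary basis element.\<close>

lemma in_gI: "(\<And>h. \<phi> (h * f) = 0) \<Longrightarrow> f \<in> g"
  unfolding IL_def using phi_W[of _ _ k _ f] by (auto simp: LamG_def)

text \<open>Poincare duality for the Gorenstein ring Q/g in degree 2. Pairing with \<open>f\<close>
  gives a functional on the maximal ideal; if it vanishes on \<open>g\<close>, it is represented by
  some \<open>q\<close> through the socle form, and comparison on multiples of the variables
  identifies \<open>f\<close> with q (x, y, z) modulo \<open>g\<close>.\<close>

lemma duality:
  assumes f: "ka1 (dk f) \<in> g" "ka2 (dk f) \<in> g" "ka3 (dk f) \<in> g"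
    and z: "\<And>w. w \<in> rng \<Longrightarrow> \<phi> (dt (ev w) f) = 0"
  shows "\<exists>q. kb1 f - vX * q \<in> g \<and> kb2 f - vY * q \<in> g \<and> kb3 f - vZ * q \<in> g"
proof -
  \<comment> \<open>The elements having a Koszul lift that pairs trivially with all multiples of
    \<open>f\<close>. They form an ideal, which contains the generators of \<open>g\<close> by
    hypothesis.\<close>
  define J where "J = {s. \<exists>a. s = ks (dk a) \<and> (\<forall>h. \<phi> (h * dt a f) = 0)}"
  have "tideal J"
    unfolding tideal_def
  proof (intro conjI ballI allI)
    show "0 \<in> J" unfolding J_def by (intro CollectI exI[of _ 0]) (simp add: dt_def)
  next
    fix s t assume "s \<in> J" "t \<in> J"
    then obtain a b where ab: "s = ks (dk a)" "\<forall>h. \<phi> (h * dt a f) = 0" "t = ks (dk b)" "\<forall>h. \<phi> (h * dt b f) = 0"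
      by (auto simp: J_def)
    have "h * dt (a + b) f = h * dt a f + h * dt b f" for h by (simp add: dt_def algebra_simps)
    then show "s + t \<in> J" unfolding J_def using ab
      by (intro CollectI exI[of _ "a + b"]) (simp add: dk_add)
  next
    fix s r assume "s \<in> J"
    then obtain a where a: "s = ks (dk a)" "\<forall>h. \<phi> (h * dt a f) = 0" by (auto simp: J_def)
    have eq: "dt (sc r * a) f = r * dt a f" by (simp add: dt_def algebra_simps)
    have "\<phi> (h * dt (sc r * a) f) = 0" for h
      using a(2)[rule_format, of "h * r"] unfolding eq by (simp only: mult.assoc)
    then show "r * s \<in> J" unfolding J_def using a
      by (intro CollectI exI[of _ "sc r * a"]) (simp add: algebra_simps)
  qed
  moreover have "P w \<in> J" if w: "w \<in> rng" for w
  proof -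
    have "ks (dk (ev w)) = P w" using w dk_ev[OF w] by (simp add: P_def del: dk_sel)
    moreover have "\<phi> (h * dt (ev w) f) = 0" for h
      using phi_dt_scale[OF f, of "ev w" h] P_g[of w] z[OF w] calculation by simp
    ultimately show ?thesis unfolding J_def by (intro CollectI exI[of _ "ev w"]) simp
  qed
  ultimately have gJ: "g \<subseteq> J" by (rule g_le)
  have syz: "\<phi> (dt a f) = \<phi> (dt b f)" if "ks (dk a) = ks (dk b)" for a b
  proof -
    have eq: "dt a f - dt b f = dt (a - b) f" by (simp add: dt_def algebra_simps)
    have "dt (a - b) f \<in> g" using that by (intro dt_syz[OF f]) (simp add: dk_diff)
    then have "\<phi> (dt a f - dt b f) = 0" unfolding eq by (rule phi_g)
    then show ?thesis by simp
  qed
  have psi0: "\<phi> (dt a f) = 0" if s: "ks (dk a) \<in> g" for a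
  proof -
    obtain b where b: "ks (dk a) = ks (dk b)" "\<forall>h. \<phi> (h * dt b f) = 0" using gJ s unfolding J_def by blast
    show ?thesis using syz[OF b(1)] b(2)[rule_format, of 1] by simp
  qed
  \<comment> \<open>The chain in the argument is the standard lift of \<open>h\<close> minus its
    constant term, so the functional is extended to all of Q by zero on constants.\<close>
  define \<Psi> where "\<Psi> h = \<phi> (dt (kA (dX h) (dY h) (dZ h)) f)" for h
  have Psi_add: "\<Psi> (s + t) = \<Psi> s + \<Psi> t" for s t
    by (simp add: \<Psi>_def dt_def d_add algebra_simps)
  have Psi_cst: "\<Psi> (cst r * s) = r * \<Psi> s" for r s
  proof -
    have "dt (kA (dX (cst r * s)) (dY (cst r * s)) (dZ (cst r * s))) f = cst r * dt (kA (dX s) (dY s) (dZ s)) f"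
      unfolding d_cst_mult dt_def by (simp add: algebra_simps)
    then show ?thesis by (simp add: \<Psi>_def)
  qed
  have Psi_sum: "\<Psi> (sum F S) = (\<Sum>i\<in>S. \<Psi> (F i))" for F and S :: "(nat \<times> nat \<times> nat) set"
    using Psi_cst[of 0 0] by (induct S rule: infinite_finite_induct) (simp_all add: Psi_add)
  have Psi_ks: "\<Psi> (ks (dk a)) = \<phi> (dt a f)" for a
  proof -
    have "ct (ks (dk a)) = 0" by simp
    from ps3_decomp0[OF this] show ?thesis unfolding \<Psi>_def by (intro syz) simp
  qed
  have Psi_g: "\<Psi> s = 0" if "s \<in> g" for s
  proof -
    have "(0, 0, 0) \<in> LamG k" using k by (simp add: LamG_def)
    then have "LT (0, 0, 0) s = 0" using that unfolding IL_def by blast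
    then have "ct s = 0" by simp
    from ps3_decomp0[OF this] have "ks (dk (kA (dX s) (dY s) (dZ s))) = s" by simp
    then show ?thesis using psi0[of "kA (dX s) (dY s) (dZ s)"] that unfolding \<Psi>_def by simp
  qed
  \<comment> \<open>The complementary triple: through it \<open>q\<close> is written down explicitly
    from the values of \<Psi> on basis elements.\<close>
  define st where "st = (\<lambda>(a, b, c). (k - 1 - a - b, b, k - 1 - b - c))"
  have st: "\<phi> (WT (st l) * h) = LT l h" if "l \<in> LamG k" for l and h :: "'k ps3"
    using that phi_W[of _ _ k _ h] by (auto simp: st_def LamG_def)
  define q where "q = (\<Sum>l\<in>LamG k. cst (\<Psi> (WT l)) * WT (st l))"
  have q: "\<phi> (q * h) = \<Psi> h" for h
  proof -
    have "\<phi> (q * h) = (\<Sum>l\<in>LamG k. \<Psi> (WT l) * LT l h)"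
      unfolding q_def sum_distrib_right L_sum mult.assoc L_cst
      by (intro sum.cong refl arg_cong2[of _ _ _ _ "(*)"] st)
    also have "\<dots> = \<Psi> (\<Sum>l\<in>LamG k. cst (LT l h) * WT l)"
      unfolding Psi_sum Psi_cst by (intro sum.cong refl mult.commute)
    also have "\<dots> = \<Psi> ((h - (\<Sum>l\<in>LamG k. cst (LT l h) * WT l)) + (\<Sum>l\<in>LamG k. cst (LT l h) * WT l))"
      using Psi_g[OF IL_expand[OF finite_LamG, of h]] unfolding Psi_add by simp
    finally show ?thesis by simp
  qed
  show ?thesis
  proof (intro exI[of _ q] conjI in_gI)
    fix h
    have "\<phi> (q * (vX * h)) = \<phi> (h * kb1 f)" "\<phi> (q * (vY * h)) = \<phi> (h * kb2 f)" "\<phi> (q * (vZ * h)) = \<phi> (h * kb3 f)"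
      using Psi_ks[of "kA h 0 0"] Psi_ks[of "kA 0 h 0"] Psi_ks[of "kA 0 0 h"] unfolding q by (simp_all add: dt_def)
    moreover have "h * (kb1 f - vX * q) = h * kb1 f - q * (vX * h)" "h * (kb2 f - vY * q) = h * kb2 f - q * (vY * h)"
      "h * (kb3 f - vZ * q) = h * kb3 f - q * (vZ * h)" by (simp_all add: algebra_simps)
    ultimately show "\<phi> (h * (kb1 f - vX * q)) = 0" "\<phi> (h * (kb2 f - vY * q)) = 0" "\<phi> (h * (kb3 f - vZ * q)) = 0"
      by (simp_all only: L_diff diff_self)
  qed
qed

end

section \<open>Socle elements of Q/I and chains of top degree\<close>

context trim
begin

lemma sig_kill: assumes "ct h = 0" shows "h * WT sgm \<in> I"
proof (rule ps3_mult_in_IL[OF order_closed_Lam assms, folded I_eq])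
  have n: "(Suc (k - be), be, 0) \<notin> Lam k be" "(k - be, be, Suc 0) \<notin> Lam k be"
    "(k - be, Suc be, 0) \<notin> Lam k be" "be \<noteq> 0 \<Longrightarrow> (Suc (k - be), be - 1, Suc 0) \<notin> Lam k be"
    using k be by (auto simp: Lam_iff)
  show "vX * WT sgm \<in> I" "vZ * WT sgm \<in> I"
    unfolding sig_def vX_WT vZ_WT by (rule WT_I[OF n(1)], rule WT_I[OF n(2)])
  have "(if be = 0 then 0 else WT (Suc (k - be), be - 1, Suc 0)) \<in> I"
    using tidealD(1)[OF I] WT_I[OF n(4)] by (simp del: WT.simps)
  then show "vY * WT sgm \<in> I"
    unfolding sig_def vY_WT by (rule tidealD(2)[OF I WT_I[OF n(3)]])
qed

lemma top_kill: assumes "ct h = 0" shows "h * WT tpm \<in> I"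
proof (rule ps3_mult_in_IL[OF order_closed_Lam assms, folded I_eq])
  have n: "(Suc (k - 1), 0, k - 1) \<notin> Lam k be" "(k - 1, 0, Suc (k - 1)) \<notin> Lam k be" "(k - 1, Suc 0, k - 1) \<notin> Lam k be"
    using k be by (auto simp: Lam_iff)
  show "vX * WT tpm \<in> I" "vZ * WT tpm \<in> I"
    unfolding vX_WT vZ_WT by (rule WT_I[OF n(1)], rule WT_I[OF n(2)])
  have "vY * WT tpm = (WT (k - 1, Suc 0, k - 1) :: 'k ps3)" by (simp add: Y_W)
  then show "vY * WT tpm \<in> I" using WT_I[OF n(3)] by metis
qed

lemma sig_scale: "h * WT sgm - cst (ct h) * WT sgm \<in> I"
  using sig_kill[of "h - cst (ct h)"] by (simp add: algebra_simps)

lemma sgm_Lam: "sgm \<in> Lam k be" and tpm_Lam: "tpm \<in> Lam k be" and sgm_tpm: "sgm \<noteq> tpm"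
  using k be by (auto simp: Lam_def LamG_def sig_def)

lemma top_decomp: "ordge (2 * k - 2) t \<Longrightarrow> t - cst (\<phi> t) * WT tpm \<in> I"
proof -
  assume t: "ordge (2 * k - 2) t"
  have "LT l (t - cst (LT tpm t) * WT tpm) = 0" if "l \<in> Lam k be" for l
    using ordge_LT[OF t, of l] Lam_tdeg'[OF that] by (auto simp: LT_WT simp del: LT.simps WT.simps)
  then have "t - cst (LT tpm t) * WT tpm \<in> I" unfolding I_eq IL_def by blast
  then show ?thesis by simp
qed

lemma ordge_mult': "ordge a f \<Longrightarrow> ordge b h \<Longrightarrow> c \<le> a + b \<Longrightarrow> ordge c (f * h)"
  using ordge_mono[OF ordge_mult] by blast

lemma scale_B: "v \<in> B \<Longrightarrow> sc r * v \<in> B"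
  by (rule B_mult(2)) simp_all

text \<open>Entries of order 2 k - 2 are multiples of s modulo \<open>I\<close>. For each of the
  three positions s arises, modulo \<open>I\<close>, from an element of degree 2 k - 3 by one
  variable, while the other two variables send that element into \<open>I\<close>.\<close>

lemma high2:
  assumes v: "kdeg 2 v" "ordge (2 * k - 2) (kb1 v)" "ordge (2 * k - 2) (kb2 v)" "ordge (2 * k - 2) (kb3 v)"
  shows "v \<in> B"
proof -
  let ?s = "WT tpm :: 'k ps3"
  obtain k' where k': "k = Suc (Suc (Suc k'))" using that[of "k - 3"] k by (simp add: numeral_3_eq_3)
  have B1: "kB ?s 0 0 \<in> B"
  proof -
    have "kB ?s 0 0 = dk (kT (W (k - 2) 0 (k - 1))) + kB 0 (- W (k - 2) 1 (k - 1)) (- W (k - 2) 0 k)"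
      by (intro kos_eqI) (simp_all add: k' X_W Y_W Z_W)
    moreover have "W (k - 2) 1 (k - 1) \<in> I" "W (k - 2) 0 k \<in> I"
      using WT_I[of "(k - 2, 1, k - 1)"] WT_I[of "(k - 2, 0, k)"] k be by (auto simp: Lam_iff)
    then have "kB 0 (- W (k - 2) 1 (k - 1)) (- W (k - 2) 0 k) \<in> B"
      using tidealD(1,5)[OF I] by (intro kin_B) (simp add: kin_def)
    ultimately show ?thesis using B_add[OF dk_B] by metis
  qed
  have B3: "kB 0 0 ?s \<in> B"
  proof -
    have "kB 0 0 ?s = dk (kT (W (k - 1) 0 (k - 2))) + kB (- W k 0 (k - 2)) (- W (k - 1) 1 (k - 2)) 0"
      by (intro kos_eqI) (simp_all add: k' X_W Y_W Z_W)
    moreover have "W (k - 1) 1 (k - 2) \<in> I" "W k 0 (k - 2) \<in> I"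
      using WT_I[of "(k - 1, 1, k - 2)"] WT_I[of "(k, 0, k - 2)"] k be by (auto simp: Lam_iff)
    then have "kB (- W k 0 (k - 2)) (- W (k - 1) 1 (k - 2)) 0 \<in> B"
      using tidealD(1,5)[OF I] by (intro kin_B) (simp add: kin_def)
    ultimately show ?thesis using B_add[OF dk_B] by metis
  qed
  have B2: "kB 0 ?s 0 \<in> B"
  proof -
    \<comment> \<open>From y U_1 = U_2 + x z: times (x z)^(k-2) the left side is y times the chosen
      3-chain, the last term is s, and the term with U_2 lies in \<open>I\<close>.\<close>
    have "kB 0 ?s 0 = dk (kT (W (k - 2) 1 (k - 2))) + kB (- W (k - 1) 1 (k - 2)) (- W (k - 2) 2 (k - 2)) (- W (k - 2) 1 (k - 1))"
      by (intro kos_eqI) (simp_all add: k' X_W Y_W Z_W numeral_2_eq_2)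
    moreover have "W (k - 1) 1 (k - 2) \<in> I" "W (k - 2) 2 (k - 2) \<in> I" "W (k - 2) 1 (k - 1) \<in> I"
      using WT_I[of "(k - 1, 1, k - 2)"] WT_I[of "(k - 2, 2, k - 2)"] WT_I[of "(k - 2, 1, k - 1)"] k be by (auto simp: Lam_iff)
    then have "kB (- W (k - 1) 1 (k - 2)) (- W (k - 2) 2 (k - 2)) (- W (k - 2) 1 (k - 1)) \<in> B"
      using tidealD(1,5)[OF I] by (intro kin_B) (simp add: kin_def)
    ultimately show ?thesis using B_add[OF dk_B] by metis
  qed
  let ?c = "\<lambda>t. cst (\<phi> t)"
  have "v = (sc (?c (kb1 v)) * kB ?s 0 0 + sc (?c (kb2 v)) * kB 0 ?s 0 + sc (?c (kb3 v)) * kB 0 0 ?s)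
     + kB (kb1 v - ?c (kb1 v) * ?s) (kb2 v - ?c (kb2 v) * ?s) (kb3 v - ?c (kb3 v) * ?s)"
    using v(1) by (intro kos_eqI) (simp_all add: kdeg_def del: WT.simps)
  moreover have "kB (kb1 v - ?c (kb1 v) * ?s) (kb2 v - ?c (kb2 v) * ?s) (kb3 v - ?c (kb3 v) * ?s) \<in> B"
    using top_decomp v(2-4) tidealD(1)[OF I] by (intro kin_B) (simp add: kin_def del: WT.simps)
  ultimately show ?thesis using B_add[OF B_add[OF B_add[OF scale_B[OF B1] scale_B[OF B2]] scale_B[OF B3]]] by metis
qed

lemma kdeg1_B: assumes "kdeg 1 d" "ks (dk d) = 0" shows "d \<in> B"
proof -
  obtain u v w where uvw: "ka1 d = vY * w - vZ * v" "ka2 d = vZ * u - vX * w" "ka3 d = vX * v - vY * u"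
    using koszul_exact1[of "ka1 d" "ka2 d" "ka3 d"] assms(2) by auto
  have "d = dk (kB (- u) (- v) (- w))"
    using assms(1) by (intro kos_eqI) (simp_all add: uvw kdeg_def)
  then show ?thesis using dk_B by metis
qed

subsection \<open>Bases of the Koszul homology\<close>

text \<open>The weights of the surviving pairs: \<open>fv w\<close> is no cycle modulo
  \<open>I\<close> for the three weights around \<open>js\<close>, and the partner of
  \<open>fv (- js)\<close> would be \<open>ev js\<close>, which is lost with \<sigma>. Below,
  \<open>EW\<close> begins with the negatives of these weights so that partners have equal
  positions.\<close>

definition "Sl = filter (\<lambda>w. w \<notin> {js - 1, js, js + 1, - js}) [- int k..int k]"
definition "Rl = filter (\<lambda>w. w \<noteq> js \<and> - w \<notin> set Sl) [- int k..int k]"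
definition "EW = map uminus Sl @ Rl"
definition "FW = Sl @ [- js]"
definition "El = map ev EW @ (if be = 0 then [kA (W k 0 0) 0 0] else [])"
definition "Cl = map cn EW @ (if be = 0 then [(k + 1, 0, 0)] else [])"
text \<open>As \<sigma> is a socle element, its three products with e_2 e_3, e_3 e_1 and e_1 e_2 are
  new cycles; they have no counterpart over Q/g.\<close>

definition "Fl = map fv FW @ [kB (WT sgm) 0 0, kB 0 (WT sgm) 0, kB 0 0 (WT sgm)]"
definition "Gl = [kT (WT tpm), kT (WT sgm :: 'k ps3)]"

lemma set_Sl: "set Sl = rng - {js - 1, js, js + 1, - js}"
  by (auto simp: Sl_def)

lemma set_EW: "set EW = rng - {js}"
proof -
  have "set EW \<subseteq> rng - {js}" by (auto simp: EW_def Rl_def set_Sl)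
  moreover have "w \<in> set EW" if "w \<in> rng - {js}" for w
  proof (cases "- w \<in> set Sl")
    case True
    then have "- (- w) \<in> uminus ` set Sl" by blast
    then show ?thesis by (simp add: EW_def)
  qed (use that in \<open>simp add: EW_def Rl_def\<close>)
  ultimately show ?thesis by blast
qed

lemma distinct_EW: "distinct EW"
  unfolding EW_def by (auto simp: distinct_map Sl_def Rl_def)

lemma set_FW: "set FW = rng - {js - 1, js, js + 1}"
  using k be by (auto simp: FW_def set_Sl)

lemma distinct_FW: "distinct FW"
  by (auto simp: FW_def set_Sl) (simp add: Sl_def)

lemma len_EW: "length EW = 2 * k"
proof -
  have "js \<in> rng" using k be by auto
  then have "card (rng - {js}) = 2 * k" by simp
  then show ?thesis using distinct_card[OF distinct_EW] set_EW by simp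
qed

lemma len_Sl: "length Sl = 2 * k - 2 - be"
proof -
  have "length Sl = card (rng - {js - 1, js, js + 1, - js})"
    using distinct_card[of Sl] by (simp add: set_Sl) (simp add: Sl_def)
  also have "\<dots> = card rng - card ({js - 1, js, js + 1, - js} \<inter> rng)"
    by (subst card_Diff_subset_Int) (auto simp: Int_commute)
  \<comment> \<open>For \<open>be = 0\<close> the weight \<open>js + 1\<close> exceeds k, so one
    weight fewer is lost. This decides the parity of \<open>r\<close>.\<close>
  also have "{js - 1, js, js + 1, - js} \<inter> rng = (if be = 0 then {js - 1, js, - js} else {js - 1, js, js + 1, - js})"
    using k be by auto
  also have "card rng - card \<dots> = 2 * k - 2 - be"
    using k be by (auto simp: card_insert_if)
  finally show ?thesis .
qed

lemma len_El: "length El = 2 * k + 1 - be" and len_Cl: "length Cl = length El"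
  using be by (auto simp: El_def Cl_def len_EW)

lemma set_Cl: "set Cl = Cs"
  by (auto simp: Cl_def Cs_def set_EW)

lemma distinct_Cl: "distinct Cl"
proof -
  have "(k + 1, 0, 0) \<noteq> cn w" if "w \<in> rng" for w
    using cn_cases[OF that] by (metis Pair_inject Suc_eq_plus1 nat_less_le lessI not_less nle_le)
  then have n: "(k + 1, 0, 0) \<notin> cn ` set EW" unfolding set_EW by blast
  have "distinct (map cn EW)" using distinct_EW cn_inj by (simp add: distinct_map inj_on_subset[OF cn_inj subset_UNIV])
  then show ?thesis using n unfolding Cl_def by (cases "be = 0") (simp_all only: if_True if_False distinct_append set_map, auto)
qed

lemma card_Cs: "card Cs = length El"
  using distinct_card[OF distinct_Cl] by (simp add: set_Cl len_Cl)

lemma El_Cl: "i < length El \<Longrightarrow> ks (dk (El ! i)) = WT (Cl ! i)"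
proof -
  assume i: "i < length El"
  show ?thesis
  proof (cases "i < length EW")
    case True
    then have "EW ! i \<in> rng" using nth_mem[OF True] set_EW by blast
    then show ?thesis using True by (simp add: El_def Cl_def nth_append dk_ev del: dk_sel)
  next
    case False
    then have b: "be = 0" "i = length EW" using i by (auto simp: El_def split: if_splits)
    have "El = map ev EW @ [kA (W k 0 0) 0 0]" "Cl = map cn EW @ [(k + 1, 0, 0)]"
      unfolding El_def Cl_def using b(1) by simp_all
    then show ?thesis unfolding b(2) by (simp add: nth_append X_W)
  qed
qed

lemma El_props: assumes "v \<in> set El"
  shows "v \<in> Z" "kdeg 1 v" "ordge (k - 1) (ka1 v)" "ordge (k - 1) (ka2 v)" "ordge (k - 1) (ka3 v)"
proof -
  obtain i where i: "i < length El" "v = El ! i" using assms by (metis in_set_conv_nth)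
  have v: "(\<exists>w\<in>rng - {js}. v = ev w) \<or> v = kA (W k 0 0) 0 0"
    using assms by (auto simp: El_def set_EW split: if_splits)
  then show d: "kdeg 1 v" using ev_deg by auto
  have "ks (dk v) \<in> I" using El_Cl[OF i(1)] i(2) WT_I[OF Cs_Lam[of "Cl ! i"]] set_Cl nth_mem[of i Cl] i(1) len_Cl by auto
  moreover have "dk v = sc (ks (dk v))" using d by (intro kos_eqI) (simp_all add: kdeg_def)
  ultimately have "kin I (dk v)" using tidealD(1)[OF I] by (metis kin_def sc_sel)
  then show "v \<in> Z" by (simp add: Z_def)
  show "ordge (k - 1) (ka1 v)" "ordge (k - 1) (ka2 v)" "ordge (k - 1) (ka3 v)"
    using v ev_ord by (auto intro!: ordge_W)
qed

text \<open>A 1-cycle has its boundary in \<open>I\<close>. Writing that boundary in the generators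
  and subtracting their lifts leaves a cycle over Q, which bounds by \<open>kdeg1_B\<close>.\<close>

lemma span_El: assumes v: "v \<in> Z" "kdeg 1 v" shows "\<exists>c. v - comb c El \<in> B"
proof -
  have "ks (dk v) \<in> I" using v(1) by (simp add: Z_def kin_def del: dk_sel)
  then obtain h where "ks (dk v) = (\<Sum>s\<in>WT ` Cs. h s * s)"
    using gen_I genideal_TA[of "WT ` Cs :: 'k ps3 set"] finite_Cs by auto
  then have h: "ks (dk v) = (\<Sum>m\<in>Cs. h (WT m) * WT m)"
    by (simp add: sum.reindex inj_on_subset[OF WT_inj] del: dk_sel)
  have "\<forall>m\<in>Cs. \<exists>e. e \<in> set El \<and> ks (dk e) = WT m"
  proof
    fix m assume "m \<in> Cs"
    then obtain i where "i < length El" "m = Cl ! i" using set_Cl len_Cl by (metis in_set_conv_nth)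
    then show "\<exists>e. e \<in> set El \<and> ks (dk e) = WT m" using El_Cl nth_mem by blast
  qed
  then obtain e where e: "\<And>m. m \<in> Cs \<Longrightarrow> e m \<in> set El" "\<And>m. m \<in> Cs \<Longrightarrow> ks (dk (e m)) = WT m" by metis
  define u where "u = (\<Sum>m\<in>Cs. sc (h (WT m)) * e m)"
  have "u \<in> Spn El" unfolding u_def by (intro Spn_sum Spn_mem e(1))
  then obtain c where c: "u = comb c El" by (auto simp: Spn_def)
  have sums: "ks (dk (sum F S)) = (\<Sum>m\<in>S. ks (dk (F m)))" "kdeg 1 (sum F S)" if "\<And>m. m \<in> S \<Longrightarrow> kdeg 1 (F m)"
    for F :: "nat \<times> nat \<times> nat \<Rightarrow> 'k ps3 kos" and S
    using that by (induct S rule: infinite_finite_induct) (simp_all add: algebra_simps kdeg_def)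
  have ed: "kdeg 1 (sc (h (WT m)) * e m)" if "m \<in> Cs" for m
    using El_props(2)[OF e(1)[OF that]] by (simp add: kdeg_def)
  have "ks (dk (sc r * w)) = r * ks (dk w)" for r and w :: "'k ps3 kos" by (simp add: algebra_simps)
  note scale = this
  have "ks (dk u) = (\<Sum>m\<in>Cs. ks (dk (sc (h (WT m)) * e m)))"
    unfolding u_def by (rule sums(1)) (rule ed)
  also have "\<dots> = (\<Sum>m\<in>Cs. h (WT m) * WT m)"
    by (intro sum.cong refl) (simp only: scale e(2))
  finally have "ks (dk u) = (\<Sum>m\<in>Cs. h (WT m) * WT m)" .
  then have "ks (dk (v - u)) = 0" unfolding dk_diff using h by (simp del: dk_sel)
  moreover have "kdeg 1 u" unfolding u_def by (rule sums(2)) (rule ed)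
  then have "kdeg 1 (v - u)" using v(2) by (simp add: kdeg_def)
  ultimately show ?thesis using kdeg1_B c by blast
qed

lemma B_cases: assumes "v \<in> B"
  obtains w i where "v = dk w + i" "ks i \<in> I" "ka1 i \<in> I" "ka2 i \<in> I" "ka3 i \<in> I" "kb1 i \<in> I" "kb2 i \<in> I" "kb3 i \<in> I" "kt i \<in> I"
  using assms by (auto simp: B_def kin_def)

text \<open>The boundary map identifies A_1 with the quotient of \<open>I\<close> by its product
  with the maximal ideal, where the corner functionals separate the generators.\<close>

lemma indep_El: assumes "comb c El \<in> B" "i < length El" shows "ct (c i) = 0"
proof (rule indepI[OF _ _ assms])
  show "set El \<subseteq> Z" using El_props(1) by blast
  fix i assume i: "i < length El"
  have m: "Cl ! i \<in> Cs" using i set_Cl len_Cl nth_mem by metis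
  have B0: "LT (Cl ! i) (ks (dk v)) = 0" if v: "v \<in> B" for v
  proof -
    obtain w j where j: "v = dk w + j" "ka1 j \<in> I" "ka2 j \<in> I" "ka3 j \<in> I" using B_cases[OF v] by metis
    have "ks (dk v) = vX * ka1 j + vY * ka2 j + vZ * ka3 j" unfolding j(1) dk_add dk_dk by simp
    then show ?thesis using corner_scale[OF m] j by simp
  qed
  show "\<exists>\<theta> :: 'k ps3 kos \<Rightarrow> 'k. (\<forall>u v. \<theta> (u + v) = \<theta> u + \<theta> v) \<and>
      (\<forall>r v. \<theta> (sc (cst r) * v) = r * \<theta> v) \<and> (\<forall>v\<in>B. \<theta> v = 0) \<and>
      (\<forall>j<length El. \<theta> (El ! j) = (if i = j then 1 else 0))"
  proof (intro exI[of _ "\<lambda>v. LT (Cl ! i) (ks (dk v))"] conjI allI ballI impI)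
    fix r :: 'k and v :: "'k ps3 kos"
    have "ks (dk (sc (cst r) * v)) = cst r * ks (dk v)" by (simp add: algebra_simps)
    then show "LT (Cl ! i) (ks (dk (sc (cst r) * v))) = r * LT (Cl ! i) (ks (dk v))" by (simp del: dk_sel)
  next
    fix j assume j: "j < length El"
    show "LT (Cl ! i) (ks (dk (El ! j))) = (if i = j then 1 else 0)"
      unfolding El_Cl[OF j] LT_WT using nth_eq_iff_index_eq[OF distinct_Cl] i j len_Cl by simp
  qed (simp_all add: dk_add B0 del: dk_sel)
qed

lemma Gl_props: "v \<in> set Gl \<Longrightarrow> v \<in> Z \<and> kdeg 3 v"
  using sig_kill[of vX] sig_kill[of vY] sig_kill[of vZ] top_kill[of vX] top_kill[of vY] top_kill[of vZ] tidealD(1)[OF I]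
  by (auto simp: Gl_def Z_def kin_def simp del: WT.simps)

text \<open>Every functional in \<open>Lam k be\<close> other than those of s and \<sigma> is
  reached by a move from a larger triple in the set, hence vanishes on an element that all variables
  send into \<open>I\<close>.\<close>

lemma socle_I:
  assumes t: "vX * t \<in> I" "vY * t \<in> I" "vZ * t \<in> I"
  shows "t - (cst (LT tpm t) * WT tpm + cst (LT sgm t) * WT sgm) \<in> I"
proof -
  have tX: "L a b c t = 0" if "(Suc a, b, c) \<in> Lam k be" for a b c
    using LT_I[OF t(1) that] by simp
  have tZ: "L a b c t = 0" if "(a, b, Suc c) \<in> Lam k be" for a b c
    using LT_I[OF t(3) that] by simp
  have "LT l t = 0" if l: "l \<in> Lam k be" "l \<noteq> tpm" "l \<noteq> sgm" for l
  proof (cases l)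
    case (fields a b c)
    have G: "a + b < k" "b + c < k" using l fields by (auto simp: Lam_def LamG_def)
    show ?thesis
    proof (cases "Suc (a + b) < k")
      case True
      then show ?thesis using tX[of a b c] G fields by (simp add: Lam_iff)
    next
      case aF: False
      show ?thesis
      proof (cases "Suc (b + c) < k")
        case True
        then show ?thesis using tZ[of a b c] G fields by (simp add: Lam_iff)
      next
        case False
        then have e: "a + b = k - 1" "b + c = k - 1" using aF G by auto
        then obtain b' where b': "b = Suc b'" using l(2) fields by (cases b) auto
        \<comment> \<open>Only a + b = b + c = k - 1 with b > 0 remains, where neither x nor z
          applies. The functional is the second term of \<open>L_Y\<close> at this triple; the first
          term is already known to vanish by multiplication with x.\<close>
        have "(Suc a, b', Suc c) \<in> Lam k be" using G b' by (simp add: Lam_iff)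
        from LT_I[OF t(2) this] have 1: "(if b' = 0 then 0 else L (Suc a) (b' - 1) (Suc c) t) + L a b c t = 0"
          by (simp add: b')
        have "b' \<noteq> 0 \<Longrightarrow> L (Suc a) (b' - 1) (Suc c) t = 0"
          by (rule tX) (use G b' in \<open>simp add: Lam_iff\<close>)
        then show ?thesis using 1 fields by (simp split: if_splits)
      qed
    qed
  qed
  then have "LT l (t - (cst (LT tpm t) * WT tpm + cst (LT sgm t) * WT sgm)) = 0" if "l \<in> Lam k be" for l
    using that sgm_tpm by (cases "l = tpm"; cases "l = sgm") (simp_all add: LT_WT del: WT.simps LT.simps)
  then show ?thesis unfolding I_eq IL_def by blast
qed

lemma comb_two: "comb c [u, v] = sc (c 0) * u + sc (c (Suc 0)) * v"
  by (simp add: comb_Cons)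

lemma span_Gl: assumes v: "v \<in> Z" "kdeg 3 v" shows "\<exists>c. v - comb c Gl \<in> B"
proof -
  have "vX * kt v \<in> I" "vY * kt v \<in> I" "vZ * kt v \<in> I" using v by (auto simp: Z_def kin_def)
  from socle_I[OF this] have s: "kt v - (cst (LT tpm (kt v)) * WT tpm + cst (LT sgm (kt v)) * WT sgm) \<in> I" .
  let ?c = "\<lambda>i::nat. if i = 0 then cst (LT tpm (kt v)) else cst (LT sgm (kt v))"
  have "v - comb ?c Gl \<in> B"
    by (rule kin_B) (use s v tidealD(1)[OF I] in \<open>simp add: kin_def Gl_def comb_two kdeg_def del: WT.simps LT.simps\<close>)
  then show ?thesis by blast
qed

lemma indep_Gl: assumes "comb c Gl \<in> B" "i < length Gl" shows "ct (c i) = 0"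
proof (rule indepI[OF _ _ assms])
  show "set Gl \<subseteq> Z" using Gl_props by blast
  have B0: "LT m (kt v) = 0" if v: "v \<in> B" "m \<in> Lam k be" for v m
    using LT_I[OF _ v(2)] B_cases[OF v(1)] by (metis add_0 dk_sel(8) kos_sel(16))
  fix i assume i: "i < length Gl"
  define m where "m = (if i = 0 then tpm else sgm)"
  have m: "m \<in> Lam k be" using sgm_Lam tpm_Lam by (simp add: m_def)
  show "\<exists>\<theta> :: 'k ps3 kos \<Rightarrow> 'k. (\<forall>u v. \<theta> (u + v) = \<theta> u + \<theta> v) \<and>
      (\<forall>r v. \<theta> (sc (cst r) * v) = r * \<theta> v) \<and> (\<forall>v\<in>B. \<theta> v = 0) \<and>
      (\<forall>j<length Gl. \<theta> (Gl ! j) = (if i = j then 1 else 0))"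
  proof (intro exI[of _ "\<lambda>v. LT m (kt v)"] conjI allI ballI impI)
    fix j assume j: "j < length Gl"
    then show "LT m (kt (Gl ! j)) = (if i = j then 1 else 0)"
      using i sgm_tpm by (auto simp: Gl_def less_Suc_eq m_def LT_WT simp del: WT.simps LT.simps)
  qed (simp_all add: B0 m)
qed

lemma Fl_props: assumes "v \<in> set Fl" shows "v \<in> Z \<and> kdeg 2 v"
proof -
  have "(\<exists>w\<in>set FW. v = fv w) \<or> v = kB (WT sgm) 0 0 \<or> v = kB 0 (WT sgm) 0 \<or> v = kB 0 0 (WT sgm)"
    using assms by (auto simp: Fl_def)
  then show ?thesis
  proof (elim disjE bexE)
    fix w assume "w \<in> set FW" "v = fv w"
    then show ?thesis using fv_Z[of w] fv_deg[of w] by (simp add: set_FW)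
  qed (use sig_kill[of vX] sig_kill[of vY] sig_kill[of vZ] tidealD(1,5)[OF I] in \<open>simp_all add: Z_def kin_def\<close>)
qed

text \<open>Over Q/g, subtracting the multiples of \<open>fv w\<close> prescribed by the pairing
  reduces the cycle to a remainder governed by \<open>duality\<close>. Passing back to
  \<open>I\<close>, which has codimension one in \<open>g\<close>, the lost weights must have
  coefficient zero, and the defect in \<open>g\<close> is accounted for by the three cycles built
  from \<sigma>.\<close>

lemma span_Fl: assumes v: "v \<in> Z" "kdeg 2 v" shows "\<exists>c. v - comb c Fl \<in> B"
proof -
  define c where "c w = \<phi> (dt (ev (- w)) v)" for w
  define f where "f = v - (\<Sum>w\<in>rng. sc (cst (c w)) * fv w)"
  have dka: "ka1 (dk (sum F S)) = (\<Sum>w\<in>S. ka1 (dk (F w)))" "ka2 (dk (sum F S)) = (\<Sum>w\<in>S. ka2 (dk (F w)))"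
    "ka3 (dk (sum F S)) = (\<Sum>w\<in>S. ka3 (dk (F w)))" for F :: "int \<Rightarrow> 'k ps3 kos" and S
    by (induct S rule: infinite_finite_induct) (simp_all add: dk_add del: dk_sel, simp_all add: dk_def)
  have dks: "ka1 (dk (sc r * w)) = r * ka1 (dk w)" "ka2 (dk (sc r * w)) = r * ka2 (dk w)"
    "ka3 (dk (sc r * w)) = r * ka3 (dk w)" for r and w :: "'k ps3 kos" by (simp_all add: algebra_simps)
  have vI: "ka1 (dk v) \<in> I" "ka2 (dk v) \<in> I" "ka3 (dk v) \<in> I" using v(1) by (auto simp: Z_def kin_def simp del: dk_sel)
  have fvg: "ka1 (dk (fv w)) \<in> g" "ka2 (dk (fv w)) \<in> g" "ka3 (dk (fv w)) \<in> g" if "w \<in> rng" for w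
    unfolding dk_fv[OF that] using P_g[of "w - 1"] P_g[of w] P_g[of "w + 1"] by (auto intro: g_mult(1) IL_minus)
  have fg: "ka1 (dk f) \<in> g" "ka2 (dk f) \<in> g" "ka3 (dk f) \<in> g"
    unfolding f_def dk_diff kos_sel dka dks
    using vI g_sub fvg by (auto intro!: IL_diff IL_sum g_mult(1) simp del: dk_sel)
  have dts: "dt u (sum F S) = (\<Sum>w\<in>S. dt u (F w))" for u and F :: "int \<Rightarrow> 'k ps3 kos" and S
    by (induct S rule: infinite_finite_induct) (simp_all add: dt_def algebra_simps)
  have dtd: "dt u (a - b) = dt u a - dt u b" for u a b by (simp add: dt_def algebra_simps)
  have dtsc: "dt u (sc r * b) = r * dt u b" for u r b by (simp add: dt_def algebra_simps)
  have z: "\<phi> (dt (ev w) f) = 0" if w: "w \<in> rng" for w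
  proof -
    have "\<phi> (dt (ev w) f) = \<phi> (dt (ev w) v) - (\<Sum>w'\<in>rng. c w' * \<phi> (dt (ev w) (fv w')))"
      unfolding f_def dtd dts dtsc by (simp only: L_diff L_sum L_cst)
    also have "(\<Sum>w'\<in>rng. c w' * \<phi> (dt (ev w) (fv w'))) = (\<Sum>w'\<in>rng. if w' = - w then c (- w) else 0)"
      by (intro sum.cong refl) (use w in \<open>auto simp only: pairing split: if_splits\<close>, auto)
    also have "\<dots> = c (- w)" using w by simp
    finally show ?thesis by (simp add: c_def)
  qed
  obtain q where q: "kb1 f - vX * q \<in> g" "kb2 f - vY * q \<in> g" "kb3 f - vZ * q \<in> g"
    using duality[OF fg z] by blast
  \<comment> \<open>\<open>g\<close> is \<open>I\<close> plus the multiples of \<sigma>, and the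
    maximal ideal sends \<sigma> into \<open>I\<close>.\<close>
  have n_g: "h * s \<in> I" if "ct h = 0" "s \<in> g" for h s
  proof -
    have "h * s = h * (s - cst (LT sgm s) * WT sgm) + cst (LT sgm s) * (h * WT sgm)"
      by (simp add: algebra_simps)
    then show ?thesis using tidealD(3)[OF I g_remove[OF that(2)], of h] tidealD(3)[OF I sig_kill[OF that(1)]] tidealD(2)[OF I] by metis
  qed
  define g1 g2 g3 where "g1 = kb1 f - vX * q" and "g2 = kb2 f - vY * q" and "g3 = kb3 f - vZ * q"
  note g = q[folded g1_def g2_def g3_def]
  have "ka1 (dk f) = vZ * g2 - vY * g3" "ka2 (dk f) = vX * g3 - vZ * g1" "ka3 (dk f) = vY * g1 - vX * g2"
    by (simp_all add: g1_def g2_def g3_def algebra_simps)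
  then have fI: "ka1 (dk f) \<in> I" "ka2 (dk f) \<in> I" "ka3 (dk f) \<in> I"
    using g by (auto intro!: tidealD(6)[OF I] n_g simp del: dk_sel)
  have sumI: "(\<Sum>w\<in>rng. cst (c w) * ka1 (dk (fv w))) \<in> I" "(\<Sum>w\<in>rng. cst (c w) * ka2 (dk (fv w))) \<in> I"
    "(\<Sum>w\<in>rng. cst (c w) * ka3 (dk (fv w))) \<in> I"
    using tidealD(6)[OF I vI(1) fI(1)] tidealD(6)[OF I vI(2) fI(2)] tidealD(6)[OF I vI(3) fI(3)]
    unfolding f_def dk_diff kos_sel dka dks by (simp_all del: dk_sel)
  \<comment> \<open>The combination of the boundaries of the \<open>fv w\<close> lies in
    \<open>I\<close>. Its \<sigma>-coefficient isolates one weight in each component, because P(js)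
    occurs first for \<open>js + 1\<close>, second for \<open>js\<close> and third for
    \<open>js - 1\<close>.\<close>
  have c0: "c w = 0" if w: "w \<in> rng" "w \<in> {js - 1, js, js + 1}" for w
  proof -
    have pos: "js - 1 > 0" using k be by auto
    have s: "(\<Sum>w'\<in>rng. c w' * ((if w' = w then s else 0))) = c w * s" for s
      using w by (simp add: if_distrib cong: if_cong)
    have LTsc: "LT sgm (r * P w') = ct r * (if w' = js then 1 else 0)" for r w'
    proof -
      have "r * P w' - cst (ct r) * P w' \<in> I" using n_g[of "r - cst (ct r)", OF _ P_g[of w']] by (simp add: algebra_simps)
      from LT_I[OF this sgm_Lam] show ?thesis by (simp add: LT_sig_P)
    qed
    consider "w = js + 1" | "w = js" | "w = js - 1" using w(2) by blast
    then show ?thesis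
    proof cases
      case 1
      have "0 = (\<Sum>w'\<in>rng. c w' * LT sgm (ka1 (dk (fv w'))))" using LT_I[OF sumI(1) sgm_Lam] by (simp del: dk_sel)
      also have "\<dots> = (\<Sum>w'\<in>rng. c w' * (if w' = w then - 1 else 0))"
        by (intro sum.cong refl) (use 1 pos in \<open>auto simp: dk_fv LTsc simp del: dk_sel\<close>)
      finally show ?thesis unfolding s by simp
    next
      case 2
      have "0 = (\<Sum>w'\<in>rng. c w' * LT sgm (ka2 (dk (fv w'))))" using LT_I[OF sumI(2) sgm_Lam] by (simp del: dk_sel)
      also have "\<dots> = (\<Sum>w'\<in>rng. c w' * (if w' = w then 1 else 0))"
        by (intro sum.cong refl) (use 2 pos in \<open>auto simp: dk_fv LTsc simp del: dk_sel\<close>)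
      finally show ?thesis unfolding s by simp
    next
      case 3
      have "0 = (\<Sum>w'\<in>rng. c w' * LT sgm (ka3 (dk (fv w'))))" using LT_I[OF sumI(3) sgm_Lam] by (simp del: dk_sel)
      also have "\<dots> = (\<Sum>w'\<in>rng. c w' * (if w' = w then - 1 else 0))"
        by (intro sum.cong refl) (use 3 pos in \<open>auto simp: dk_fv LTsc simp del: dk_sel\<close>)
      finally show ?thesis unfolding s by simp
    qed
  qed
  have "(\<Sum>w\<in>rng. sc (cst (c w)) * fv w) = (\<Sum>w\<in>set FW. sc (cst (c w)) * fv w)"
    by (rule sum.mono_neutral_right) (use c0 in \<open>auto simp: set_FW sc_0\<close>)
  then have veq: "v = f + (\<Sum>w\<in>set FW. sc (cst (c w)) * fv w)" by (simp add: f_def)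
  let ?\<gamma> = "\<lambda>s. sc (cst (LT sgm s))"
  define u where "u = (\<Sum>w\<in>set FW. sc (cst (c w)) * fv w) + (?\<gamma> g1 * kB (WT sgm) 0 0 + ?\<gamma> g2 * kB 0 (WT sgm) 0 + ?\<gamma> g3 * kB 0 0 (WT sgm))"
  have "u \<in> Spn Fl" unfolding u_def by (intro Spn_add Spn_sum Spn_mem) (auto simp: Fl_def)
  moreover have "v - u \<in> B"
  proof -
    have degs: "kdeg 2 (sum F S)" if "\<And>w. w \<in> S \<Longrightarrow> kdeg 2 (F w)" for F :: "int \<Rightarrow> 'k ps3 kos" and S
      using that by (induct S rule: infinite_finite_induct) (simp_all add: kdeg_def)
    have "kdeg 2 (\<Sum>w\<in>rng. sc (cst (c w)) * fv w)"
      by (rule degs) (use fv_deg in \<open>simp add: kdeg_def\<close>)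
    then have "kdeg 2 f" using v(2) unfolding f_def by (simp add: kdeg_def)
    then have "f = kB (kb1 f) (kb2 f) (kb3 f)" by (rule kdeg_eq)
    then have "v - u = dk (kT q) + kB (g1 - cst (LT sgm g1) * WT sgm) (g2 - cst (LT sgm g2) * WT sgm) (g3 - cst (LT sgm g3) * WT sgm)"
      unfolding veq u_def by (intro kos_eqI) (simp_all add: g1_def g2_def g3_def \<open>kdeg 2 f\<close>[unfolded kdeg_def])
    moreover have "kB (g1 - cst (LT sgm g1) * WT sgm) (g2 - cst (LT sgm g2) * WT sgm) (g3 - cst (LT sgm g3) * WT sgm) \<in> B"
      using g_remove g tidealD(1)[OF I] by (intro kin_B) (simp add: kin_def)
    ultimately show ?thesis using B_add[OF dk_B] by metis
  qed
  ultimately show ?thesis by (auto simp: Spn_def)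
qed

text \<open>The cycles \<open>fv w\<close> are detected by their partners under the pairing, the
  three \<sigma>-cycles by \<sigma>-coefficients corrected so as to vanish on boundaries.\<close>

lemma indep_Fl: assumes "comb c Fl \<in> B" "i < length Fl" shows "ct (c i) = 0"
proof (rule indepI[OF _ _ assms])
  show "set Fl \<subseteq> Z" using Fl_props by blast
  fix i assume i: "i < length Fl"
  let ?n = "length FW"
  have len: "length Fl = ?n + 3" by (simp add: Fl_def)
  have nthF: "Fl ! j = fv (FW ! j)" if "j < ?n" for j using that by (simp add: Fl_def nth_append)
  have nthS: "Fl ! ?n = kB (WT sgm) 0 0" "Fl ! Suc ?n = kB 0 (WT sgm) 0" "Fl ! Suc (Suc ?n) = kB 0 0 (WT sgm)"
    by (simp_all add: Fl_def nth_append)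
  have FWr: "FW ! j \<in> rng" if "j < ?n" for j using nth_mem[OF that] set_FW by blast
  have split: "P j" if "j < length Fl" "\<And>j. j < ?n \<Longrightarrow> P j" "P ?n" "P (Suc ?n)" "P (Suc (Suc ?n))" for j and P :: "nat \<Rightarrow> bool"
    using that(1) less_Suc_eq that(2-) unfolding len by (metis add_Suc_right numeral_3_eq_3 add_0_right)
  show "\<exists>\<theta> :: 'k ps3 kos \<Rightarrow> 'k. (\<forall>u v. \<theta> (u + v) = \<theta> u + \<theta> v) \<and>
      (\<forall>r v. \<theta> (sc (cst r) * v) = r * \<theta> v) \<and> (\<forall>v\<in>B. \<theta> v = 0) \<and>
      (\<forall>j<length Fl. \<theta> (Fl ! j) = (if i = j then 1 else 0))"
  proof (cases "i < ?n")
    case True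
    define w where "w = - (FW ! i)"
    have w: "w \<in> rng" using FWr[OF True] by (auto simp: w_def)
    have evI: "h * WT sgm \<in> I" if "h \<in> {ka1 (ev w), ka2 (ev w), ka3 (ev w)}" for h
    proof (rule sig_kill)
      have "ordge (Suc 0) h" using that ev_ord[OF w] k by (auto elim!: ordge_mono)
      then show "ct h = 0" by (rule ordge_ct)
    qed
    show ?thesis
    proof (intro exI[of _ "\<lambda>v. \<phi> (dt (ev w) v)"] conjI allI ballI impI)
      fix u v show "\<phi> (dt (ev w) (u + v)) = \<phi> (dt (ev w) u) + \<phi> (dt (ev w) v)"
        by (simp add: dt_def algebra_simps)
    next
      fix r v
      have "dt (ev w) (sc (cst r) * v) = cst r * dt (ev w) v" by (simp add: dt_def algebra_simps)
      then show "\<phi> (dt (ev w) (sc (cst r) * v)) = r * \<phi> (dt (ev w) v)" by simp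
    next
      fix v assume "v \<in> B"
      then obtain y j where j: "v = dk y + j" "kb1 j \<in> I" "kb2 j \<in> I" "kb3 j \<in> I" by (metis B_cases)
      have "dt (ev w) v = kt y * ks (dk (ev w)) + (ka1 (ev w) * kb1 j + ka2 (ev w) * kb2 j + ka3 (ev w) * kb3 j)"
        by (simp add: dt_def j(1) algebra_simps)
      also have "\<dots> \<in> g"
        using g_sub j P_g[of w] w dk_ev[OF w]
        by (auto intro!: IL_add g_mult(1) simp: P_def simp del: dk_sel)
      finally show "\<phi> (dt (ev w) v) = 0" by (rule phi_g)
    next
      fix j assume "j < length Fl"
      then show "\<phi> (dt (ev w) (Fl ! j)) = (if i = j then 1 else 0)"
      proof (rule split)
        fix j assume j: "j < ?n"
        show "\<phi> (dt (ev w) (Fl ! j)) = (if i = j then 1 else 0)"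
          unfolding nthF[OF j] pairing[OF FWr[OF j] w] unfolding w_def
          using nth_eq_iff_index_eq[OF distinct_FW True j] by simp
      qed (use True evI phi_I in \<open>simp_all add: nthS dt_def\<close>)
    qed
  next
    case False
    \<comment> \<open>A boundary has entries x t, y t, z t. The triples \<open>l1\<close> and
      \<open>l2\<close> are chosen so that their functionals on z t reproduce the
      \<sigma>-coefficients of x t and y t; for \<open>be = 0\<close> the latter is zero, and that
      of z t vanishes in any case.\<close>
    define l1 where "l1 = (k - 1 - be, be, 1 :: nat)"
    define l2 where "l2 = (k - 1, 0 :: nat, 1 :: nat)"
    define \<theta>1 where "\<theta>1 v = LT sgm (kb1 v) - LT l1 (kb3 v)" for v :: "'k ps3 kos"
    define \<theta>2 where "\<theta>2 v = LT sgm (kb2 v) - (if be = 0 then 0 else LT l2 (kb3 v))" for v :: "'k ps3 kos"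
    define \<theta>3 where "\<theta>3 v = LT sgm (kb3 v)" for v :: "'k ps3 kos"
    have l: "l1 \<in> Lam k be" "l2 \<in> Lam k be" "l1 \<noteq> sgm" "l2 \<noteq> sgm"
      using k be by (auto simp: l1_def l2_def Lam_iff sig_def)
    have lin: "\<theta> (u + v) = \<theta> u + \<theta> v" "\<theta> (sc (cst r) * v) = r * \<theta> v" if "\<theta> \<in> {\<theta>1, \<theta>2, \<theta>3}" for \<theta> u v r
      using that by (auto simp: \<theta>1_def \<theta>2_def \<theta>3_def algebra_simps)
    have sX: "LT sgm (vX * t) = LT l1 (vZ * t)" and sY: "LT sgm (vY * t) = (if be = 0 then 0 else LT l2 (vZ * t))"
      and sZ: "LT sgm (vZ * t) = 0" for t
      by (rule be_cases; use k in \<open>simp add: sig_def l1_def l2_def\<close>)+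
    have B0: "\<theta> v = 0" if \<theta>: "\<theta> \<in> {\<theta>1, \<theta>2, \<theta>3}" and v: "v \<in> B" for \<theta> v
    proof -
      obtain y j where j: "v = dk y + j" "kb1 j \<in> I" "kb2 j \<in> I" "kb3 j \<in> I" using v by (metis B_cases)
      have "kb1 v = vX * kt y + kb1 j" "kb2 v = vY * kt y + kb2 j" "kb3 v = vZ * kt y + kb3 j" using j(1) by simp_all
      then show ?thesis using \<theta> LT_I[OF j(2) sgm_Lam] LT_I[OF j(3) sgm_Lam] LT_I[OF j(4) sgm_Lam] LT_I[OF j(4) l(1)] LT_I[OF j(4) l(2)]
        by (auto simp: \<theta>1_def \<theta>2_def \<theta>3_def sX sY sZ simp del: LT.simps)
    qed
    \<comment> \<open>The three functionals have degree k, while the entries of \<open>fv w\<close>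
      are homogeneous of degree k - 1.\<close>
    have fv0: "LT l (kb1 (fv w)) = 0 \<and> LT l (kb2 (fv w)) = 0 \<and> LT l (kb3 (fv w)) = 0"
      if "w \<in> rng" "l \<in> {sgm, l1, l2}" for w l
    proof -
      have "tdeg l = k" using that(2) k be by (auto simp: sig_def l1_def l2_def)
      then have LW: "LT l (W a b c) = 0" if "a + b + c = k - 1" for a b c
        using that k by (cases l) (auto simp: L_W)
      have "w > 0 \<or> w < 0 \<or> w = 0" by auto
      moreover have "nat w \<le> k" "nat (- w) \<le> k" using that(1) by auto
      ultimately show ?thesis using k by (elim disjE) (simp_all add: fv_def LW)
    qed
    have \<theta>fv: "\<theta> (fv w) = 0" if "\<theta> \<in> {\<theta>1, \<theta>2, \<theta>3}" "w \<in> rng" for \<theta> w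
      using that fv0[OF that(2), of sgm] fv0[OF that(2), of l1] fv0[OF that(2), of l2]
      by (auto simp: \<theta>1_def \<theta>2_def \<theta>3_def)
    have \<theta>s: "\<theta>1 (kB (WT sgm) 0 0) = 1" "\<theta>1 (kB 0 (WT sgm) 0) = 0" "\<theta>1 (kB 0 0 (WT sgm)) = 0"
      "\<theta>2 (kB (WT sgm) 0 0) = 0" "\<theta>2 (kB 0 (WT sgm) 0) = 1" "\<theta>2 (kB 0 0 (WT sgm)) = 0"
      "\<theta>3 (kB (WT sgm) 0 0) = 0" "\<theta>3 (kB 0 (WT sgm) 0) = 0" "\<theta>3 (kB 0 0 (WT sgm)) = 1"
      using l(3,4) by (simp_all add: \<theta>1_def \<theta>2_def \<theta>3_def LT_WT)
    define \<theta> where "\<theta> = (if i = ?n then \<theta>1 else if i = Suc ?n then \<theta>2 else \<theta>3)"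
    have mem: "\<theta> \<in> {\<theta>1, \<theta>2, \<theta>3}" by (simp add: \<theta>_def)
    have i3: "i = ?n \<or> i = Suc ?n \<or> i = Suc (Suc ?n)" using False i len by auto
    show ?thesis
    proof (intro exI[of _ \<theta>] conjI allI ballI impI lin[OF mem] B0[OF mem])
      fix j assume "j < length Fl"
      then show "\<theta> (Fl ! j) = (if i = j then 1 else 0)"
      proof (rule split)
        fix j assume j: "j < ?n"
        then show "\<theta> (Fl ! j) = (if i = j then 1 else 0)"
          using False \<theta>fv[OF mem FWr[OF j]] by (auto simp: nthF)
      qed (use i3 in \<open>auto simp: nthS \<theta>_def \<theta>s\<close>)
    qed
  qed
qed

text \<open>All entries of 1-cycles in the list have order at least k - 1, so those of a product
  reach the order 2 k - 2 required by \<open>high2\<close>.\<close>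

lemma El_El: assumes "u \<in> set El" "v \<in> set El" shows "u * v \<in> B"
proof (rule high2)
  note u = El_props[OF assms(1)] and v = El_props[OF assms(2)]
  show "kdeg 2 (u * v)" using u(2) v(2) by (simp add: kdeg_def times_kos_sel)
  have k2: "2 * k - 2 \<le> (k - 1) + (k - 1)" by simp
  show "ordge (2 * k - 2) (kb1 (u * v))" "ordge (2 * k - 2) (kb2 (u * v))" "ordge (2 * k - 2) (kb3 (u * v))"
    using u v by (auto simp: times_kos_sel kdeg_def intro!: ordge_diff ordge_mult'[OF _ _ k2])
qed

text \<open>The product has order at least 2 k - 2 unless \<sigma> is involved, so modulo
  \<open>I\<close> it is s times the value of the pairing. Products with the \<sigma>-cycles vanish
  because the entries of 1-cycles lie in the maximal ideal.\<close>

lemma El_Fl: assumes "i < length El" "j < length Fl"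
  shows "El ! i * Fl ! j - (if i = j \<and> i < 2 * k - 2 - be then Gl ! 0 else 0) \<in> B"
proof -
  let ?n = "length FW"
  have len: "length Fl = ?n + 3" "?n = Suc (length Sl)" by (simp_all add: Fl_def FW_def)
  note u = El_props[OF nth_mem[OF assms(1)]] and v = Fl_props[OF nth_mem[OF assms(2)]]
  have prod: "El ! i * Fl ! j = kT (dt (El ! i) (Fl ! j))"
    using u(2) v by (intro kos_eqI) (simp_all add: kdeg_def times_kos_sel dt_def)
  have fin: ?thesis if "dt (El ! i) (Fl ! j) - (if i = j \<and> i < 2 * k - 2 - be then WT tpm else 0) \<in> I"
  proof -
    have "kT (dt (El ! i) (Fl ! j)) - (if i = j \<and> i < 2 * k - 2 - be then Gl ! 0 else 0)
      = kT (dt (El ! i) (Fl ! j) - (if i = j \<and> i < 2 * k - 2 - be then WT tpm else 0))"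
      by (rule kos_eqI) (simp_all add: Gl_def del: WT.simps)
    moreover have "kin I \<dots>" using that tidealD(1)[OF I] by (simp only: kin_def kABT_sel)
    ultimately show ?thesis unfolding prod by (metis kin_B)
  qed
  show ?thesis
  proof (cases "j < ?n")
    case False
    have "ordge (Suc 0) (ka1 (El ! i))" "ordge (Suc 0) (ka2 (El ! i))" "ordge (Suc 0) (ka3 (El ! i))"
      using u k by (auto elim!: ordge_mono)
    then have "ka1 (El ! i) * WT sgm \<in> I" "ka2 (El ! i) * WT sgm \<in> I" "ka3 (El ! i) * WT sgm \<in> I"
      by (auto intro!: sig_kill dest: ordge_ct)
    moreover have "j = ?n \<or> j = Suc ?n \<or> j = Suc (Suc ?n)" using False assms(2) len by auto
    then have "Fl ! j \<in> {kB (WT sgm) 0 0, kB 0 (WT sgm) 0, kB 0 0 (WT sgm)}"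
      by (auto simp: Fl_def nth_append)
    ultimately have "dt (El ! i) (Fl ! j) \<in> I" by (auto simp: dt_def)
    then show ?thesis using False len len_Sl by (intro fin) auto
  next
    case True
    have Fj: "Fl ! j = fv (FW ! j)" using True by (simp add: Fl_def nth_append)
    have wr: "FW ! j \<in> rng" using nth_mem[OF True] set_FW by blast
    show ?thesis
    proof (cases "i < length EW")
      case False
      then have "El ! i = kA (W k 0 0) 0 0" using assms(1) by (auto simp: El_def nth_append split: if_splits)
      then have "dt (El ! i) (Fl ! j) = W k 0 0 * kb1 (fv (FW ! j))" by (simp add: dt_def Fj)
      also have "ordge (2 * k - 1) \<dots>"
        by (rule ordge_mult'[of k _ "k - 1"]) (use fv_ord[OF wr] k in \<open>auto intro: ordge_W\<close>)
      finally have "dt (El ! i) (Fl ! j) \<in> I" by (rule ordge_I)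
      then show ?thesis using False len_EW k by (intro fin) auto
    next
      case iE: True
      have Ei: "El ! i = ev (EW ! i)" using iE by (simp add: El_def nth_append)
      have er: "EW ! i \<in> rng" "EW ! i \<noteq> js" using nth_mem[OF iE] set_EW by auto
      have k2: "2 * k - 2 \<le> (k - 1) + (k - 1)" by simp
      have "ordge (2 * k - 2) (dt (El ! i) (Fl ! j))"
        unfolding dt_def Ei Fj by (intro ordge_add ordge_mult'[OF _ _ k2] ev_ord[OF er(1)] fv_ord[OF wr])
      from top_decomp[OF this]
      have t: "dt (El ! i) (Fl ! j) - cst (if EW ! i = - (FW ! j) then 1 else 0) * WT tpm \<in> I"
        unfolding Ei Fj pairing[OF wr er(1)] .
      \<comment> \<open>The last weight in \<open>FW\<close> is \<open>- js\<close>, whose partner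
        \<open>js\<close> does not occur in \<open>EW\<close>; so the pairing matches only positions
        within \<open>Sl\<close>.\<close>
      have "EW ! i = - (FW ! j) \<longleftrightarrow> i = j \<and> i < 2 * k - 2 - be"
      proof (cases "j < length Sl")
        case True
        then have "FW ! j = Sl ! j" "EW ! j = - (Sl ! j)" "j < length EW" by (simp_all add: FW_def EW_def nth_append)
        then show ?thesis using nth_eq_iff_index_eq[OF distinct_EW iE, of j] True len_Sl by auto
      next
        case False
        then have "FW ! j = - js" using \<open>j < ?n\<close> len by (simp add: FW_def nth_append)
        then show ?thesis using er(2) False len_Sl by auto
      qed
      then show ?thesis using t by (intro fin) (auto split: if_splits simp del: WT.simps)
    qed
  qed
qed

lemma class_G_trim:
  assumes "proj_dim TA (quotient_module TA I) = 3"
  shows "class_G TA I (2 * k - 2 - be)"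
proof (rule class_GI[of _ El Fl Gl])
  show "min_num_gens TA I = length El" by (simp add: min_num_gens_I card_Cs)
  have lF: "length Fl = 2 * k - 2 - be + 4" by (simp add: Fl_def FW_def len_Sl)
  show "2 \<le> 2 * k - 2 - be" "2 * k - 2 - be \<le> length El" "2 * k - 2 - be \<le> length Fl" "1 \<le> length Gl"
    "length Fl + 1 = length El + length Gl"
    using k be by (auto simp: len_El lF Gl_def)
qed (use assms El_props(1,2) Fl_props Gl_props span_El span_Fl span_Gl indep_El indep_Fl indep_Gl El_El El_Fl in \<open>blast+\<close>)

end

subsection \<open>Module homomorphisms\<close>

lemma mod_homD:
  assumes "f \<in> mod_hom R M N"
  shows "x \<in> carrier M \<Longrightarrow> f x \<in> carrier N"
    and "x \<in> carrier M \<Longrightarrow> y \<in> carrier M \<Longrightarrow> f (x \<oplus>\<^bsub>M\<^esub> y) = f x \<oplus>\<^bsub>N\<^esub> f y"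
    and "c \<in> carrier R \<Longrightarrow> x \<in> carrier M \<Longrightarrow> f (c \<odot>\<^bsub>M\<^esub> x) = c \<odot>\<^bsub>N\<^esub> f x"
  using assms by (auto simp: mod_hom_def hom_def)

lemma mod_homI:
  assumes "\<And>x. x \<in> carrier M \<Longrightarrow> f x \<in> carrier N"
    and "\<And>x y. x \<in> carrier M \<Longrightarrow> y \<in> carrier M \<Longrightarrow> f (x \<oplus>\<^bsub>M\<^esub> y) = f x \<oplus>\<^bsub>N\<^esub> f y"
    and "\<And>c x. c \<in> carrier R \<Longrightarrow> x \<in> carrier M \<Longrightarrow> f (c \<odot>\<^bsub>M\<^esub> x) = c \<odot>\<^bsub>N\<^esub> f x"
  shows "f \<in> mod_hom R M N"
  using assms by (auto simp: mod_hom_def hom_def)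

lemma mod_hom_zero:
  assumes "f \<in> mod_hom R M N" "module R M" "module R N"
  shows "f \<zero>\<^bsub>M\<^esub> = \<zero>\<^bsub>N\<^esub>"
proof -
  interpret M: module R M by fact
  interpret N: module R N by fact
  have "f \<zero>\<^bsub>M\<^esub> = f (\<zero>\<^bsub>R\<^esub> \<odot>\<^bsub>M\<^esub> \<zero>\<^bsub>M\<^esub>)" by simp
  also have "\<dots> = \<zero>\<^bsub>N\<^esub>" using mod_homD(1,3)[OF assms(1)] by (simp del: M.smult_l_null M.smult_r_null)
  finally show ?thesis .
qed

lemma mod_hom_minus:
  assumes "f \<in> mod_hom R M N" "module R M" "module R N" "x \<in> carrier M" "y \<in> carrier M"
  shows "f (x \<ominus>\<^bsub>M\<^esub> y) = f x \<ominus>\<^bsub>N\<^esub> f y"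
proof -
  interpret M: module R M by fact
  interpret N: module R N by fact
  have "f (\<ominus>\<^bsub>M\<^esub> y) \<oplus>\<^bsub>N\<^esub> f y = f (\<ominus>\<^bsub>M\<^esub> y \<oplus>\<^bsub>M\<^esub> y)"
    using mod_homD(2)[OF assms(1)] assms(5) by simp
  also have "\<dots> = \<zero>\<^bsub>N\<^esub>" using assms(5) mod_hom_zero[OF assms(1-3)] by (simp add: M.M.l_neg)
  finally have "f (\<ominus>\<^bsub>M\<^esub> y) = \<ominus>\<^bsub>N\<^esub> f y"
    using mod_homD(1)[OF assms(1)] assms(5) N.M.minus_equality[of "f (\<ominus>\<^bsub>M\<^esub> y)" "f y"] by simp
  then show ?thesis using mod_homD(2)[OF assms(1)] assms(4,5) by (simp add: a_minus_def)
qed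

subsection \<open>Failure of the Gorenstein property\<close>

context ps3_quot
begin

text \<open>The image of \<open>J\<close> in R, stored as constant sequences, since injectivity is
  tested only against modules whose elements are sequences. \<open>cmod UNIV\<close> is a copy of
  R.\<close>

definition cmod :: "'k ps3 set \<Rightarrow> ('k ps3 set, nat \<Rightarrow> 'k ps3 set) module" where
  "cmod J = \<lparr>carrier = (\<lambda>f _. qm I f) ` J, monoid.mult = undefined, one = undefined,
     ring.zero = (\<lambda>_. qm I 0), add = (\<lambda>f g _. f 0 \<oplus>\<^bsub>R\<^esub> g 0), module.smult = (\<lambda>c f _. c \<otimes>\<^bsub>R\<^esub> f 0)\<rparr>"

lemma cmod_module: assumes J: "tideal J" shows "module R (cmod J)"
proof (rule moduleI[OF cring_R])
  show "abelian_group (cmod J)"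
  proof (rule abelian_groupI)
    fix x assume "x \<in> carrier (cmod J)"
    then obtain f where f: "f \<in> J" "x = (\<lambda>_. qm I f)" by (auto simp: cmod_def)
    have "(\<lambda>_. qm I (- f)) \<in> carrier (cmod J)" using tidealD(5)[OF J f(1)] by (auto simp: cmod_def)
    moreover have "(\<lambda>_. qm I (- f)) \<oplus>\<^bsub>cmod J\<^esub> x = \<zero>\<^bsub>cmod J\<^esub>" by (simp add: f cmod_def qm_add[OF I])
    ultimately show "\<exists>y\<in>carrier (cmod J). y \<oplus>\<^bsub>cmod J\<^esub> x = \<zero>\<^bsub>cmod J\<^esub>" by blast
  qed (use tidealD(1,2)[OF J] in \<open>auto simp: cmod_def qm_add[OF I] ac_simps\<close>)
  fix a x assume "a \<in> carrier R" "x \<in> carrier (cmod J)"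
  then obtain r f where f: "f \<in> J" "x = (\<lambda>_. qm I f)" "a = qm I r" by (auto simp: cmod_def carrier_quot)
  have "a \<odot>\<^bsub>cmod J\<^esub> x = (\<lambda>_. qm I (r * f))" by (simp add: f cmod_def qm_mult[OF I])
  then show "a \<odot>\<^bsub>cmod J\<^esub> x \<in> carrier (cmod J)" using tidealD(3)[OF J f(1)] by (auto simp: cmod_def)
qed (use tidealD(3)[OF J] in \<open>auto simp: cmod_def carrier_quot qm_add[OF I] qm_mult[OF I] qm_one[OF I] algebra_simps\<close>)

text \<open>Baer's argument: j + h u \<mapsto> h e1 is a well-defined homomorphism on J + Q u by
  \<open>ann\<close>, and the element sought is the value at 1 of an extension to R.\<close>

lemma injective_extend:
  fixes E :: "('k ps3 set, nat \<Rightarrow> 'k ps3 set) module"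
  assumes E: "injective_module R E" and J: "tideal J" "I \<subseteq> J" and e1: "e1 \<in> carrier E"
    and ann: "\<And>h. h * u \<in> J \<Longrightarrow> qm I h \<odot>\<^bsub>E\<^esub> e1 = \<zero>\<^bsub>E\<^esub>"
  shows "\<exists>e\<in>carrier E. (\<forall>j\<in>J. qm I j \<odot>\<^bsub>E\<^esub> e = \<zero>\<^bsub>E\<^esub>) \<and> qm I u \<odot>\<^bsub>E\<^esub> e = e1"
proof -
  have mE: "module R E" using E by (simp add: injective_module_def)
  interpret E: module R E by (rule mE)
  define J' where "J' = {j + h * u | j h. j \<in> J}"
  have J': "tideal J'"
    unfolding tideal_def
  proof (intro conjI ballI allI)
    have "0 = 0 + 0 * u" by simp
    then show "0 \<in> J'" using tidealD(1)[OF J(1)] unfolding J'_def by blast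
  next
    fix a b assume "a \<in> J'" "b \<in> J'"
    then obtain j h j' h' where "a = j + h * u" "b = j' + h' * u" "j \<in> J" "j' \<in> J" by (auto simp: J'_def)
    then have "a + b = (j + j') + (h + h') * u" "j + j' \<in> J" using tidealD(2)[OF J(1)] by (auto simp: algebra_simps)
    then show "a + b \<in> J'" unfolding J'_def by blast
  next
    fix a r assume "a \<in> J'"
    then obtain j h where "a = j + h * u" "j \<in> J" by (auto simp: J'_def)
    then have "r * a = r * j + (r * h) * u" "r * j \<in> J" using tidealD(3)[OF J(1)] by (auto simp: algebra_simps)
    then show "r * a \<in> J'" unfolding J'_def by blast
  qed
  have fl: "qm I h \<odot>\<^bsub>E\<^esub> e1 = qm I h' \<odot>\<^bsub>E\<^esub> e1" if "(h - h') * u \<in> J" for h h'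
  proof -
    have "qm I h = qm I (h - h') \<oplus>\<^bsub>R\<^esub> qm I h'" by (simp add: qm_add[OF I])
    then have "qm I h \<odot>\<^bsub>E\<^esub> e1 = qm I (h - h') \<odot>\<^bsub>E\<^esub> e1 \<oplus>\<^bsub>E\<^esub> qm I h' \<odot>\<^bsub>E\<^esub> e1"
      using E.smult_l_distr e1 I by simp
    then show ?thesis using ann[OF that] e1 I by simp
  qed
  \<comment> \<open>The choice of \<open>h\<close> is harmless by \<open>fl\<close>.\<close>
  define F where "F x = qm I (SOME h. \<exists>j\<in>J. x 0 = qm I (j + h * u)) \<odot>\<^bsub>E\<^esub> e1" for x :: "nat \<Rightarrow> 'k ps3 set"
  have F: "F (\<lambda>_. qm I (j + h * u)) = qm I h \<odot>\<^bsub>E\<^esub> e1" if "j \<in> J" for j h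
  proof -
    define h' where "h' = (SOME h'. \<exists>j'\<in>J. qm I (j + h * u) = qm I (j' + h' * u))"
    have "\<exists>h'. \<exists>j'\<in>J. qm I (j + h * u) = qm I (j' + h' * u)" using that by blast
    from someI_ex[OF this] obtain j' where j': "j' \<in> J" "qm I (j + h * u) = qm I (j' + h' * u)"
      unfolding h'_def by blast
    then have "(j + h * u) - (j' + h' * u) \<in> J" using J(2) by (auto simp: qm_eq[OF I])
    from tidealD(6)[OF J(1) this tidealD(6)[OF J(1) that j'(1)]] have "(h - h') * u \<in> J" by (simp add: algebra_simps)
    from fl[OF this] show ?thesis by (simp add: F_def h'_def)
  qed
  have Fhom: "F \<in> mod_hom R (cmod J') E"
  proof (rule mod_homI)
    fix x assume "x \<in> carrier (cmod J')"
    then obtain j h where x: "j \<in> J" "x = (\<lambda>_. qm I (j + h * u))" by (auto simp: cmod_def J'_def)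
    show "F x \<in> carrier E" unfolding x(2) F[OF x(1)] using e1 I by simp
    fix y assume "y \<in> carrier (cmod J')"
    then obtain j' h' where y: "j' \<in> J" "y = (\<lambda>_. qm I (j' + h' * u))" by (auto simp: cmod_def J'_def)
    have "x \<oplus>\<^bsub>cmod J'\<^esub> y = (\<lambda>_. qm I ((j + j') + (h + h') * u))"
      by (simp add: cmod_def x y qm_add[OF I] algebra_simps)
    then show "F (x \<oplus>\<^bsub>cmod J'\<^esub> y) = F x \<oplus>\<^bsub>E\<^esub> F y"
      using F[OF tidealD(2)[OF J(1) x(1) y(1)], of "h + h'"] F[OF x(1)] F[OF y(1)] E.smult_l_distr[of "qm I h" "qm I h'" e1] e1 I
      by (simp add: x(2) y(2) qm_add[OF I])
  next
    fix c x assume "c \<in> carrier R" "x \<in> carrier (cmod J')"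
    then obtain r j h where x: "j \<in> J" "x = (\<lambda>_. qm I (j + h * u))" "c = qm I r" by (auto simp: cmod_def J'_def carrier_quot)
    have "c \<odot>\<^bsub>cmod J'\<^esub> x = (\<lambda>_. qm I (r * j + (r * h) * u))"
      by (simp add: cmod_def x qm_mult[OF I] algebra_simps)
    then show "F (c \<odot>\<^bsub>cmod J'\<^esub> x) = c \<odot>\<^bsub>E\<^esub> F x"
      using F[OF tidealD(3)[OF J(1) x(1)], of r "r * h"] F[OF x(1)] E.smult_assoc1[of "qm I r" "qm I h" e1] e1 I
      by (simp add: x(2,3) qm_mult[OF I])
  qed
  have U: "tideal (UNIV :: 'k ps3 set)" by (simp add: tideal_def)
  have "(\<lambda>x. x) \<in> mod_hom R (cmod J') (cmod UNIV)"
    by (rule mod_homI) (auto simp: cmod_def)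
  moreover have "inj_on (\<lambda>x. x) (carrier (cmod J'))" by simp
  ultimately obtain G where G: "G \<in> mod_hom R (cmod UNIV) E" "\<And>x. x \<in> carrier (cmod J') \<Longrightarrow> G x = F x"
    using E[unfolded injective_module_def, THEN conjunct2, rule_format, of "cmod J'" "cmod UNIV" "\<lambda>x. x" F]
      cmod_module[OF J'] cmod_module[OF U] Fhom by metis
  define e where "e = G (\<lambda>_. qm I 1)"
  have c1: "(\<lambda>_. qm I 1) \<in> carrier (cmod UNIV)" by (auto simp: cmod_def)
  have e: "e \<in> carrier E" unfolding e_def by (rule mod_homD(1)[OF G(1) c1])
  have act: "qm I (j + h * u) \<odot>\<^bsub>E\<^esub> e = qm I h \<odot>\<^bsub>E\<^esub> e1" if "j \<in> J" for j h
  proof -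
    have "qm I (j + h * u) \<odot>\<^bsub>E\<^esub> e = G (qm I (j + h * u) \<odot>\<^bsub>cmod UNIV\<^esub> (\<lambda>_. qm I 1))"
      unfolding e_def using mod_homD(3)[OF G(1) _ c1] I by simp
    also have "qm I (j + h * u) \<odot>\<^bsub>cmod UNIV\<^esub> (\<lambda>_. qm I 1) = (\<lambda>_. qm I (j + h * u))"
      by (simp add: cmod_def qm_mult[OF I])
    also have "G \<dots> = F \<dots>" by (rule G(2)) (use that in \<open>auto simp: cmod_def J'_def\<close>)
    also have "\<dots> = qm I h \<odot>\<^bsub>E\<^esub> e1" by (rule F[OF that])
    finally show ?thesis .
  qed
  have "qm I j \<odot>\<^bsub>E\<^esub> e = \<zero>\<^bsub>E\<^esub>" if "j \<in> J" for j
    using act[OF that, of 0] ann[of 0] tidealD(1)[OF J(1)] by simp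
  moreover have "qm I u \<odot>\<^bsub>E\<^esub> e = e1"
    using act[OF tidealD(1)[OF J(1)], of 1] e1 by (simp flip: qm_one[OF I])
  ultimately show ?thesis using e by blast
qed

end

section \<open>Vanishing of Ext along order ideals\<close>

context trim
begin

definition kills :: "'k ps3 set \<Rightarrow> ('k ps3 set, 'm) module \<Rightarrow> 'm \<Rightarrow> bool" where
  "kills J M z \<longleftrightarrow> (\<forall>j\<in>J. qm I j \<odot>\<^bsub>M\<^esub> z = \<zero>\<^bsub>M\<^esub>)"

lemma tideal_IL: "order_closed D \<Longrightarrow> tideal (IL D :: 'k ps3 set)"
  by (auto simp: tideal_def intro: IL_add IL_mult)

lemma kills_add:
  assumes "module R M" "kills J M x" "kills J M y" "x \<in> carrier M" "y \<in> carrier M"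
  shows "kills J M (x \<oplus>\<^bsub>M\<^esub> y)"
proof -
  interpret module R M by fact
  show ?thesis using assms smult_r_distr qm_carrier[OF I] by (simp add: kills_def)
qed

lemma kills_minus:
  assumes "module R M" "kills J M x" "kills J M y" "x \<in> carrier M" "y \<in> carrier M"
  shows "kills J M (x \<ominus>\<^bsub>M\<^esub> y)"
proof -
  interpret module R M by fact
  have "qm I j \<odot>\<^bsub>M\<^esub> (\<ominus>\<^bsub>M\<^esub> y) = \<zero>\<^bsub>M\<^esub>" if "j \<in> J" for j
    using assms that smult_r_minus[of "qm I j" y] qm_carrier[OF I] by (simp add: kills_def)
  then have "kills J M (\<ominus>\<^bsub>M\<^esub> y)" by (simp add: kills_def)
  then show ?thesis unfolding a_minus_def by (intro kills_add assms) (use assms in auto)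
qed

lemma kills_hom:
  assumes "module R M" "module R N" "f \<in> mod_hom R M N" "kills J M x" "x \<in> carrier M"
  shows "kills J N (f x)"
  unfolding kills_def
proof
  fix j assume "j \<in> J"
  then show "qm I j \<odot>\<^bsub>N\<^esub> f x = \<zero>\<^bsub>N\<^esub>"
    using assms(4,5) mod_homD(3)[OF assms(3), of "qm I j" x] mod_hom_zero[OF assms(3,1,2)] qm_carrier[OF I]
    by (simp add: kills_def)
qed

lemma kills_zero: "module R M \<Longrightarrow> kills J M \<zero>\<^bsub>M\<^esub>"
  using qm_carrier[OF I] by (simp add: kills_def module.smult_r_null)

lemma kills_remove:
  assumes M: "module R M" "x \<in> carrier M" and J: "kills (IL D) M x" "qm I (WT m) \<odot>\<^bsub>M\<^esub> x = \<zero>\<^bsub>M\<^esub>"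
  shows "kills (IL (D - {m})) M x"
  unfolding kills_def
proof
  interpret module R M by fact
  fix f :: "'k ps3" assume f: "f \<in> IL (D - {m})"
  let ?c = "cst (LT m f)"
  have "qm I f = qm I (f - ?c * WT m) \<oplus>\<^bsub>R\<^esub> qm I ?c \<otimes>\<^bsub>R\<^esub> qm I (WT m)"
    by (simp add: qm_add[OF I] qm_mult[OF I])
  then have "qm I f \<odot>\<^bsub>M\<^esub> x = qm I (f - ?c * WT m) \<odot>\<^bsub>M\<^esub> x \<oplus>\<^bsub>M\<^esub> qm I ?c \<odot>\<^bsub>M\<^esub> (qm I (WT m) \<odot>\<^bsub>M\<^esub> x)"
    using smult_l_distr smult_assoc1 M qm_carrier[OF I] by simp
  then show "qm I f \<odot>\<^bsub>M\<^esub> x = \<zero>\<^bsub>M\<^esub>"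
    using J IL_remove[OF f] qm_carrier[OF I] by (simp add: kills_def)
qed

lemma act_act: "module R M \<Longrightarrow> x \<in> carrier M \<Longrightarrow> qm I a \<odot>\<^bsub>M\<^esub> (qm I b \<odot>\<^bsub>M\<^esub> x) = qm I (a * b) \<odot>\<^bsub>M\<^esub> x"
  using module.smult_assoc1[of R M "qm I a" "qm I b" x] qm_carrier[OF I] by (simp add: qm_mult[OF I])

lemma act_I: "module R M \<Longrightarrow> x \<in> carrier M \<Longrightarrow> a \<in> I \<Longrightarrow> qm I a \<odot>\<^bsub>M\<^esub> x = \<zero>\<^bsub>M\<^esub>"
  using module.smult_l_null[of R M x] qm_0_iff[OF I, of a] by simp

lemma g_eq: "g = IL (Lam k be - {sgm})"
  using sig_notin by (simp add: Lam_def)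

lemma kills_g:
  assumes M: "module R M" "x \<in> carrier M" and J: "kills I M x" "qm I (WT sgm) \<odot>\<^bsub>M\<^esub> x = \<zero>\<^bsub>M\<^esub>"
  shows "kills g M x"
  unfolding g_eq by (rule kills_remove[OF M], fold I_eq) (rule J)+

lemma not_gorenstein: "\<not> gorenstein_local_ring R"
proof
  assume "gorenstein_local_ring R"
  then have "inj_dim R (regular_module R) < \<infinity>" by (simp add: gorenstein_local_ring_def)
  then have "{enat n | n. \<exists>E d \<eta>. injective_resolution R (regular_module R) E d \<eta> \<and>
                              (\<forall>i>n. carrier (E i) = {\<zero>\<^bsub>E i\<^esub>})} \<noteq> {}"
    unfolding inj_dim_def by (metis (no_types, lifting) Inf_empty infinity_enat_def not_less_iff_gr_or_eq top_enat_def)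
  then obtain n E d \<eta> where res: "injective_resolution R (regular_module R) E d \<eta>"
    and top: "\<And>i. i > n \<Longrightarrow> carrier (E i) = {\<zero>\<^bsub>E i\<^esub>}" by blast
  have inj: "injective_module R (E i)" and dh: "d i \<in> mod_hom R (E i) (E (Suc i))" for i
    using res by (auto simp: injective_resolution_def)
  have \<eta>: "\<eta> \<in> mod_hom R (regular_module R) (E 0)" "inj_on \<eta> (carrier (regular_module R))"
    "\<eta> ` carrier (regular_module R) = {x \<in> carrier (E 0). d 0 x = \<zero>\<^bsub>E 1\<^esub>}"
    using res by (auto simp: injective_resolution_def)
  have ex: "d i ` carrier (E i) = {x \<in> carrier (E (Suc i)). d (Suc i) x = \<zero>\<^bsub>E (Suc (Suc i))\<^esub>}" for i
    using res by (auto simp: injective_resolution_def)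
  have exE: "\<exists>t\<in>carrier (E i). d i t = x" if "x \<in> carrier (E (Suc i))" "d (Suc i) x = \<zero>\<^bsub>E (Suc (Suc i))\<^esub>" for i x
  proof -
    have "x \<in> d i ` carrier (E i)" unfolding ex using that by simp
    then show ?thesis by (auto simp: image_iff)
  qed
  have dd: "d (Suc i) (d i x) = \<zero>\<^bsub>E (Suc (Suc i))\<^esub>" if "x \<in> carrier (E i)" for i x
  proof -
    have "d i x \<in> d i ` carrier (E i)" using that by simp
    then show ?thesis unfolding ex by simp
  qed
  have mE: "module R (E i)" for i using inj[of i] by (simp add: injective_module_def)
  have zc: "\<zero>\<^bsub>E i\<^esub> \<in> carrier (E i)" for i
    using module.axioms(2)[OF mE[of i]] abelian_monoid.zero_closed abelian_group.axioms(1) by blast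
  have ac: "x \<in> carrier (E i) \<Longrightarrow> qm I a \<odot>\<^bsub>E i\<^esub> x \<in> carrier (E i)" for a x i
    using module.smult_closed[OF mE qm_carrier[OF I]] .
  \<comment> \<open>\<open>C m J\<close> expresses the vanishing of Ext^(m+1)(Q/J, R): for
    \<open>J\<close> containing \<open>I\<close>, the elements of \<open>E i\<close> killed by
    \<open>J\<close> are the homomorphisms from Q/J to \<open>E i\<close>.\<close>
  define C where "C m J \<longleftrightarrow> (\<forall>z\<in>carrier (E (Suc m)). d (Suc m) z = \<zero>\<^bsub>E (Suc (Suc m))\<^esub> \<and> kills J (E (Suc m)) z \<longrightarrow>
     (\<exists>e\<in>carrier (E m). d m e = z \<and> kills J (E m) e))" for m and J :: "'k ps3 set"
  let ?n = "{f :: 'k ps3. ct f = 0}"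
  have Clarge: "C m J" if "m \<ge> n" for m J
    unfolding C_def
  proof (intro ballI impI)
    fix z assume z: "z \<in> carrier (E (Suc m))"
    then have "z = \<zero>\<^bsub>E (Suc m)\<^esub>" using top[of "Suc m"] that by simp
    then show "\<exists>e\<in>carrier (E m). d m e = z \<and> kills J (E m) e"
      using mod_hom_zero[OF dh mE mE, of m] kills_zero[OF mE, of J m] zc[of m] by blast
  qed
  \<comment> \<open>the dimension shift along \<open>Q/g \<leftarrow> R \<leftarrow> k\<close>, where \<open>k\<close> is embedded in \<open>R\<close> by the socle element \<open>\<sigma>\<close>\<close>
  have stepA: "C m ?n" if Cg: "C (Suc m) g" for m
    unfolding C_def
  proof (intro ballI impI)
    fix z assume z: "z \<in> carrier (E (Suc m))" "d (Suc m) z = \<zero>\<^bsub>E (Suc (Suc m))\<^esub> \<and> kills ?n (E (Suc m)) z"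
    interpret E1: module R "E (Suc m)" by (rule mE)
    interpret E2: module R "E (Suc (Suc m))" by (rule mE)
    have "\<exists>e\<in>carrier (E (Suc m)). (\<forall>j\<in>I. qm I j \<odot>\<^bsub>E (Suc m)\<^esub> e = \<zero>\<^bsub>E (Suc m)\<^esub>) \<and> qm I (WT sgm) \<odot>\<^bsub>E (Suc m)\<^esub> e = z"
    proof (rule injective_extend[OF inj I subset_refl z(1)])
      fix h :: "'k ps3" assume "h * WT sgm \<in> I"
      from tidealD(6)[OF I this sig_scale[of h]] have "cst (ct h) * WT sgm \<in> I" by simp
      from LT_I[OF this sgm_Lam] have "ct h = 0" by (simp add: LT_WT)
      then show "qm I h \<odot>\<^bsub>E (Suc m)\<^esub> z = \<zero>\<^bsub>E (Suc m)\<^esub>" using z(2) by (simp add: kills_def)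
    qed
    then obtain e where e: "e \<in> carrier (E (Suc m))" "qm I (WT sgm) \<odot>\<^bsub>E (Suc m)\<^esub> e = z" by blast
    let ?de = "d (Suc m) e"
    have de: "?de \<in> carrier (E (Suc (Suc m)))" by (rule mod_homD(1)[OF dh e(1)])
    have "kills I (E (Suc (Suc m))) ?de" using act_I[OF mE de] by (simp add: kills_def)
    moreover have "qm I (WT sgm) \<odot>\<^bsub>E (Suc (Suc m))\<^esub> ?de = \<zero>\<^bsub>E (Suc (Suc m))\<^esub>"
      using mod_homD(3)[OF dh qm_carrier[OF I] e(1)] e(2) z(2) by metis
    ultimately have kg: "kills g (E (Suc (Suc m))) ?de"
      by (rule kills_g[OF mE de])
    have "d (Suc (Suc m)) ?de = \<zero>\<^bsub>E (Suc (Suc (Suc m)))\<^esub>" by (rule dd[OF e(1)])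
    then obtain e' where e': "e' \<in> carrier (E (Suc m))" "d (Suc m) e' = ?de" "kills g (E (Suc m)) e'"
      using Cg de kg unfolding C_def by blast
    have "d (Suc m) (e \<ominus>\<^bsub>E (Suc m)\<^esub> e') = \<zero>\<^bsub>E (Suc (Suc m))\<^esub>"
      using mod_hom_minus[OF dh mE mE e(1) e'(1)] e'(2) de E2.M.r_neg by (simp add: a_minus_def)
    moreover have "e \<ominus>\<^bsub>E (Suc m)\<^esub> e' \<in> carrier (E (Suc m))" using e e' by simp
    ultimately have "\<exists>t\<in>carrier (E m). d m t = e \<ominus>\<^bsub>E (Suc m)\<^esub> e'" by (intro exE)
    then obtain t where t: "t \<in> carrier (E m)" "d m t = e \<ominus>\<^bsub>E (Suc m)\<^esub> e'" by blast
    \<comment> \<open>Multiplication by \<sigma> sends \<open>e - e'\<close> to \<open>z\<close>,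
      because \<sigma> lies in \<open>g\<close> and so kills \<open>e'\<close>; and \<sigma> t is
      killed by the maximal ideal, which sends \<sigma> into \<open>I\<close>.\<close>
    let ?st = "qm I (WT sgm) \<odot>\<^bsub>E m\<^esub> t"
    have "WT sgm \<in> g" by (rule WT_g[OF sig_notin])
    then have k0: "qm I (WT sgm) \<odot>\<^bsub>E (Suc m)\<^esub> e' = \<zero>\<^bsub>E (Suc m)\<^esub>" using e'(3) by (simp add: kills_def)
    have "d m ?st = qm I (WT sgm) \<odot>\<^bsub>E (Suc m)\<^esub> (e \<ominus>\<^bsub>E (Suc m)\<^esub> e')"
      using mod_homD(3)[OF dh qm_carrier[OF I] t(1)] t(2) by metis
    also have "\<dots> = z"
      using E1.smult_r_distr[of "qm I (WT sgm)" e "\<ominus>\<^bsub>E (Suc m)\<^esub> e'"] E1.smult_r_minus[of "qm I (WT sgm)" e']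
        qm_carrier[OF I] e e'(1) k0 z(1) by (simp add: a_minus_def)
    finally have "d m ?st = z" .
    moreover have "kills ?n (E m) ?st"
      unfolding kills_def using act_act[OF mE t(1)] act_I[OF mE t(1) sig_kill] by simp
    ultimately show "\<exists>e\<in>carrier (E m). d m e = z \<and> kills ?n (E m) e" using ac[OF t(1)] by blast
  qed
  \<comment> \<open>Induction along the filtration of Q/(IL D) by residue fields, with the long
    exact sequence spelled out on elements.\<close>
  have stepB: "C m (IL D)" if Cn: "C m ?n" and D: "finite D" "order_closed D" "D \<subseteq> Lam k be" for m D
    using D
  proof (induct D rule: order_closed_induct)
    case empty
    show ?case unfolding C_def
    proof (intro ballI impI)
      fix z assume z: "z \<in> carrier (E (Suc m))" "d (Suc m) z = \<zero>\<^bsub>E (Suc (Suc m))\<^esub> \<and> kills (IL {}) (E (Suc m)) z"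
      then have "qm I 1 \<odot>\<^bsub>E (Suc m)\<^esub> z = \<zero>\<^bsub>E (Suc m)\<^esub>" by (simp add: kills_def IL_def)
      then have "z = \<zero>\<^bsub>E (Suc m)\<^esub>" using module.smult_one[OF mE z(1)] by (simp add: qm_one[OF I])
      then show "\<exists>e\<in>carrier (E m). d m e = z \<and> kills (IL {}) (E m) e"
        using mod_hom_zero[OF dh mE mE, of m] kills_zero[OF mE, of "IL {}" m] zc[of m] by blast
    qed
  next
    case (remove D l)
    have CA: "C m (IL (D - {l}))" using remove by blast
    have tA: "tideal (IL D :: 'k ps3 set)" by (rule tideal_IL[OF remove(2)])
    have IA: "I \<subseteq> IL D" using remove(7) by (auto simp: I_eq IL_def)
    let ?u = "WT l :: 'k ps3"
    have nu: "h * ?u \<in> IL D" if "ct h = 0" for h by (rule top_WT_mult[OF remove(2,5) that])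
    show ?case unfolding C_def
    proof (intro ballI impI)
      interpret E0: module R "E m" by (rule mE)
      interpret E1: module R "E (Suc m)" by (rule mE)
      interpret E2: module R "E (Suc (Suc m))" by (rule mE)
      fix z assume z: "z \<in> carrier (E (Suc m))" "d (Suc m) z = \<zero>\<^bsub>E (Suc (Suc m))\<^esub> \<and> kills (IL D) (E (Suc m)) z"
      let ?uz = "qm I ?u \<odot>\<^bsub>E (Suc m)\<^esub> z"
      have "kills ?n (E (Suc m)) ?uz"
        unfolding kills_def using act_act[OF mE z(1)] nu z(2) by (simp add: kills_def)
      moreover have "d (Suc m) ?uz = \<zero>\<^bsub>E (Suc (Suc m))\<^esub>"
        using mod_homD(3)[OF dh qm_carrier[OF I] z(1)] z(2) qm_carrier[OF I] by simp
      ultimately obtain e1 where e1: "e1 \<in> carrier (E m)" "d m e1 = ?uz" "kills ?n (E m) e1"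
        using Cn ac[OF z(1)] unfolding C_def by blast
      have "\<exists>e\<in>carrier (E m). (\<forall>j\<in>IL D. qm I j \<odot>\<^bsub>E m\<^esub> e = \<zero>\<^bsub>E m\<^esub>) \<and> qm I ?u \<odot>\<^bsub>E m\<^esub> e = e1"
      proof (rule injective_extend[OF inj tA IA e1(1)])
        fix h :: "'k ps3" assume "h * ?u \<in> IL D"
        moreover have "(h - cst (ct h)) * ?u \<in> IL D" by (rule nu) simp
        ultimately have "h * ?u - (h - cst (ct h)) * ?u \<in> IL D" by (rule tidealD(6)[OF tA])
        then have "cst (ct h) * ?u \<in> IL D" by (simp add: algebra_simps)
        then have "LT l (cst (ct h) * ?u) = 0" using remove(3) unfolding IL_def by blast
        then have "ct h = 0" by (simp add: LT_WT)
        then show "qm I h \<odot>\<^bsub>E m\<^esub> e1 = \<zero>\<^bsub>E m\<^esub>" using e1(3) by (simp add: kills_def)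
      qed
      then obtain e2 where e2: "e2 \<in> carrier (E m)" "kills (IL D) (E m) e2" "qm I ?u \<odot>\<^bsub>E m\<^esub> e2 = e1"
        unfolding kills_def by blast
      \<comment> \<open>\<open>e2\<close> solves the problem on the residue field spanned by
        \<open>WT l\<close>. The corrected cocycle is killed by \<open>WT l\<close> as well, hence
        by the larger ideal of the induction hypothesis.\<close>
      let ?de = "d m e2"
      have de: "?de \<in> carrier (E (Suc m))" by (rule mod_homD(1)[OF dh e2(1)])
      let ?z = "z \<ominus>\<^bsub>E (Suc m)\<^esub> ?de"
      have zc': "?z \<in> carrier (E (Suc m))" using z(1) de by simp
      have "kills (IL D) (E (Suc m)) ?z"
        using kills_minus[OF mE _ kills_hom[OF mE mE dh e2(2,1)] z(1) de] z(2) by blast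
      moreover have "qm I ?u \<odot>\<^bsub>E (Suc m)\<^esub> ?z = \<zero>\<^bsub>E (Suc m)\<^esub>"
      proof -
        have "qm I ?u \<odot>\<^bsub>E (Suc m)\<^esub> ?de = ?uz" using mod_homD(3)[OF dh qm_carrier[OF I] e2(1)] e2(3) e1(2) by metis
        then show ?thesis
          using E1.smult_r_distr[of "qm I ?u" z "\<ominus>\<^bsub>E (Suc m)\<^esub> ?de"] E1.smult_r_minus[of "qm I ?u" ?de]
            qm_carrier[OF I] z(1) de ac[OF z(1), of ?u] E1.M.r_neg by (simp add: a_minus_def)
      qed
      ultimately have kz: "kills (IL (D - {l})) (E (Suc m)) ?z" by (rule kills_remove[OF mE zc'])
      have "d (Suc m) ?de = \<zero>\<^bsub>E (Suc (Suc m))\<^esub>" by (rule dd[OF e2(1)])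
      then have "d (Suc m) ?z = \<zero>\<^bsub>E (Suc (Suc m))\<^esub>"
        using mod_hom_minus[OF dh mE mE z(1) de] z(2) by (simp add: a_minus_def)
      then obtain e3 where e3: "e3 \<in> carrier (E m)" "d m e3 = ?z" "kills (IL (D - {l})) (E m) e3"
        using CA kz zc' unfolding C_def by blast
      have "kills (IL D) (E m) e3" using e3(3) by (auto simp: kills_def IL_def)
      then have "kills (IL D) (E m) (e2 \<oplus>\<^bsub>E m\<^esub> e3)" by (intro kills_add[OF mE] e2 e3)
      moreover have "d m (e2 \<oplus>\<^bsub>E m\<^esub> e3) = z"
        using mod_homD(2)[OF dh e2(1) e3(1)] e3(2) z(1) de
        by (simp add: a_minus_def E1.M.a_lcomm[of ?de z] E1.M.r_neg)
      moreover have "e2 \<oplus>\<^bsub>E m\<^esub> e3 \<in> carrier (E m)" using e2 e3 by simp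
      ultimately show "\<exists>e\<in>carrier (E m). d m e = z \<and> kills (IL D) (E m) e" by blast
    qed
  qed
  \<comment> \<open>Descending induction from the end of the resolution: each round passes from Q/g
    in one degree to the residue field and back to Q/g in the degree below.\<close>
  have Cg: "C m g" for m
  proof (cases "m \<ge> n")
    case True then show ?thesis by (rule Clarge)
  next
    case False
    then have "m \<le> n" by simp
    then show ?thesis
    proof (induct m rule: inc_induct)
      case base show ?case by (rule Clarge) simp
    next
      case (step m)
      show ?case
        by (rule stepB[OF stepA[OF step(3)] finite_LamG order_closed_LamG]) (auto simp: Lam_def)
    qed
  qed
  interpret E0: module R "E 0" by (rule mE)
  interpret E1: module R "E (Suc 0)" by (rule mE)
  have rc: "carrier (regular_module R) = range (qm I)" by (simp add: regular_module_def carrier_quot)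
  have \<eta>c: "\<eta> (qm I a) \<in> carrier (E 0)" for a by (rule mod_homD(1)[OF \<eta>(1)]) (simp add: rc)
  have \<eta>s: "qm I a \<odot>\<^bsub>E 0\<^esub> \<eta> (qm I b) = \<eta> (qm I (a * b))" for a b
    using mod_homD(3)[OF \<eta>(1) qm_carrier[OF I, of a], of "qm I b"] rc by (simp add: regular_module_def qm_mult[OF I])
  have \<eta>0: "\<eta> (qm I a) = \<zero>\<^bsub>E 0\<^esub>" if "a \<in> I" for a
    using \<eta>s[of a 1] act_I[OF mE \<eta>c that, of 1] by simp
  \<comment> \<open>The map from the span of \<sigma> to R with \<sigma> \<mapsto> s extends to all
    of R because Ext^1(Q/g, R) = 0. It would be multiplication by some \<open>c\<close>, but the
    multiples of \<sigma> modulo \<open>I\<close> are scalar multiples and miss s.\<close>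
  have "\<exists>e\<in>carrier (E 0). (\<forall>j\<in>I. qm I j \<odot>\<^bsub>E 0\<^esub> e = \<zero>\<^bsub>E 0\<^esub>) \<and> qm I (WT sgm) \<odot>\<^bsub>E 0\<^esub> e = \<eta> (qm I (WT tpm))"
  proof (rule injective_extend[OF inj I subset_refl \<eta>c])
    fix h :: "'k ps3" assume "h * WT sgm \<in> I"
    from tidealD(6)[OF I this sig_scale[of h]] have "cst (ct h) * WT sgm \<in> I" by simp
    from LT_I[OF this sgm_Lam] have "ct h = 0" by (simp add: LT_WT)
    then show "qm I h \<odot>\<^bsub>E 0\<^esub> \<eta> (qm I (WT tpm)) = \<zero>\<^bsub>E 0\<^esub>" unfolding \<eta>s by (intro \<eta>0 top_kill)
  qed
  then obtain e where e: "e \<in> carrier (E 0)" "qm I (WT sgm) \<odot>\<^bsub>E 0\<^esub> e = \<eta> (qm I (WT tpm))" by blast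
  let ?de = "d 0 e"
  have de: "?de \<in> carrier (E (Suc 0))" by (rule mod_homD(1)[OF dh e(1)])
  have d\<eta>: "d 0 (\<eta> (qm I a)) = \<zero>\<^bsub>E (Suc 0)\<^esub>" for a using \<eta>(3) rc by auto
  have "kills I (E (Suc 0)) ?de" using act_I[OF mE de] by (simp add: kills_def)
  moreover have "qm I (WT sgm) \<odot>\<^bsub>E (Suc 0)\<^esub> ?de = \<zero>\<^bsub>E (Suc 0)\<^esub>"
    using mod_homD(3)[OF dh qm_carrier[OF I] e(1)] e(2) d\<eta> by metis
  ultimately have kg: "kills g (E (Suc 0)) ?de"
    by (rule kills_g[OF mE de])
  have "d (Suc 0) ?de = \<zero>\<^bsub>E (Suc (Suc 0))\<^esub>" by (rule dd[OF e(1)])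
  then obtain e' where e': "e' \<in> carrier (E 0)" "d 0 e' = ?de" "kills g (E 0) e'"
    using Cg[of 0] de kg unfolding C_def by blast
  have "d 0 (e \<ominus>\<^bsub>E 0\<^esub> e') = \<zero>\<^bsub>E (Suc 0)\<^esub>"
    using mod_hom_minus[OF dh mE mE e(1) e'(1)] e'(2) de E1.M.r_neg by (simp add: a_minus_def)
  moreover have "e \<ominus>\<^bsub>E 0\<^esub> e' \<in> carrier (E 0)" using e e' by simp
  ultimately have "e \<ominus>\<^bsub>E 0\<^esub> e' \<in> \<eta> ` range (qm I)" using \<eta>(3) rc by auto
  then obtain c where c: "e \<ominus>\<^bsub>E 0\<^esub> e' = \<eta> (qm I c)" by blast
  have "WT sgm \<in> g" by (rule WT_g[OF sig_notin])
  then have k0: "qm I (WT sgm) \<odot>\<^bsub>E 0\<^esub> e' = \<zero>\<^bsub>E 0\<^esub>" using e'(3) by (simp add: kills_def)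
  have "\<eta> (qm I (WT sgm * c)) = qm I (WT sgm) \<odot>\<^bsub>E 0\<^esub> (e \<ominus>\<^bsub>E 0\<^esub> e')" unfolding c \<eta>s ..
  also have "\<dots> = \<eta> (qm I (WT tpm))"
    using E0.smult_r_distr[of "qm I (WT sgm)" e "\<ominus>\<^bsub>E 0\<^esub> e'"] E0.smult_r_minus[of "qm I (WT sgm)" e']
      qm_carrier[OF I] e e'(1) k0 \<eta>c by (simp add: a_minus_def)
  finally have "qm I (WT sgm * c) = qm I (WT tpm)" by (rule inj_onD[OF \<eta>(2)]) (simp_all add: rc)
  then have "c * WT sgm - WT tpm \<in> I" by (simp add: qm_eq[OF I] mult.commute del: WT.simps)
  from tidealD(6)[OF I sig_scale[of c] this] have "WT tpm - cst (ct c) * WT sgm \<in> I" by (simp del: WT.simps)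
  from LT_I[OF this tpm_Lam] show False using sgm_tpm by (simp add: LT_WT del: WT.simps LT.simps)
qed

end

subsection \<open>Free resolutions of length three\<close>

type_synonym 'k vec = "nat \<Rightarrow> 'k ps3"

text \<open>Q^N as sequences vanishing from N on, so that free modules already have the carrier type
  demanded of the terms of a resolution.\<close>

definition Fr :: "nat \<Rightarrow> 'k::field vec set" where "Fr N = {v. \<forall>i\<ge>N. v i = 0}"
definition sm :: "'k::field ps3 \<Rightarrow> 'k vec \<Rightarrow> 'k vec" where "sm c v = (\<lambda>i. c * v i)"

lemma sm_nth [simp]: "sm c v i = c * v i" by (simp add: sm_def)
lemma sm_add: "sm c (v + w) = sm c v + sm c w" "sm (a + c) v = sm a v + sm c v"
  and sm_diff: "sm c (v - w) = sm c v - sm c w"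
  and sm_sm: "sm a (sm c v) = sm (a * c) v" and sm_1: "sm 1 v = v" and sm_0: "sm c 0 = 0" "sm 0 v = 0"
  by (auto simp: fun_eq_iff algebra_simps)

lemma Fr_simps: "0 \<in> Fr N" "v \<in> Fr N \<Longrightarrow> w \<in> Fr N \<Longrightarrow> v + w \<in> Fr N" "v \<in> Fr N \<Longrightarrow> sm c v \<in> Fr N"
  "v \<in> Fr N \<Longrightarrow> w \<in> Fr N \<Longrightarrow> v - w \<in> Fr N"
  by (auto simp: Fr_def)

definition lin :: "nat \<Rightarrow> ('k::field vec \<Rightarrow> 'k vec) \<Rightarrow> bool" where
  "lin N f \<longleftrightarrow> (\<forall>v\<in>Fr N. \<forall>w\<in>Fr N. f (v + w) = f v + f w) \<and> (\<forall>c. \<forall>v\<in>Fr N. f (sm c v) = sm c (f v))"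
definition lin1 :: "nat \<Rightarrow> ('k::field vec \<Rightarrow> 'k ps3) \<Rightarrow> bool" where
  "lin1 N f \<longleftrightarrow> (\<forall>v\<in>Fr N. \<forall>w\<in>Fr N. f (v + w) = f v + f w) \<and> (\<forall>c. \<forall>v\<in>Fr N. f (sm c v) = c * f v)"

lemma linD: assumes "lin N f"
  shows "v \<in> Fr N \<Longrightarrow> w \<in> Fr N \<Longrightarrow> f (v + w) = f v + f w" "v \<in> Fr N \<Longrightarrow> f (sm c v) = sm c (f v)"
    "v \<in> Fr N \<Longrightarrow> w \<in> Fr N \<Longrightarrow> f (v - w) = f v - f w" "f 0 = 0"
proof -
  show 1: "v \<in> Fr N \<Longrightarrow> w \<in> Fr N \<Longrightarrow> f (v + w) = f v + f w" "v \<in> Fr N \<Longrightarrow> f (sm c v) = sm c (f v)" for v w c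
    using assms by (auto simp: lin_def)
  show "f 0 = 0" using 1(2)[OF Fr_simps(1), of 0] by (simp add: sm_0)
  have e: "v - w = v + sm (- 1) w" "f v - f w = f v + sm (- 1) (f w)" by (auto simp: fun_eq_iff)
  show "v \<in> Fr N \<Longrightarrow> w \<in> Fr N \<Longrightarrow> f (v - w) = f v - f w"
    unfolding e using 1(1)[of v "sm (- 1) w"] 1(2)[of w "- 1"] Fr_simps(3)[of w N "- 1"] by metis
qed

lemma lin1D: assumes "lin1 N f"
  shows "v \<in> Fr N \<Longrightarrow> w \<in> Fr N \<Longrightarrow> f (v + w) = f v + f w" "v \<in> Fr N \<Longrightarrow> f (sm c v) = c * f v"
    "v \<in> Fr N \<Longrightarrow> w \<in> Fr N \<Longrightarrow> f (v - w) = f v - f w" "f 0 = 0"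
proof -
  show 1: "v \<in> Fr N \<Longrightarrow> w \<in> Fr N \<Longrightarrow> f (v + w) = f v + f w" "v \<in> Fr N \<Longrightarrow> f (sm c v) = c * f v" for v w c
    using assms by (auto simp: lin1_def)
  show "f 0 = 0" using 1(2)[OF Fr_simps(1), of 0] by (simp add: sm_0)
  have e: "v - w = v + sm (- 1) w" "f v - f w = f v + (- 1) * f w" by (auto simp: fun_eq_iff)
  show "v \<in> Fr N \<Longrightarrow> w \<in> Fr N \<Longrightarrow> f (v - w) = f v - f w"
    unfolding e using 1(1)[of v "sm (- 1) w"] 1(2)[of w "- 1"] Fr_simps(3)[of w N "- 1"] by metis
qed

definition bas :: "nat \<Rightarrow> 'k::field vec" where "bas i = (\<lambda>j. if j = i then 1 else 0)"

lemma bas_Fr: "i < N \<Longrightarrow> bas i \<in> Fr N" by (auto simp: bas_def Fr_def)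

definition rs :: "nat \<Rightarrow> 'k::field vec \<Rightarrow> 'k vec" where "rs N v = (\<lambda>i. if i < N then v i else 0)"

lemma rs_Fr [simp]: "rs N v \<in> Fr N" by (auto simp: rs_def Fr_def)
lemma rs_add: "rs N (v + w) = rs N v + rs N w" and rs_sm: "rs N (sm c v) = sm c (rs N v)"
  and rs_id: "v \<in> Fr N \<Longrightarrow> rs N v = v" and rs_0: "rs N 0 = 0"
  by (auto simp: rs_def Fr_def fun_eq_iff)

lemma rs_Suc: "rs (Suc n) v = rs n v + sm (v n) (bas n)"
  by (auto simp: rs_def bas_def fun_eq_iff less_Suc_eq)

lemma lin_expand: assumes "lin N f" "v \<in> Fr N" shows "f v = (\<Sum>i<N. sm (v i) (f (bas i)))"
proof -
  have "n \<le> N \<Longrightarrow> f (rs n v) = (\<Sum>i<n. sm (v i) (f (bas i)))" for n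
  proof (induct n)
    case 0
    have "rs 0 v = 0" by (auto simp: rs_def fun_eq_iff)
    then show ?case by (simp only: lessThan_0 sum.empty linD(4)[OF assms(1)])
  next
    case (Suc n)
    have "rs n v \<in> Fr N" using Suc(2) by (auto simp: rs_def Fr_def)
    moreover have "bas n \<in> Fr N" by (rule bas_Fr) (use Suc(2) in simp)
    ultimately have "f (rs (Suc n) v) = f (rs n v) + sm (v n) (f (bas n))"
      unfolding rs_Suc using linD(1)[OF assms(1), of "rs n v" "sm (v n) (bas n)"] linD(2)[OF assms(1), of "bas n" "v n"]
        Fr_simps(3)[of "bas n" N "v n"] by metis
    then show ?case using Suc by (simp only: sum.lessThan_Suc Suc_leD)
  qed
  from this[of N] show ?thesis using rs_id[OF assms(2)] by simp
qed

lemma sum_fun_nth: "(\<Sum>i\<in>S. F i) j = (\<Sum>i\<in>S. (F i :: 'k::field vec) j)"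
  by (induct S rule: infinite_finite_induct) auto

lemma lin1_expand: assumes "lin1 N f" "v \<in> Fr N" shows "f v = (\<Sum>i<N. v i * f (bas i))"
proof -
  \<comment> \<open>A functional is treated as a map into the first coordinate, which reduces the
    claim to \<open>lin_expand\<close>.\<close>
  have "lin N (\<lambda>v. sm (f v) (bas 0))"
    using lin1D(1,2)[OF assms(1)] by (auto simp: lin_def sm_add sm_sm)
  from lin_expand[OF this assms(2)] have "sm (f v) (bas 0) 0 = (\<Sum>i<N. sm (v i) (sm (f (bas i)) (bas 0))) 0" by simp
  then show ?thesis by (simp add: sum_fun_nth bas_def)
qed

lemma lin1_sum: "lin1 N (\<lambda>v. \<Sum>i<N. v i * t i)"
  by (simp add: lin1_def distrib_right sum.distrib sum_distrib_left mult.assoc)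

lemma lin1_comp: "lin N f \<Longrightarrow> (\<And>v. v \<in> Fr N \<Longrightarrow> f v \<in> Fr M) \<Longrightarrow> lin1 M h \<Longrightarrow> lin1 N (\<lambda>v. h (f v))"
  by (auto simp: lin1_def lin_def)

lemma lin1_comp_expand:
  assumes "lin N f" "\<And>v. v \<in> Fr N \<Longrightarrow> f v \<in> Fr M" "lin1 M h" "p \<in> Fr N"
  shows "h (f p) = (\<Sum>i<N. p i * h (f (bas i)))"
  using lin1_expand[OF lin1_comp[OF assms(1-3)] assms(4)] by simp

text \<open>A free resolution of Q/J of length three. The augmentation is lifted to Q, so
  surjectivity and exactness at the first term are stated modulo \<open>J\<close>.\<close>

definition free_res :: "'k::field ps3 set \<Rightarrow> nat \<Rightarrow> nat \<Rightarrow> nat \<Rightarrow> nat \<Rightarrow>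
    ('k vec \<Rightarrow> 'k ps3) \<Rightarrow> ('k vec \<Rightarrow> 'k vec) \<Rightarrow> ('k vec \<Rightarrow> 'k vec) \<Rightarrow> ('k vec \<Rightarrow> 'k vec) \<Rightarrow> bool" where
  "free_res J N0 N1 N2 N3 \<epsilon> d0 d1 d2 \<longleftrightarrow>
     lin1 N0 \<epsilon> \<and> lin N1 d0 \<and> lin N2 d1 \<and> lin N3 d2 \<and>
     (\<forall>v\<in>Fr N1. d0 v \<in> Fr N0) \<and> (\<forall>v\<in>Fr N2. d1 v \<in> Fr N1) \<and> (\<forall>v\<in>Fr N3. d2 v \<in> Fr N2) \<and>
     (\<forall>q. \<exists>v\<in>Fr N0. q - \<epsilon> v \<in> J) \<and>
     (\<forall>v\<in>Fr N0. \<epsilon> v \<in> J \<longleftrightarrow> (\<exists>w\<in>Fr N1. v = d0 w)) \<and>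
     (\<forall>v\<in>Fr N1. d0 v = 0 \<longleftrightarrow> (\<exists>w\<in>Fr N2. v = d1 w)) \<and>
     (\<forall>v\<in>Fr N2. d1 v = 0 \<longleftrightarrow> (\<exists>w\<in>Fr N3. v = d2 w)) \<and>
     (\<forall>v\<in>Fr N3. d2 v = 0 \<longrightarrow> v = 0)"

lemma free_resD:
  assumes res: "free_res J N0 N1 N2 N3 \<epsilon> d0 d1 d2"
  shows "lin1 N0 \<epsilon>" "lin N1 d0" "lin N2 d1" "lin N3 d2"
    and "v \<in> Fr N1 \<Longrightarrow> d0 v \<in> Fr N0" "v \<in> Fr N2 \<Longrightarrow> d1 v \<in> Fr N1" "v \<in> Fr N3 \<Longrightarrow> d2 v \<in> Fr N2"
    and "\<exists>v\<in>Fr N0. q - \<epsilon> v \<in> J"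
    and "v \<in> Fr N0 \<Longrightarrow> \<epsilon> v \<in> J \<longleftrightarrow> (\<exists>w\<in>Fr N1. v = d0 w)"
    and "v \<in> Fr N1 \<Longrightarrow> d0 v = 0 \<longleftrightarrow> (\<exists>w\<in>Fr N2. v = d1 w)"
    and "v \<in> Fr N2 \<Longrightarrow> d1 v = 0 \<longleftrightarrow> (\<exists>w\<in>Fr N3. v = d2 w)"
    and "v \<in> Fr N3 \<Longrightarrow> d2 v = 0 \<Longrightarrow> v = 0"
proof -
  note r = res[unfolded free_res_def]
  show "lin1 N0 \<epsilon>" by (insert r, elim conjE, assumption)
  show "lin N1 d0" by (insert r, elim conjE, assumption)
  show "lin N2 d1" by (insert r, elim conjE, assumption)
  show "lin N3 d2" by (insert r, elim conjE, assumption)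
  have "\<forall>v\<in>Fr N1. d0 v \<in> Fr N0" by (insert r, elim conjE, assumption)
  moreover have "\<forall>v\<in>Fr N2. d1 v \<in> Fr N1" by (insert r, elim conjE, assumption)
  moreover have "\<forall>v\<in>Fr N3. d2 v \<in> Fr N2" by (insert r, elim conjE, assumption)
  ultimately show "v \<in> Fr N1 \<Longrightarrow> d0 v \<in> Fr N0" "v \<in> Fr N2 \<Longrightarrow> d1 v \<in> Fr N1" "v \<in> Fr N3 \<Longrightarrow> d2 v \<in> Fr N2"
    by simp_all
  have "\<forall>q. \<exists>v\<in>Fr N0. q - \<epsilon> v \<in> J" by (insert r, elim conjE, assumption)
  then show "\<exists>v\<in>Fr N0. q - \<epsilon> v \<in> J" by (rule spec)
  have "\<forall>v\<in>Fr N0. \<epsilon> v \<in> J \<longleftrightarrow> (\<exists>w\<in>Fr N1. v = d0 w)" by (insert r, elim conjE, assumption)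
  then show "v \<in> Fr N0 \<Longrightarrow> \<epsilon> v \<in> J \<longleftrightarrow> (\<exists>w\<in>Fr N1. v = d0 w)" by (rule bspec)
  have "\<forall>v\<in>Fr N1. d0 v = 0 \<longleftrightarrow> (\<exists>w\<in>Fr N2. v = d1 w)" by (insert r, elim conjE, assumption)
  then show "v \<in> Fr N1 \<Longrightarrow> d0 v = 0 \<longleftrightarrow> (\<exists>w\<in>Fr N2. v = d1 w)" by (rule bspec)
  have "\<forall>v\<in>Fr N2. d1 v = 0 \<longleftrightarrow> (\<exists>w\<in>Fr N3. v = d2 w)" by (insert r, elim conjE, assumption)
  then show "v \<in> Fr N2 \<Longrightarrow> d1 v = 0 \<longleftrightarrow> (\<exists>w\<in>Fr N3. v = d2 w)" by (rule bspec)
  have "\<forall>v\<in>Fr N3. d2 v = 0 \<longrightarrow> v = 0" by (insert r, elim conjE, assumption)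
  then show "v \<in> Fr N3 \<Longrightarrow> d2 v = 0 \<Longrightarrow> v = 0" by simp
qed

text \<open>Elements of the direct sums of Q^N with Q and, below, with Q^3: the Koszul summands in
  the horseshoe.\<close>

definition g1 :: "nat \<Rightarrow> 'k::field vec \<Rightarrow> 'k ps3 \<Rightarrow> 'k vec" where
  "g1 N p a = (\<lambda>i. if i < N then p i else if i = N then a else 0)"
definition g3 :: "nat \<Rightarrow> 'k::field vec \<Rightarrow> 'k ps3 \<Rightarrow> 'k ps3 \<Rightarrow> 'k ps3 \<Rightarrow> 'k vec" where
  "g3 N p a b c = (\<lambda>i. if i < N then p i else if i = N then a else if i = N + 1 then b else if i = N + 2 then c else 0)"

lemma g_Fr: "g1 N p a \<in> Fr (N + 1)" "g3 N p a b c \<in> Fr (N + 3)"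
  by (auto simp: g1_def g3_def Fr_def)

lemma g1_nth: "rs N (g1 N p a) = rs N p" "g1 N p a N = a"
  and g3_nth: "rs N (g3 N p a b c) = rs N p" "g3 N p a b c N = a" "g3 N p a b c (Suc N) = b" "g3 N p a b c (Suc (Suc N)) = c"
  by (auto simp: g1_def g3_def rs_def fun_eq_iff)

lemma g1_eq: "v \<in> Fr (N + 1) \<Longrightarrow> v = g1 N (rs N v) (v N)"
  by (auto simp: g1_def Fr_def rs_def fun_eq_iff)
lemma g3_eq: "v \<in> Fr (N + 3) \<Longrightarrow> v = g3 N (rs N v) (v N) (v (Suc N)) (v (Suc (Suc N)))"
  by (auto simp: g3_def Fr_def rs_def fun_eq_iff)

lemma g1_inj: "g1 N p a = g1 N p' a' \<longleftrightarrow> rs N p = rs N p' \<and> a = a'"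
proof
  assume e: "g1 N p a = g1 N p' a'"
  show "rs N p = rs N p' \<and> a = a'"
    using arg_cong[OF e, of "rs N"] arg_cong[OF e, of "\<lambda>v. v N"] by (simp add: g1_nth)
next
  assume "rs N p = rs N p' \<and> a = a'"
  then show "g1 N p a = g1 N p' a'" by (auto simp: g1_def rs_def fun_eq_iff) metis
qed
lemma g3_inj: "g3 N p a b c = g3 N p' a' b' c' \<longleftrightarrow> rs N p = rs N p' \<and> a = a' \<and> b = b' \<and> c = c'"
proof
  assume e: "g3 N p a b c = g3 N p' a' b' c'"
  show "rs N p = rs N p' \<and> a = a' \<and> b = b' \<and> c = c'"
    using arg_cong[OF e, of "rs N"] arg_cong[OF e, of "\<lambda>v. v N"] arg_cong[OF e, of "\<lambda>v. v (Suc N)"]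
      arg_cong[OF e, of "\<lambda>v. v (Suc (Suc N))"] by (simp add: g3_nth)
next
  assume "rs N p = rs N p' \<and> a = a' \<and> b = b' \<and> c = c'"
  then show "g3 N p a b c = g3 N p' a' b' c'" by (auto simp: g3_def rs_def fun_eq_iff) metis
qed

lemma g1_0: "g1 N p a = 0 \<longleftrightarrow> rs N p = 0 \<and> a = 0"
  and g3_0: "g3 N p a b c = 0 \<longleftrightarrow> rs N p = 0 \<and> a = 0 \<and> b = 0 \<and> c = 0" for p :: "'k::field vec"
proof -
  have "g1 N 0 0 = (0 :: 'k vec)" "g3 N 0 0 0 0 = (0 :: 'k vec)" by (auto simp: g1_def g3_def fun_eq_iff)
  then show "g1 N p a = 0 \<longleftrightarrow> rs N p = 0 \<and> a = 0" "g3 N p a b c = 0 \<longleftrightarrow> rs N p = 0 \<and> a = 0 \<and> b = 0 \<and> c = 0"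
    using g1_inj[of N p a 0 0] g3_inj[of N p a b c 0 0 0 0] unfolding rs_0 by metis+
qed

lemma g_add: "g1 N p a + g1 N p' a' = g1 N (p + p') (a + a')"
  "g3 N p a b c + g3 N p' a' b' c' = g3 N (p + p') (a + a') (b + b') (c + c')"
  and g_sm: "sm r (g1 N p a) = g1 N (sm r p) (r * a)" "sm r (g3 N p a b c) = g3 N (sm r p) (r * a) (r * b) (r * c)"
  by (auto simp: g1_def g3_def fun_eq_iff)

lemma all_g1: "(\<forall>v\<in>Fr (N + 1). P v) \<longleftrightarrow> (\<forall>p\<in>Fr N. \<forall>a. P (g1 N p a))"
  for P :: "'k::field vec \<Rightarrow> bool"
proof (intro iffI ballI allI)
  fix v :: "'k vec" assume "\<forall>p\<in>Fr N. \<forall>a. P (g1 N p a)" "v \<in> Fr (N + 1)"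
  then show "P v" using g1_eq[of v N] rs_Fr[of N v] by metis
qed (use g_Fr(1) in blast)
lemma all_g3: "(\<forall>v\<in>Fr (N + 3). P v) \<longleftrightarrow> (\<forall>p\<in>Fr N. \<forall>a b c. P (g3 N p a b c))"
  for P :: "'k::field vec \<Rightarrow> bool"
proof (intro iffI ballI allI)
  fix v :: "'k vec" assume "\<forall>p\<in>Fr N. \<forall>a b c. P (g3 N p a b c)" "v \<in> Fr (N + 3)"
  then have "P (g3 N (rs N v) (v N) (v (Suc N)) (v (Suc (Suc N))))" using rs_Fr[of N v] by blast
  then show "P v" using g3_eq[OF \<open>v \<in> Fr (N + 3)\<close>] by simp
qed (use g_Fr(2) in blast)
lemma ex_g1: "(\<exists>v\<in>Fr (N + 1). P v) \<longleftrightarrow> (\<exists>p\<in>Fr N. \<exists>a. P (g1 N p a))"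
  using all_g1[of N "\<lambda>v. \<not> P v"] by blast
lemma ex_g3: "(\<exists>v\<in>Fr (N + 3). P v) \<longleftrightarrow> (\<exists>p\<in>Fr N. \<exists>a b c. P (g3 N p a b c))"
  using all_g3[of N "\<lambda>v. \<not> P v"] by blast

text \<open>The horseshoe construction for \<open>0 \<rightarrow> k \<rightarrow> Q/J \<rightarrow> Q/J' \<rightarrow> 0\<close>, where \<open>k\<close> is spanned by the class of \<open>w\<close>
  and is resolved by the Koszul complex.\<close>

lemma horseshoe:
  fixes J J' :: "'k::field ps3 set" and w :: "'k ps3"
  assumes J: "tideal J" and J': "\<And>f. f \<in> J' \<longleftrightarrow> (\<exists>t. f + t * w \<in> J)"
    and w: "\<And>t. t * w \<in> J \<longleftrightarrow> ct t = 0"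
    and res: "free_res J' N0 N1 N2 N3 \<epsilon> d0 d1 d2"
  shows "\<exists>\<epsilon> d0 d1 d2. free_res J (N0 + 1) (N1 + 3) (N2 + 3) (N3 + 1) \<epsilon> d0 d1 d2"
proof -
  note r = free_resD[OF res]
  note l = r(1-4) and c = r(5-7) and onto = r(8) and e0 = r(9) and e1 = r(10) and e2 = r(11) and e3 = r(12)
  have koszul0: "ct t = 0 \<longleftrightarrow> (\<exists>a b c. t = vX * a + vY * b + vZ * c)" for t :: "'k ps3"
    using ps3_decomp0[of t] by auto
  have "\<exists>t. \<epsilon> (d0 (bas i)) + t * w \<in> J" if "i < N1" for i
    using e0[OF c(1)[OF bas_Fr[OF that]]] bas_Fr[OF that] J' by blast
  then obtain t where t: "\<And>i. i < N1 \<Longrightarrow> \<epsilon> (d0 (bas i)) + t i * w \<in> J" by metis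
  \<comment> \<open>\<open>\<epsilon> d0\<close> takes values in \<open>J'\<close> only; \<tau> is
    the multiple of \<open>w\<close> that brings them into \<open>J\<close>.\<close>
  define \<tau> where "\<tau> v = (\<Sum>i<N1. v i * t i)" for v
  have l\<tau>: "lin1 N1 \<tau>" unfolding \<tau>_def by (rule lin1_sum)
  have \<tau>: "\<epsilon> (d0 p) + \<tau> p * w \<in> J" if "p \<in> Fr N1" for p
  proof -
    have "\<epsilon> (d0 p) + \<tau> p * w = (\<Sum>i<N1. p i * (\<epsilon> (d0 (bas i)) + t i * w))"
      using lin1_comp_expand[of N1 d0 N0 \<epsilon> p, OF l(2) _ l(1) that] c(1) unfolding \<tau>_def
      by (simp add: distrib_left sum.distrib sum_distrib_right mult.assoc)
    also have "\<dots> \<in> J" by (intro tideal_sum[OF J] tidealD(3)[OF J] t) simp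
    finally show ?thesis .
  qed
  have d01: "d0 (d1 p) = 0" if "p \<in> Fr N2" for p using e1[OF c(2)[OF that]] that by blast
  have d12: "d1 (d2 p) = 0" if "p \<in> Fr N3" for p using e2[OF c(3)[OF that]] that by blast
  \<comment> \<open>On d1, \<tau> times \<open>w\<close> lies in \<open>J\<close>; so \<tau> d1 has
    no constant term and lifts through the first Koszul differential.\<close>
  have "\<exists>a b c. vX * a + vY * b + vZ * c + \<tau> (d1 (bas i)) = 0" if "i < N2" for i
  proof -
    have "\<epsilon> (d0 (d1 (bas i))) = 0" using d01[OF bas_Fr[OF that]] lin1D(4)[OF l(1)] by simp
    then have "\<tau> (d1 (bas i)) * w \<in> J" using \<tau>[OF c(2)[OF bas_Fr[OF that]]] by simp
    then have "ct (- \<tau> (d1 (bas i))) = 0" unfolding w by simp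
    then obtain a b c where "- \<tau> (d1 (bas i)) = vX * a + vY * b + vZ * c" unfolding koszul0 by blast
    then have "vX * a + vY * b + vZ * c + \<tau> (d1 (bas i)) = 0" by (metis add.commute add.right_inverse)
    then show ?thesis by blast
  qed
  then obtain s1 s2 s3 where s: "\<And>i. i < N2 \<Longrightarrow> vX * s1 i + vY * s2 i + vZ * s3 i + \<tau> (d1 (bas i)) = 0" by metis
  define \<tau>a \<tau>b \<tau>c where "\<tau>a v = (\<Sum>i<N2. v i * s1 i)" and "\<tau>b v = (\<Sum>i<N2. v i * s2 i)" and "\<tau>c v = (\<Sum>i<N2. v i * s3 i)" for v
  have l\<tau>1: "lin1 N2 \<tau>a" "lin1 N2 \<tau>b" "lin1 N2 \<tau>c" unfolding \<tau>a_def \<tau>b_def \<tau>c_def by (rule lin1_sum)+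
  have \<tau>1: "vX * \<tau>a p + vY * \<tau>b p + vZ * \<tau>c p + \<tau> (d1 p) = 0" if "p \<in> Fr N2" for p
  proof -
    have "vX * \<tau>a p + vY * \<tau>b p + vZ * \<tau>c p + \<tau> (d1 p) = (\<Sum>i<N2. p i * (vX * s1 i + vY * s2 i + vZ * s3 i + \<tau> (d1 (bas i))))"
      using lin1_comp_expand[of N2 d1 N1 \<tau> p, OF l(3) _ l\<tau> that] c(2) unfolding \<tau>a_def \<tau>b_def \<tau>c_def
      by (simp add: distrib_left sum.distrib sum_distrib_left mult.left_commute)
    also have "\<dots> = 0" by (simp add: s)
    finally show ?thesis .
  qed
  \<comment> \<open>Composed with d2 these lifts are Koszul cycles, hence Koszul boundaries. Up to
    sign the corrections form a chain map into the shifted Koszul complex.\<close>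
  have "\<exists>u1 u2 u3. (vY * u3 - vZ * u2) + \<tau>a (d2 (bas i)) = 0 \<and> (vZ * u1 - vX * u3) + \<tau>b (d2 (bas i)) = 0 \<and>
      (vX * u2 - vY * u1) + \<tau>c (d2 (bas i)) = 0" if "i < N3" for i
  proof -
    let ?q = "d2 (bas i)"
    have "vX * (- \<tau>a ?q) + vY * (- \<tau>b ?q) + vZ * (- \<tau>c ?q) = - (vX * \<tau>a ?q + vY * \<tau>b ?q + vZ * \<tau>c ?q + \<tau> (d1 ?q))"
      using d12[OF bas_Fr[OF that]] lin1D(4)[OF l\<tau>] by simp
    also have "\<dots> = 0" using \<tau>1[OF c(3)[OF bas_Fr[OF that]]] by simp
    finally obtain u v z where "- \<tau>a ?q = vY * z - vZ * v" "- \<tau>b ?q = vZ * u - vX * z" "- \<tau>c ?q = vX * v - vY * u"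
      using koszul_exact1 by blast
    then have "(vY * z - vZ * v) + \<tau>a ?q = 0 \<and> (vZ * u - vX * z) + \<tau>b ?q = 0 \<and> (vX * v - vY * u) + \<tau>c ?q = 0"
      by (metis add.commute add.right_inverse)
    then show ?thesis by blast
  qed
  then obtain r1 r2 r3 where r: "\<And>i. i < N3 \<Longrightarrow> (vY * r3 i - vZ * r2 i) + \<tau>a (d2 (bas i)) = 0"
    "\<And>i. i < N3 \<Longrightarrow> (vZ * r1 i - vX * r3 i) + \<tau>b (d2 (bas i)) = 0"
    "\<And>i. i < N3 \<Longrightarrow> (vX * r2 i - vY * r1 i) + \<tau>c (d2 (bas i)) = 0" by metis
  define \<rho>a \<rho>b \<rho>c where "\<rho>a v = (\<Sum>i<N3. v i * r1 i)" and "\<rho>b v = (\<Sum>i<N3. v i * r2 i)" and "\<rho>c v = (\<Sum>i<N3. v i * r3 i)" for v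
  have l\<rho>: "lin1 N3 \<rho>a" "lin1 N3 \<rho>b" "lin1 N3 \<rho>c" unfolding \<rho>a_def \<rho>b_def \<rho>c_def by (rule lin1_sum)+
  have \<rho>: "(vY * \<rho>c p - vZ * \<rho>b p) + \<tau>a (d2 p) = 0 \<and> (vZ * \<rho>a p - vX * \<rho>c p) + \<tau>b (d2 p) = 0 \<and>
      (vX * \<rho>b p - vY * \<rho>a p) + \<tau>c (d2 p) = 0" if "p \<in> Fr N3" for p
  proof -
    have "(vY * \<rho>c p - vZ * \<rho>b p) + \<tau>a (d2 p) = (\<Sum>i<N3. p i * ((vY * r3 i - vZ * r2 i) + \<tau>a (d2 (bas i))))"
      "(vZ * \<rho>a p - vX * \<rho>c p) + \<tau>b (d2 p) = (\<Sum>i<N3. p i * ((vZ * r1 i - vX * r3 i) + \<tau>b (d2 (bas i))))"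
      "(vX * \<rho>b p - vY * \<rho>a p) + \<tau>c (d2 p) = (\<Sum>i<N3. p i * ((vX * r2 i - vY * r1 i) + \<tau>c (d2 (bas i))))"
      using lin1_comp_expand[of N3 d2 N2 \<tau>a p, OF l(4) _ l\<tau>1(1) that] lin1_comp_expand[of N3 d2 N2 \<tau>b p, OF l(4) _ l\<tau>1(2) that]
        lin1_comp_expand[of N3 d2 N2 \<tau>c p, OF l(4) _ l\<tau>1(3) that] c(3) unfolding \<rho>a_def \<rho>b_def \<rho>c_def
      by (simp_all add: distrib_left right_diff_distrib sum.distrib sum_subtractf sum_distrib_left mult.left_commute)
    then show ?thesis by (simp add: r)
  qed
  \<comment> \<open>The new differentials are block triangular: the old ones, the Koszul ones, and
    the corrections from the old summands to the Koszul summands.\<close>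
  define \<epsilon>' where "\<epsilon>' v = \<epsilon> (rs N0 v) + v N0 * w" for v
  define d0' where "d0' v = g1 N0 (d0 (rs N1 v)) (vX * v N1 + vY * v (Suc N1) + vZ * v (Suc (Suc N1)) + \<tau> (rs N1 v))" for v
  define d1' where "d1' v = g3 N1 (d1 (rs N2 v)) (vY * v (Suc (Suc N2)) - vZ * v (Suc N2) + \<tau>a (rs N2 v))
    (vZ * v N2 - vX * v (Suc (Suc N2)) + \<tau>b (rs N2 v)) (vX * v (Suc N2) - vY * v N2 + \<tau>c (rs N2 v))" for v
  define d2' where "d2' v = g3 N2 (d2 (rs N3 v)) (vX * v N3 + \<rho>a (rs N3 v)) (vY * v N3 + \<rho>b (rs N3 v)) (vZ * v N3 + \<rho>c (rs N3 v))" for v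
  have E: "\<epsilon>' (g1 N0 p a) = \<epsilon> p + a * w" if "p \<in> Fr N0" for p a
    using rs_id[OF that] by (simp add: \<epsilon>'_def g1_nth)
  have D0: "d0' (g3 N1 p a b c) = g1 N0 (d0 p) (vX * a + vY * b + vZ * c + \<tau> p)" if "p \<in> Fr N1" for p a b c
    using rs_id[OF that] by (simp add: d0'_def g3_nth)
  have D1: "d1' (g3 N2 p a b c) = g3 N1 (d1 p) (vY * c - vZ * b + \<tau>a p) (vZ * a - vX * c + \<tau>b p) (vX * b - vY * a + \<tau>c p)"
    if "p \<in> Fr N2" for p a b c
    using rs_id[OF that] by (simp add: d1'_def g3_nth)
  have D2: "d2' (g1 N3 p q) = g3 N2 (d2 p) (vX * q + \<rho>a p) (vY * q + \<rho>b p) (vZ * q + \<rho>c p)" if "p \<in> Fr N3" for p q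
    using rs_id[OF that] by (simp add: d2'_def g1_nth)
  have "free_res J (N0 + 1) (N1 + 3) (N2 + 3) (N3 + 1) \<epsilon>' d0' d1' d2'"
    unfolding free_res_def
  proof (intro conjI)
    show "lin1 (N0 + 1) \<epsilon>'"
      using lin1D(1,2)[OF l(1)] by (simp add: lin1_def \<epsilon>'_def rs_add rs_sm algebra_simps)
    show "lin (N1 + 3) d0'"
      using linD(1,2)[OF l(2)] lin1D(1,2)[OF l\<tau>] by (simp add: lin_def d0'_def rs_add rs_sm g_add g_sm algebra_simps)
    show "lin (N2 + 3) d1'"
      using linD(1,2)[OF l(3)] lin1D(1,2)[OF l\<tau>1(1)] lin1D(1,2)[OF l\<tau>1(2)] lin1D(1,2)[OF l\<tau>1(3)]
      by (simp add: lin_def d1'_def rs_add rs_sm g_add g_sm algebra_simps)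
    show "lin (N3 + 1) d2'"
      using linD(1,2)[OF l(4)] lin1D(1,2)[OF l\<rho>(1)] lin1D(1,2)[OF l\<rho>(2)] lin1D(1,2)[OF l\<rho>(3)]
      by (simp add: lin_def d2'_def rs_add rs_sm g_add g_sm algebra_simps)
    show "\<forall>v\<in>Fr (N1 + 3). d0' v \<in> Fr (N0 + 1)" "\<forall>v\<in>Fr (N2 + 3). d1' v \<in> Fr (N1 + 3)" "\<forall>v\<in>Fr (N3 + 1). d2' v \<in> Fr (N2 + 3)"
      by (simp_all only: d0'_def d1'_def d2'_def g_Fr ball_triv simp_thms)
    show "\<forall>q. \<exists>v\<in>Fr (N0 + 1). q - \<epsilon>' v \<in> J"
    proof
      fix q
      obtain v where v: "v \<in> Fr N0" "q - \<epsilon> v \<in> J'" using onto by blast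
      then obtain t where "q - \<epsilon> v + t * w \<in> J" unfolding J' by blast
      then have "q - \<epsilon>' (g1 N0 v (- t)) \<in> J" using E[OF v(1)] by (simp add: algebra_simps)
      then show "\<exists>v\<in>Fr (N0 + 1). q - \<epsilon>' v \<in> J" using g_Fr by blast
    qed
    show "\<forall>v\<in>Fr (N0 + 1). \<epsilon>' v \<in> J \<longleftrightarrow> (\<exists>w\<in>Fr (N1 + 3). v = d0' w)"
      unfolding all_g1 ex_g3
    proof (intro ballI allI iffI)
      fix p a assume p: "p \<in> Fr N0" and "\<epsilon>' (g1 N0 p a) \<in> J"
      then have h: "\<epsilon> p + a * w \<in> J" using E by simp
      then obtain p1 where p1: "p1 \<in> Fr N1" "p = d0 p1" using e0[OF p] J' by blast
      have "(a - \<tau> p1) * w = (\<epsilon> p + a * w) - (\<epsilon> (d0 p1) + \<tau> p1 * w)" by (simp add: p1 algebra_simps)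
      then have "(a - \<tau> p1) * w \<in> J" using tidealD(6)[OF J h \<tau>[OF p1(1)]] by simp
      then obtain x y z where "a - \<tau> p1 = vX * x + vY * y + vZ * z" unfolding w koszul0 by blast
      then have "a = vX * x + vY * y + vZ * z + \<tau> p1" by (simp add: diff_eq_eq)
      then have "g1 N0 p a = d0' (g3 N1 p1 x y z)" unfolding D0[OF p1(1)] by (simp add: p1(2))
      then show "\<exists>p1\<in>Fr N1. \<exists>x y z. g1 N0 p a = d0' (g3 N1 p1 x y z)" using p1(1) by blast
    next
      fix p a assume p: "p \<in> Fr N0" and "\<exists>p1\<in>Fr N1. \<exists>x y z. g1 N0 p a = d0' (g3 N1 p1 x y z)"
      then obtain p1 x y z where p1: "p1 \<in> Fr N1" "g1 N0 p a = d0' (g3 N1 p1 x y z)" by blast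
      then have pa: "p = d0 p1" "a = vX * x + vY * y + vZ * z + \<tau> p1"
        unfolding D0[OF p1(1)] g1_inj using rs_id[OF p] rs_id[OF c(1)[OF p1(1)]] by auto
      have "ct (vX * x + vY * y + vZ * z) = 0" by simp
      then have "(vX * x + vY * y + vZ * z) * w \<in> J" unfolding w .
      from tidealD(2)[OF J this \<tau>[OF p1(1)]] show "\<epsilon>' (g1 N0 p a) \<in> J"
        unfolding E[OF p] unfolding pa by (simp add: algebra_simps)
    qed
    show "\<forall>v\<in>Fr (N1 + 3). d0' v = 0 \<longleftrightarrow> (\<exists>w\<in>Fr (N2 + 3). v = d1' w)"
      unfolding all_g3 ex_g3
    proof (intro ballI allI iffI)
      fix p a b e assume p: "p \<in> Fr N1" and "d0' (g3 N1 p a b e) = 0"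
      then have h: "d0 p = 0" "vX * a + vY * b + vZ * e + \<tau> p = 0"
        unfolding D0[OF p] g1_0 using rs_id[OF c(1)[OF p]] by auto
      obtain p2 where p2: "p2 \<in> Fr N2" "p = d1 p2" using e1[OF p] h(1) by blast
      have "vX * (a - \<tau>a p2) + vY * (b - \<tau>b p2) + vZ * (e - \<tau>c p2)
         = (vX * a + vY * b + vZ * e + \<tau> p) - (vX * \<tau>a p2 + vY * \<tau>b p2 + vZ * \<tau>c p2 + \<tau> (d1 p2))"
        by (simp add: p2 algebra_simps)
      also have "\<dots> = 0" using h(2) \<tau>1[OF p2(1)] by simp
      finally obtain x y z where "a - \<tau>a p2 = vY * z - vZ * y" "b - \<tau>b p2 = vZ * x - vX * z" "e - \<tau>c p2 = vX * y - vY * x"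
        using koszul_exact1 by blast
      then have "g3 N1 p a b e = d1' (g3 N2 p2 x y z)" unfolding D1[OF p2(1)] by (simp add: p2(2) diff_eq_eq)
      then show "\<exists>p2\<in>Fr N2. \<exists>x y z. g3 N1 p a b e = d1' (g3 N2 p2 x y z)" using p2(1) by blast
    next
      fix p a b e assume p: "p \<in> Fr N1" and "\<exists>p2\<in>Fr N2. \<exists>x y z. g3 N1 p a b e = d1' (g3 N2 p2 x y z)"
      then obtain p2 x y z where p2: "p2 \<in> Fr N2" "g3 N1 p a b e = d1' (g3 N2 p2 x y z)" by blast
      then have pa: "p = d1 p2" "a = vY * z - vZ * y + \<tau>a p2" "b = vZ * x - vX * z + \<tau>b p2" "e = vX * y - vY * x + \<tau>c p2"
        unfolding D1[OF p2(1)] g3_inj using rs_id[OF p] rs_id[OF c(2)[OF p2(1)]] by auto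
      have "vX * a + vY * b + vZ * e + \<tau> p = vX * \<tau>a p2 + vY * \<tau>b p2 + vZ * \<tau>c p2 + \<tau> (d1 p2)"
        by (simp add: pa algebra_simps)
      then show "d0' (g3 N1 p a b e) = 0"
        unfolding D0[OF p] g1_0 using \<tau>1[OF p2(1)] d01[OF p2(1)] by (simp add: pa(1) rs_0)
    qed
    show "\<forall>v\<in>Fr (N2 + 3). d1' v = 0 \<longleftrightarrow> (\<exists>w\<in>Fr (N3 + 1). v = d2' w)"
      unfolding all_g3 ex_g1
    proof (intro ballI allI iffI)
      fix p a b e assume p: "p \<in> Fr N2" and "d1' (g3 N2 p a b e) = 0"
      then have h: "d1 p = 0" "vY * e - vZ * b + \<tau>a p = 0" "vZ * a - vX * e + \<tau>b p = 0" "vX * b - vY * a + \<tau>c p = 0"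
        unfolding D1[OF p] g3_0 using rs_id[OF c(2)[OF p]] by auto
      obtain p3 where p3: "p3 \<in> Fr N3" "p = d2 p3" using e2[OF p] h(1) by blast
      note \<rho>' = \<rho>[OF p3(1), folded p3(2)]
      have "vY * (e - \<rho>c p3) - vZ * (b - \<rho>b p3) = (vY * e - vZ * b + \<tau>a p) - ((vY * \<rho>c p3 - vZ * \<rho>b p3) + \<tau>a p)"
        "vZ * (a - \<rho>a p3) - vX * (e - \<rho>c p3) = (vZ * a - vX * e + \<tau>b p) - ((vZ * \<rho>a p3 - vX * \<rho>c p3) + \<tau>b p)"
        "vX * (b - \<rho>b p3) - vY * (a - \<rho>a p3) = (vX * b - vY * a + \<tau>c p) - ((vX * \<rho>b p3 - vY * \<rho>a p3) + \<tau>c p)"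
        by (simp_all add: algebra_simps)
      then obtain q where "a - \<rho>a p3 = vX * q" "b - \<rho>b p3 = vY * q" "e - \<rho>c p3 = vZ * q"
        using koszul_exact2[of "e - \<rho>c p3" "b - \<rho>b p3" "a - \<rho>a p3"] h \<rho>' by (metis diff_zero)
      then have "g3 N2 p a b e = d2' (g1 N3 p3 q)" unfolding D2[OF p3(1)] by (simp add: p3(2) diff_eq_eq)
      then show "\<exists>p3\<in>Fr N3. \<exists>q. g3 N2 p a b e = d2' (g1 N3 p3 q)" using p3(1) by blast
    next
      fix p a b e assume p: "p \<in> Fr N2" and "\<exists>p3\<in>Fr N3. \<exists>q. g3 N2 p a b e = d2' (g1 N3 p3 q)"
      then obtain p3 q where p3: "p3 \<in> Fr N3" "g3 N2 p a b e = d2' (g1 N3 p3 q)" by blast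
      then have pa: "p = d2 p3" "a = vX * q + \<rho>a p3" "b = vY * q + \<rho>b p3" "e = vZ * q + \<rho>c p3"
        unfolding D2[OF p3(1)] g3_inj using rs_id[OF p] rs_id[OF c(3)[OF p3(1)]] by auto
      have "vY * e - vZ * b + \<tau>a p = (vY * \<rho>c p3 - vZ * \<rho>b p3) + \<tau>a (d2 p3)"
        "vZ * a - vX * e + \<tau>b p = (vZ * \<rho>a p3 - vX * \<rho>c p3) + \<tau>b (d2 p3)"
        "vX * b - vY * a + \<tau>c p = (vX * \<rho>b p3 - vY * \<rho>a p3) + \<tau>c (d2 p3)"
        by (simp_all add: pa algebra_simps)
      then show "d1' (g3 N2 p a b e) = 0"
        unfolding D1[OF p] g3_0 using \<rho>[OF p3(1)] d12[OF p3(1)] by (simp add: pa(1) rs_0)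
    qed
    show "\<forall>v\<in>Fr (N3 + 1). d2' v = 0 \<longrightarrow> v = 0"
      unfolding all_g1
    proof (intro ballI allI impI)
      fix p q assume p: "p \<in> Fr N3" and "d2' (g1 N3 p q) = 0"
      then have h: "d2 p = 0" "vX * q + \<rho>a p = 0" unfolding D2[OF p] g3_0 using rs_id[OF c(3)[OF p]] by auto
      have "p = 0" by (rule e3[OF p h(1)])
      then have "q = 0" using h(2) lin1D(4)[OF l\<rho>(1)] by simp
      then show "g1 N3 p q = 0" unfolding g1_0 by (simp add: \<open>p = 0\<close> rs_0)
    qed
  qed
  then show ?thesis by blast
qed

lemma free_res_IL:
  assumes "finite D" "order_closed D"
  shows "\<exists>N0 N1 N2 N3 \<epsilon> d0 d1 d2. free_res (IL D :: 'k::field ps3 set) N0 N1 N2 N3 \<epsilon> d0 d1 d2"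
  using assms
proof (induct D rule: order_closed_induct)
  case empty
  have F0: "Fr 0 = {0 :: 'k vec}" by (auto simp: Fr_def fun_eq_iff)
  have "free_res (IL {} :: 'k ps3 set) 0 0 0 0 (\<lambda>_. 0) (\<lambda>_. 0) (\<lambda>_. 0) (\<lambda>_. 0)"
    unfolding free_res_def F0 by (simp add: lin1_def lin_def F0 sm_0 IL_def)
  then show ?case by blast
next
  case (remove D m)
  then obtain N0 N1 N2 N3 \<epsilon> d0 d1 d2 where res: "free_res (IL (D - {m}) :: 'k ps3 set) N0 N1 N2 N3 \<epsilon> d0 d1 d2" by blast
  have tD: "tideal (IL D :: 'k ps3 set)" using remove(2) by (auto simp: tideal_def intro: IL_add IL_mult)
  have sub: "IL D \<subseteq> (IL (D - {m}) :: 'k ps3 set)" by (auto simp: IL_def)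
  have tD': "tideal (IL (D - {m}) :: 'k ps3 set)" using remove(4) by (auto simp: tideal_def intro: IL_add IL_mult)
  have wD': "WT m \<in> (IL (D - {m}) :: 'k ps3 set)" by (rule WT_in_IL) simp
  have J': "f \<in> IL (D - {m}) \<longleftrightarrow> (\<exists>t. f + t * WT m \<in> IL D)" for f :: "'k ps3"
  proof
    assume "f \<in> IL (D - {m})"
    from IL_remove[OF this] have "f + (- cst (LT m f)) * WT m \<in> IL D" by simp
    then show "\<exists>t. f + t * WT m \<in> IL D" by blast
  next
    assume "\<exists>t. f + t * WT m \<in> IL D"
    then obtain t where "f + t * WT m \<in> IL (D - {m})" using sub by blast
    from tidealD(6)[OF tD' this tidealD(3)[OF tD' wD', of t]] show "f \<in> IL (D - {m})" by simp
  qed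
  have w: "t * WT m \<in> IL D \<longleftrightarrow> ct t = 0" for t :: "'k ps3"
  proof
    show "ct t = 0 \<Longrightarrow> t * WT m \<in> IL D" by (rule top_WT_mult[OF remove(2,5)])
    assume "t * WT m \<in> IL D"
    moreover have "(t - cst (ct t)) * WT m \<in> IL D" by (rule top_WT_mult[OF remove(2,5)]) simp_all
    ultimately have "t * WT m - (t - cst (ct t)) * WT m \<in> IL D" by (rule tidealD(6)[OF tD])
    then have "cst (ct t) * WT m \<in> IL D" by (simp add: algebra_simps)
    then have "LT m (cst (ct t) * WT m) = 0" using remove(3) unfolding IL_def by blast
    then show "ct t = 0" by (simp add: LT_WT)
  qed
  show ?case using horseshoe[OF tD J' w res] by blast
qed

subsection \<open>Projective dimension\<close>

definition frm :: "'k::field vec set \<Rightarrow> ('k ps3, nat \<Rightarrow> 'k ps3) module" where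
  "frm S = \<lparr>carrier = S, monoid.mult = undefined, one = undefined, ring.zero = 0, add = (+), module.smult = sm\<rparr>"

lemma frm_simps [simp]: "carrier (frm S) = S" "\<zero>\<^bsub>frm S\<^esub> = 0" "x \<oplus>\<^bsub>frm S\<^esub> y = x + y" "c \<odot>\<^bsub>frm S\<^esub> x = sm c x"
  by (simp_all add: frm_def)

definition submod :: "'k::field vec set \<Rightarrow> bool" where
  "submod S \<longleftrightarrow> 0 \<in> S \<and> (\<forall>x\<in>S. \<forall>y\<in>S. x + y \<in> S) \<and> (\<forall>c. \<forall>x\<in>S. sm c x \<in> S)"

lemma frm_module: assumes S: "submod S" shows "module TA (frm S)"
proof (rule moduleI[OF TA_cring])
  show "abelian_group (frm S)"
  proof (rule abelian_groupI)
    fix x assume "x \<in> carrier (frm S)"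
    then have "sm (- 1) x \<in> S" using S by (simp add: submod_def)
    moreover have "sm (- 1) x + x = 0" by (auto simp: fun_eq_iff)
    ultimately show "\<exists>y\<in>carrier (frm S). y \<oplus>\<^bsub>frm S\<^esub> x = \<zero>\<^bsub>frm S\<^esub>" unfolding frm_simps by blast
  qed (use S in \<open>simp_all add: submod_def add.assoc add.commute\<close>)
qed (use S in \<open>simp_all add: submod_def sm_add sm_sm sm_1\<close>)

lemma submod_Fr: "submod (Fr N)"
  by (simp add: submod_def Fr_simps)

text \<open>A linear combination formed with the operations of an arbitrary module record; it
  describes the homomorphisms out of a free module.\<close>

primrec gsum :: "('k::field ps3, 'm) module \<Rightarrow> (nat \<Rightarrow> 'm) \<Rightarrow> 'k vec \<Rightarrow> nat \<Rightarrow> 'm" where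
  "gsum M l v 0 = \<zero>\<^bsub>M\<^esub>"
| "gsum M l v (Suc n) = gsum M l v n \<oplus>\<^bsub>M\<^esub> (v n \<odot>\<^bsub>M\<^esub> l n)"

context
  fixes M :: "('k::field ps3, 'm) module"
  assumes M: "module TA M"
begin

interpretation module TA M by (rule M)

lemma gsum_closed: "(\<And>i. i < n \<Longrightarrow> l i \<in> carrier M) \<Longrightarrow> gsum M l v n \<in> carrier M"
  by (induct n) auto

lemma gsum_add: "(\<And>i. i < n \<Longrightarrow> l i \<in> carrier M) \<Longrightarrow> gsum M l (v + w) n = gsum M l v n \<oplus>\<^bsub>M\<^esub> gsum M l w n"
proof (induct n)
  case (Suc n)
  have c: "gsum M l v n \<in> carrier M" "gsum M l w n \<in> carrier M" "l n \<in> carrier M"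
    using Suc(2) by (auto intro!: gsum_closed)
  have "(v n + w n) \<odot>\<^bsub>M\<^esub> l n = v n \<odot>\<^bsub>M\<^esub> l n \<oplus>\<^bsub>M\<^esub> w n \<odot>\<^bsub>M\<^esub> l n"
    using smult_l_distr[of "v n" "w n" "l n"] c by simp
  then show ?case using Suc c smult_closed[of _ "l n"] by (simp add: M.a_ac)
qed simp

lemma gsum_sm: "(\<And>i. i < n \<Longrightarrow> l i \<in> carrier M) \<Longrightarrow> gsum M l (sm c v) n = c \<odot>\<^bsub>M\<^esub> gsum M l v n"
proof (induct n)
  case 0 then show ?case using smult_r_null[of c] by simp
next
  case (Suc n)
  have c: "gsum M l v n \<in> carrier M" "l n \<in> carrier M"
    using Suc(2) by (auto intro!: gsum_closed)
  then show ?case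
    using Suc smult_r_distr[of c "gsum M l v n" "v n \<odot>\<^bsub>M\<^esub> l n"] smult_assoc1[of c "v n" "l n"] smult_closed[of "v n" "l n"] by simp
qed

lemma gsum_expand:
  assumes f: "f \<in> mod_hom TA (frm (Fr N)) M" and v: "v \<in> Fr N"
  shows "f v = gsum M (\<lambda>i. f (bas i)) v N"
proof -
  have "n \<le> N \<Longrightarrow> f (rs n v) = gsum M (\<lambda>i. f (bas i)) v n" for n
  proof (induct n)
    case 0
    have "rs 0 v = 0" by (auto simp: rs_def fun_eq_iff)
    have z: "f 0 = \<zero>\<^bsub>M\<^esub>" using mod_hom_zero[OF f frm_module[OF submod_Fr] M] unfolding frm_simps .
    show ?case unfolding \<open>rs 0 v = 0\<close> gsum.simps(1) by (rule z)
  next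
    case (Suc n)
    have b: "bas n \<in> Fr N" by (rule bas_Fr) (use Suc(2) in simp)
    have r: "rs n v \<in> Fr N" using Suc(2) by (auto simp: rs_def Fr_def)
    have "f (rs (Suc n) v) = f (rs n v) \<oplus>\<^bsub>M\<^esub> f (sm (v n) (bas n))"
      unfolding rs_Suc using mod_homD(2)[OF f] r Fr_simps(3)[OF b] unfolding frm_simps by blast
    also have "f (sm (v n) (bas n)) = v n \<odot>\<^bsub>M\<^esub> f (bas n)"
      using mod_homD(3)[OF f, of "v n" "bas n"] b by simp
    finally show ?case using Suc by simp
  qed
  from this[of N] show ?thesis using rs_id[OF v] by simp
qed

end

lemma gsum_hom:
  fixes M :: "('k::field ps3, 'm) module" and M' :: "('k::field ps3, 'n) module"
  assumes "module TA M" "module TA M'" "p \<in> mod_hom TA M M'" "\<And>i. i < n \<Longrightarrow> l i \<in> carrier M"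
  shows "p (gsum M l v n) = gsum M' (\<lambda>i. p (l i)) v n"
  using assms(4)
proof (induct n)
  case 0 then show ?case using mod_hom_zero[OF assms(3,1,2)] by simp
next
  case (Suc n)
  have c: "gsum M l v n \<in> carrier M" "l n \<in> carrier M"
    using Suc(2) by (auto intro!: gsum_closed[OF assms(1)])
  then show ?case
    using Suc mod_homD(2)[OF assms(3), of "gsum M l v n" "v n \<odot>\<^bsub>M\<^esub> l n"] mod_homD(3)[OF assms(3), of "v n" "l n"]
      module.smult_closed[OF assms(1), of "v n" "l n"] by simp
qed

lemma gsum_cong: "(\<And>i. i < n \<Longrightarrow> l i = l' i) \<Longrightarrow> gsum M l v n = gsum M l' v n"
  by (induct n) auto

lemma projective_Fr: "projective_module TA (frm (Fr N) :: ('k::field ps3, nat \<Rightarrow> 'k ps3) module)"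
  unfolding projective_module_def
proof (intro conjI allI impI)
  show "module TA (frm (Fr N) :: ('k ps3, nat \<Rightarrow> 'k ps3) module)" by (rule frm_module[OF submod_Fr])
  fix M M' :: "('k ps3, nat \<Rightarrow> 'k ps3) module" and p f
  assume h: "module TA M \<and> module TA M' \<and> p \<in> mod_hom TA M M' \<and> p ` carrier M = carrier M' \<and> f \<in> mod_hom TA (frm (Fr N)) M'"
  then have M: "module TA M" and M': "module TA M'" and p: "p \<in> mod_hom TA M M'" and onto: "p ` carrier M = carrier M'"
    and f: "f \<in> mod_hom TA (frm (Fr N)) M'" by auto
  have "\<exists>x. x \<in> carrier M \<and> p x = f (bas i)" if "i < N" for i
  proof -
    have "f (bas i) \<in> p ` carrier M" unfolding onto using mod_homD(1)[OF f] bas_Fr[OF that] by simp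
    then show ?thesis by (auto simp: image_iff)
  qed
  then obtain l where l: "\<And>i. i < N \<Longrightarrow> l i \<in> carrier M" "\<And>i. i < N \<Longrightarrow> p (l i) = f (bas i)" by metis
  show "\<exists>g\<in>mod_hom TA (frm (Fr N)) M. \<forall>x\<in>carrier (frm (Fr N)). p (g x) = f x"
  proof (intro bexI[of _ "\<lambda>v. gsum M l v N"] ballI)
    show "(\<lambda>v. gsum M l v N) \<in> mod_hom TA (frm (Fr N)) M"
      by (rule mod_homI) (simp_all add: gsum_closed[OF M] gsum_add[OF M] gsum_sm[OF M] l(1))
    fix v :: "'k vec" assume "v \<in> carrier (frm (Fr N))"
    then have v: "v \<in> Fr N" by simp
    have "p (gsum M l v N) = gsum M' (\<lambda>i. p (l i)) v N" by (rule gsum_hom[OF M M' p l(1)])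
    also have "\<dots> = gsum M' (\<lambda>i. f (bas i)) v N" by (rule gsum_cong) (rule l(2))
    also have "\<dots> = f v" by (rule gsum_expand[OF M' f v, symmetric])
    finally show "p (gsum M l v N) = f v" .
  qed
qed

lemma quotient_module_simps:
  assumes J: "tideal J"
  shows "carrier (quotient_module TA J) = range (qm J)" "\<zero>\<^bsub>quotient_module TA J\<^esub> = qm J 0"
    "qm J a \<oplus>\<^bsub>quotient_module TA J\<^esub> qm J b = qm J (a + b)" "c \<odot>\<^bsub>quotient_module TA J\<^esub> qm J a = qm J (c * a)"
  using qm_add[OF J] qm_mult[OF J] qm_zero[OF J] carrier_quot[of J] by (simp_all add: quotient_module_def)

lemma proj_dim_le_3:
  fixes J :: "'k::field ps3 set"
  assumes J: "tideal J" and res: "free_res J N0 N1 N2 N3 \<epsilon> d0 d1 d2"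
  shows "\<exists>P d \<epsilon>. projective_resolution TA (quotient_module TA J) P d \<epsilon> \<and> (\<forall>i>3. carrier (P i) = {\<zero>\<^bsub>P i\<^esub>})"
proof -
  note r = free_resD[OF res]
  define n where "n i = (if i = 0 then N0 else if i = 1 then N1 else if i = 2 then N2 else if i = 3 then N3 else 0)" for i :: nat
  define P where "P i = (frm (Fr (n i)) :: ('k ps3, nat \<Rightarrow> 'k ps3) module)" for i
  define d where "d i = (if i = 0 then d0 else if i = 1 then d1 else if i = 2 then d2 else (\<lambda>_. 0))" for i :: nat
  have F0: "Fr 0 = {0 :: 'k vec}" by (auto simp: Fr_def fun_eq_iff)
  have "projective_resolution TA (quotient_module TA J) P d (\<lambda>v. qm J (\<epsilon> v))"
    unfolding projective_resolution_def
  proof (intro conjI allI)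
    fix i show "projective_module TA (P i)" unfolding P_def by (rule projective_Fr)
    show "d i \<in> mod_hom TA (P (Suc i)) (P i)"
      using r(5-7) linD(1,2)[OF r(2)] linD(1,2)[OF r(3)] linD(1,2)[OF r(4)]
      by (intro mod_homI) (auto simp: P_def d_def n_def F0 sm_0 intro!: Fr_simps(1) split: if_splits)
    have i: "i = 0 \<or> i = 1 \<or> i = 2 \<or> i > 2" by auto
    show "d (Suc i) ` carrier (P (Suc (Suc i))) = {x \<in> carrier (P (Suc i)). d i x = \<zero>\<^bsub>P i\<^esub>}"
      using i
    proof (elim disjE)
      assume "i = 0"
      then show ?thesis using r(6,10) by (auto simp: P_def d_def n_def)
    next
      assume "i = 1"
      then show ?thesis using r(7,11) by (auto simp: P_def d_def n_def numeral_2_eq_2 numeral_3_eq_3)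
    next
      assume "i = 2"
      then show ?thesis using r(12) linD(4)[OF r(4)] Fr_simps(1)[of N3] by (auto simp: P_def d_def n_def F0)
    next
      assume "i > 2"
      then show ?thesis by (auto simp: P_def d_def n_def F0)
    qed
  next
    show "(\<lambda>v. qm J (\<epsilon> v)) \<in> mod_hom TA (P 0) (quotient_module TA J)"
      using lin1D(1,2)[OF r(1)] by (intro mod_homI) (auto simp: P_def n_def quotient_module_simps[OF J])
    show "(\<lambda>v. qm J (\<epsilon> v)) ` carrier (P 0) = carrier (quotient_module TA J)"
    proof
      show "carrier (quotient_module TA J) \<subseteq> (\<lambda>v. qm J (\<epsilon> v)) ` carrier (P 0)"
      proof
        fix x assume "x \<in> carrier (quotient_module TA J)"
        then obtain q where q: "x = qm J q" by (auto simp: quotient_module_simps[OF J])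
        obtain v where "v \<in> Fr N0" "q - \<epsilon> v \<in> J" using r(8) by blast
        then show "x \<in> (\<lambda>v. qm J (\<epsilon> v)) ` carrier (P 0)" using q by (auto simp: P_def n_def qm_eq[OF J])
      qed
    qed (auto simp: quotient_module_simps[OF J])
    show "d 0 ` carrier (P 1) = {x \<in> carrier (P 0). qm J (\<epsilon> x) = \<zero>\<^bsub>quotient_module TA J\<^esub>}"
      using r(5,9) by (auto simp: P_def d_def n_def quotient_module_simps[OF J] qm_eq[OF J])
  qed
  moreover have "\<forall>i>3. carrier (P i) = {\<zero>\<^bsub>P i\<^esub>}" by (simp add: P_def n_def F0)
  ultimately show ?thesis by blast
qed

lemma projective_lift:
  fixes P :: "('k::field ps3, nat \<Rightarrow> 'k ps3) module"
  assumes P: "projective_module TA P" and d: "lin N d" and S: "submod S" "d ` Fr N = S"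
    and f: "f \<in> mod_hom TA P (frm S)"
  shows "\<exists>\<beta>\<in>mod_hom TA P (frm (Fr N)). \<forall>x\<in>carrier P. d (\<beta> x) = f x"
proof -
  have "d \<in> mod_hom TA (frm (Fr N)) (frm S)"
    using linD(1,2)[OF d] S(2) by (intro mod_homI) auto
  moreover have "d ` carrier (frm (Fr N)) = carrier (frm S)" using S(2) by simp
  ultimately show ?thesis
    using P[unfolded projective_module_def, THEN conjunct2, rule_format, of "frm (Fr N)" "frm S" d f]
      frm_module[OF submod_Fr, of N] frm_module[OF S(1)] f by blast
qed

lemma submod_ker: assumes "lin N d" "S = {v \<in> Fr N. d v = 0}" shows "submod S"
  using linD[OF assms(1)] unfolding assms(2) submod_def by (auto simp: Fr_simps sm_0)

section \<open>Resolutions of Q/I are not shorter than three\<close>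

context trim
begin

text \<open>An additive choice of representatives modulo \<open>I\<close>. Additivity lets the
  module below use the addition of power series itself.\<close>

definition nf :: "'k ps3 \<Rightarrow> 'k ps3" where "nf f = (\<Sum>l\<in>Lam k be. cst (LT l f) * WT l)"

lemma nf_I: "f - nf f \<in> I"
  unfolding nf_def using IL_expand[OF finite_Lam, of f] by (simp add: I_eq)

lemma nf_eq: "nf f = nf h \<longleftrightarrow> f - h \<in> I"
proof
  assume "nf f = nf h"
  then have "f - h = (f - nf f) - (h - nf h)" by simp
  then show "f - h \<in> I" using tidealD(6)[OF I nf_I[of f] nf_I[of h]] by simp
next
  assume "f - h \<in> I"
  then have "LT l f = LT l h" if "l \<in> Lam k be" for l using LT_I[OF _ that, of "f - h"] by simp
  then show "nf f = nf h" by (simp add: nf_def)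
qed

lemma nf_add: "nf f + nf h = nf (f + h)"
  by (simp add: nf_def cst_add distrib_right sum.distrib)

lemma nf_scale: "nf (c * nf f) = nf (c * f)"
proof -
  have "c * f - c * nf f \<in> I" using tidealD(3)[OF I nf_I[of f], of c] by (simp add: right_diff_distrib)
  then show ?thesis unfolding nf_eq using tidealD(5)[OF I, of "c * f - c * nf f"] by simp
qed

text \<open>A copy of \<open>Q/I\<close> on constant sequences of normal forms: projectivity is only tested against modules
  whose carrier type is \<open>nat \<Rightarrow> 'k ps3\<close>.\<close>

definition Nq :: "('k ps3, nat \<Rightarrow> 'k ps3) module" where
  "Nq = \<lparr>carrier = range (\<lambda>f _. nf f), monoid.mult = undefined, one = undefined, ring.zero = (\<lambda>_. nf 0),
     add = (\<lambda>u v _. u 0 + v 0), module.smult = (\<lambda>c v _. nf (c * v 0))\<rparr>"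

lemma Nq_simps: "carrier Nq = range (\<lambda>f _. nf f)" "\<zero>\<^bsub>Nq\<^esub> = (\<lambda>_. nf 0)"
  "(\<lambda>_. nf a) \<oplus>\<^bsub>Nq\<^esub> (\<lambda>_. nf b) = (\<lambda>_. nf (a + b))" "c \<odot>\<^bsub>Nq\<^esub> (\<lambda>_. nf a) = (\<lambda>_. nf (c * a))"
  by (simp_all add: Nq_def nf_add nf_scale)

lemma Nq_module: "module TA Nq"
proof (rule moduleI[OF TA_cring])
  show "abelian_group Nq"
  proof (rule abelian_groupI)
    fix x assume "x \<in> carrier Nq"
    then obtain f where f: "x = (\<lambda>_. nf f)" by (auto simp: Nq_simps)
    have "(\<lambda>_. nf (- f)) \<oplus>\<^bsub>Nq\<^esub> x = \<zero>\<^bsub>Nq\<^esub>" "(\<lambda>_. nf (- f)) \<in> carrier Nq" by (simp_all add: f Nq_simps)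
    then show "\<exists>y\<in>carrier Nq. y \<oplus>\<^bsub>Nq\<^esub> x = \<zero>\<^bsub>Nq\<^esub>" by blast
  qed (auto simp: Nq_simps ac_simps)
qed (auto simp: Nq_simps algebra_simps)

lemma module_add_closed:
  assumes "module S M" "x \<in> carrier M" "y \<in> carrier M" shows "x \<oplus>\<^bsub>M\<^esub> y \<in> carrier M"
proof -
  interpret module S M by (rule assms(1))
  show ?thesis using assms(2,3) by (rule M.a_closed)
qed

text \<open>The socle of Q/I is Tor_3 with the residue field, and the proof chases the class of s
  down the Koszul direction of the given resolution. If its third term is zero, the chase ends in a
  Koszul relation in degree 2. Solving that relation requires coordinates, which a projective module
  does not come with, so the chase is carried over to a free resolution.\<close>

lemma proj_dim_ge_3:
  assumes res: "projective_resolution TA (quotient_module TA I) PP d \<epsilon>" and P3: "carrier (PP 3) = {\<zero>\<^bsub>PP 3\<^esub>}"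
  shows False
proof -
  have pr: "projective_module TA (PP i)" and dh: "d i \<in> mod_hom TA (PP (Suc i)) (PP i)" for i
    using res by (auto simp: projective_resolution_def)
  have \<epsilon>: "\<epsilon> \<in> mod_hom TA (PP 0) (quotient_module TA I)" "\<epsilon> ` carrier (PP 0) = carrier (quotient_module TA I)"
    using res by (auto simp: projective_resolution_def)
  have im0: "d 0 ` carrier (PP (Suc 0)) = {x \<in> carrier (PP 0). \<epsilon> x = \<zero>\<^bsub>quotient_module TA I\<^esub>}"
    and im: "d (Suc i) ` carrier (PP (Suc (Suc i))) = {x \<in> carrier (PP (Suc i)). d i x = \<zero>\<^bsub>PP i\<^esub>}" for i
    using res by (auto simp: projective_resolution_def)
  have mP: "module TA (PP i)" for i using pr[of i] by (simp add: projective_module_def)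
  note q = quotient_module_simps[OF I]
  have ex0: "\<exists>y\<in>carrier (PP (Suc 0)). d 0 y = x" if "x \<in> carrier (PP 0)" "\<epsilon> x = qm I 0" for x
  proof -
    have "x \<in> d 0 ` carrier (PP (Suc 0))" unfolding im0 using that by (simp add: q)
    then show ?thesis by (auto simp: image_iff)
  qed
  have ed0: "\<epsilon> (d 0 y) = qm I 0" if "y \<in> carrier (PP (Suc 0))" for y
  proof -
    have "d 0 y \<in> d 0 ` carrier (PP (Suc 0))" using that by simp
    then show ?thesis unfolding im0 by (simp add: q)
  qed
  have ex: "\<exists>y\<in>carrier (PP (Suc (Suc i))). d (Suc i) y = x" if "x \<in> carrier (PP (Suc i))" "d i x = \<zero>\<^bsub>PP i\<^esub>" for x i
  proof -
    have "x \<in> d (Suc i) ` carrier (PP (Suc (Suc i)))" unfolding im using that by simp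
    then show ?thesis by (auto simp: image_iff)
  qed
  have dd: "d i (d (Suc i) y) = \<zero>\<^bsub>PP i\<^esub>" if "y \<in> carrier (PP (Suc (Suc i)))" for y i
  proof -
    have "d (Suc i) y \<in> d (Suc i) ` carrier (PP (Suc (Suc i)))" using that by simp
    then show ?thesis unfolding im by simp
  qed
  obtain N0 N1 N2 N3 e D0 D1 D2 where fr: "free_res I N0 N1 N2 N3 e D0 D1 D2"
    using free_res_IL[OF finite_Lam order_closed_Lam, where 'k = 'k] unfolding I_eq by blast
  note r = free_resD[OF fr]
  \<comment> \<open>a chain map from the given resolution to the free one, in degrees 0, 1 and 2\<close>
  define rep where "rep x = (SOME f. \<epsilon> x = qm I f)" for x
  have rep: "\<epsilon> x = qm I (rep x)" if "x \<in> carrier (PP 0)" for x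
  proof -
    have "\<epsilon> x \<in> range (qm I)" using mod_homD(1)[OF \<epsilon>(1) that] by (simp add: q)
    then have "\<exists>f. \<epsilon> x = qm I f" by auto
    then show ?thesis unfolding rep_def by (rule someI_ex)
  qed
  have "\<exists>\<beta>\<in>mod_hom TA (PP 0) (frm (Fr N0)). \<forall>x\<in>carrier (PP 0). (\<lambda>_::nat. nf (e (\<beta> x))) = (\<lambda>_. nf (rep x))"
  proof -
    have p: "(\<lambda>v _. nf (e v)) \<in> mod_hom TA (frm (Fr N0)) Nq"
      using lin1D(1,2)[OF r(1)] by (intro mod_homI) (auto simp: Nq_simps)
    have on: "(\<lambda>v _. nf (e v)) ` carrier (frm (Fr N0)) = carrier Nq"
    proof
      show "carrier Nq \<subseteq> (\<lambda>v _. nf (e v)) ` carrier (frm (Fr N0))"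
      proof
        fix x assume "x \<in> carrier Nq"
        then obtain f where f: "x = (\<lambda>_. nf f)" by (auto simp: Nq_simps)
        obtain v where v: "v \<in> Fr N0" "f - e v \<in> I" using r(8) by blast
        then have "nf f = nf (e v)" by (simp add: nf_eq)
        then show "x \<in> (\<lambda>v _. nf (e v)) ` carrier (frm (Fr N0))" using f v(1) by auto
      qed
    qed (auto simp: Nq_simps)
    have f: "(\<lambda>x _. nf (rep x)) \<in> mod_hom TA (PP 0) Nq"
    proof (rule mod_homI)
      fix x y assume x: "x \<in> carrier (PP 0)" and y: "y \<in> carrier (PP 0)"
      have xy: "x \<oplus>\<^bsub>PP 0\<^esub> y \<in> carrier (PP 0)"
        by (rule module_add_closed[OF mP x y])
      have "qm I (rep (x \<oplus>\<^bsub>PP 0\<^esub> y)) = qm I (rep x + rep y)"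
        using mod_homD(2)[OF \<epsilon>(1) x y] unfolding rep[OF x] rep[OF y] rep[OF xy] q by simp
      then have "nf (rep (x \<oplus>\<^bsub>PP 0\<^esub> y)) = nf (rep x + rep y)" by (simp add: nf_eq qm_eq[OF I])
      then show "(\<lambda>_. nf (rep (x \<oplus>\<^bsub>PP 0\<^esub> y))) = (\<lambda>_. nf (rep x)) \<oplus>\<^bsub>Nq\<^esub> (\<lambda>_. nf (rep y))" by (simp add: Nq_simps)
    next
      fix c x assume x: "x \<in> carrier (PP 0)"
      have cx: "c \<odot>\<^bsub>PP 0\<^esub> x \<in> carrier (PP 0)" using module.smult_closed[OF mP, of c x 0] x by simp
      have "qm I (rep (c \<odot>\<^bsub>PP 0\<^esub> x)) = qm I (c * rep x)"
        using mod_homD(3)[OF \<epsilon>(1) _ x, of c] unfolding rep[OF x] rep[OF cx] q by simp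
      then have "nf (rep (c \<odot>\<^bsub>PP 0\<^esub> x)) = nf (c * rep x)" by (simp add: nf_eq qm_eq[OF I])
      then show "(\<lambda>_. nf (rep (c \<odot>\<^bsub>PP 0\<^esub> x))) = c \<odot>\<^bsub>Nq\<^esub> (\<lambda>_. nf (rep x))" by (simp add: Nq_simps)
    qed (simp add: Nq_simps)
    show ?thesis
      using pr[of 0, unfolded projective_module_def, THEN conjunct2, rule_format,
          of "frm (Fr N0)" Nq "\<lambda>v _. nf (e v)" "\<lambda>x _. nf (rep x)"]
        frm_module[OF submod_Fr, of N0] Nq_module p on f by blast
  qed
  then obtain \<beta>0 where \<beta>0: "\<beta>0 \<in> mod_hom TA (PP 0) (frm (Fr N0))"
    and "\<And>x. x \<in> carrier (PP 0) \<Longrightarrow> (\<lambda>_::nat. nf (e (\<beta>0 x))) = (\<lambda>_. nf (rep x))" by blast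
  then have "\<And>x. x \<in> carrier (PP 0) \<Longrightarrow> nf (e (\<beta>0 x)) = nf (rep x)" by (metis (no_types))
  then have \<beta>0e: "qm I (e (\<beta>0 x)) = \<epsilon> x" if "x \<in> carrier (PP 0)" for x
    using that unfolding rep[OF that] by (simp add: nf_eq qm_eq[OF I])
  define S0 where "S0 = {v \<in> Fr N0. e v \<in> I}"
  have S0: "submod S0" "D0 ` Fr N1 = S0"
    using lin1D[OF r(1)] tidealD(1-3)[OF I] r(5,9) by (auto simp: submod_def S0_def Fr_simps)
  have "(\<lambda>x. \<beta>0 (d 0 x)) \<in> mod_hom TA (PP (Suc 0)) (frm S0)"
  proof (rule mod_homI)
    fix x assume x: "x \<in> carrier (PP (Suc 0))"
    have "qm I (e (\<beta>0 (d 0 x))) = qm I 0" using \<beta>0e[OF mod_homD(1)[OF dh x]] ed0[OF x] by simp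
    then show "\<beta>0 (d 0 x) \<in> carrier (frm S0)"
      using mod_homD(1)[OF \<beta>0 mod_homD(1)[OF dh x]] by (simp add: S0_def qm_eq[OF I])
  qed (use mod_homD[OF \<beta>0] mod_homD[OF dh[of 0]] in simp_all)
  from projective_lift[OF pr r(2) S0 this] obtain \<beta>1 where \<beta>1: "\<beta>1 \<in> mod_hom TA (PP (Suc 0)) (frm (Fr N1))"
    "\<And>x. x \<in> carrier (PP (Suc 0)) \<Longrightarrow> D0 (\<beta>1 x) = \<beta>0 (d 0 x)" by blast
  define S1 where "S1 = {v \<in> Fr N1. D0 v = 0}"
  have "D1 ` Fr N2 = S1" using r(6,10) by (auto simp: S1_def)
  have z0: "\<beta>0 \<zero>\<^bsub>PP 0\<^esub> = 0" using mod_hom_zero[OF \<beta>0 mP frm_module[OF submod_Fr]] by simp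
  have "(\<lambda>x. \<beta>1 (d (Suc 0) x)) \<in> mod_hom TA (PP (Suc (Suc 0))) (frm S1)"
  proof (rule mod_homI)
    fix x assume x: "x \<in> carrier (PP (Suc (Suc 0)))"
    have "D0 (\<beta>1 (d (Suc 0) x)) = 0" using \<beta>1(2)[OF mod_homD(1)[OF dh x]] dd[OF x] z0 by simp
    then show "\<beta>1 (d (Suc 0) x) \<in> carrier (frm S1)"
      using mod_homD(1)[OF \<beta>1(1) mod_homD(1)[OF dh x]] by (simp add: S1_def)
  qed (use mod_homD[OF \<beta>1(1)] mod_homD[OF dh[of "Suc 0"]] in simp_all)
  from projective_lift[OF pr r(3) submod_ker[OF r(2) S1_def] \<open>D1 ` Fr N2 = S1\<close> this]
  obtain \<beta>2 where \<beta>2: "\<beta>2 \<in> mod_hom TA (PP (Suc (Suc 0))) (frm (Fr N2))"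
    "\<And>x. x \<in> carrier (PP (Suc (Suc 0))) \<Longrightarrow> D1 (\<beta>2 x) = \<beta>1 (d (Suc 0) x)" by blast
  \<comment> \<open>lifting the socle element through the given resolution gives a Koszul cycle in degree 2\<close>
  have P2inj: "x = \<zero>\<^bsub>PP (Suc (Suc 0))\<^esub>" if "x \<in> carrier (PP (Suc (Suc 0)))" "d (Suc 0) x = \<zero>\<^bsub>PP (Suc 0)\<^esub>" for x
  proof -
    have "\<exists>y\<in>carrier (PP (Suc (Suc (Suc 0)))). d (Suc (Suc 0)) y = x" by (rule ex[OF that])
    then obtain y where y: "y \<in> carrier (PP (Suc (Suc (Suc 0))))" "d (Suc (Suc 0)) y = x" by blast
    then have "y = \<zero>\<^bsub>PP (Suc (Suc (Suc 0)))\<^esub>" using P3 by (simp add: numeral_3_eq_3)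
    then show ?thesis using y(2) mod_hom_zero[OF dh mP mP] by metis
  qed
  let ?s = "WT tpm :: 'k ps3"
  have "qm I ?s \<in> \<epsilon> ` carrier (PP 0)" unfolding \<epsilon>(2) by (simp add: q)
  then obtain p0 where p0: "p0 \<in> carrier (PP 0)" "\<epsilon> p0 = qm I ?s" by auto
  have sc: "c \<odot>\<^bsub>PP i\<^esub> x \<in> carrier (PP i)" if "x \<in> carrier (PP i)" for c x i
    using module.smult_closed[OF mP, of c x i] that by simp
  have "\<exists>a\<in>carrier (PP (Suc 0)). d 0 a = v \<odot>\<^bsub>PP 0\<^esub> p0" if "ct v = 0" for v
  proof (rule ex0[OF sc[OF p0(1)]])
    have "\<epsilon> (v \<odot>\<^bsub>PP 0\<^esub> p0) = qm I (v * ?s)" using mod_homD(3)[OF \<epsilon>(1) _ p0(1), of v] unfolding p0(2) q by simp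
    then show "\<epsilon> (v \<odot>\<^bsub>PP 0\<^esub> p0) = qm I 0" using top_kill[OF that] by (simp add: qm_eq[OF I] del: WT.simps)
  qed
  then obtain a1 a2 a3 where a: "a1 \<in> carrier (PP (Suc 0))" "a2 \<in> carrier (PP (Suc 0))" "a3 \<in> carrier (PP (Suc 0))"
    "d 0 a1 = vX \<odot>\<^bsub>PP 0\<^esub> p0" "d 0 a2 = vY \<odot>\<^bsub>PP 0\<^esub> p0" "d 0 a3 = vZ \<odot>\<^bsub>PP 0\<^esub> p0"
    using ct_v by metis
  have "\<exists>b\<in>carrier (PP (Suc (Suc 0))). d (Suc 0) b = u \<odot>\<^bsub>PP (Suc 0)\<^esub> x \<ominus>\<^bsub>PP (Suc 0)\<^esub> v \<odot>\<^bsub>PP (Suc 0)\<^esub> y"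
    if xy: "x \<in> carrier (PP (Suc 0))" "y \<in> carrier (PP (Suc 0))" "d 0 x = v \<odot>\<^bsub>PP 0\<^esub> p0" "d 0 y = u \<odot>\<^bsub>PP 0\<^esub> p0" for u v x y
  proof (rule ex)
    interpret M1: module TA "PP (Suc 0)" by (rule mP)
    interpret M0: module TA "PP 0" by (rule mP)
    show "u \<odot>\<^bsub>PP (Suc 0)\<^esub> x \<ominus>\<^bsub>PP (Suc 0)\<^esub> v \<odot>\<^bsub>PP (Suc 0)\<^esub> y \<in> carrier (PP (Suc 0))" using xy sc by simp
    have "d 0 (u \<odot>\<^bsub>PP (Suc 0)\<^esub> x \<ominus>\<^bsub>PP (Suc 0)\<^esub> v \<odot>\<^bsub>PP (Suc 0)\<^esub> y) = u \<odot>\<^bsub>PP 0\<^esub> (v \<odot>\<^bsub>PP 0\<^esub> p0) \<ominus>\<^bsub>PP 0\<^esub> v \<odot>\<^bsub>PP 0\<^esub> (u \<odot>\<^bsub>PP 0\<^esub> p0)"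
      using mod_hom_minus[OF dh mP mP sc[OF xy(1)] sc[OF xy(2)]] mod_homD(3)[OF dh _ xy(1), of u] mod_homD(3)[OF dh _ xy(2), of v] xy(3,4) by simp
    also have "\<dots> = (u * v) \<odot>\<^bsub>PP 0\<^esub> p0 \<ominus>\<^bsub>PP 0\<^esub> (u * v) \<odot>\<^bsub>PP 0\<^esub> p0"
      using M0.smult_assoc1[of u v p0] M0.smult_assoc1[of v u p0] p0(1) by (simp add: mult.commute)
    also have "\<dots> = \<zero>\<^bsub>PP 0\<^esub>" using M0.M.r_neg[OF sc[OF p0(1)]] by (simp add: a_minus_def)
    finally show "d 0 (u \<odot>\<^bsub>PP (Suc 0)\<^esub> x \<ominus>\<^bsub>PP (Suc 0)\<^esub> v \<odot>\<^bsub>PP (Suc 0)\<^esub> y) = \<zero>\<^bsub>PP 0\<^esub>" .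
  qed
  note exb = this
  obtain b1 where b1: "b1 \<in> carrier (PP (Suc (Suc 0)))" "d (Suc 0) b1 = vY \<odot>\<^bsub>PP (Suc 0)\<^esub> a3 \<ominus>\<^bsub>PP (Suc 0)\<^esub> vZ \<odot>\<^bsub>PP (Suc 0)\<^esub> a2"
    using exb[OF a(3,2,6,5)] by blast
  obtain b2 where b2: "b2 \<in> carrier (PP (Suc (Suc 0)))" "d (Suc 0) b2 = vZ \<odot>\<^bsub>PP (Suc 0)\<^esub> a1 \<ominus>\<^bsub>PP (Suc 0)\<^esub> vX \<odot>\<^bsub>PP (Suc 0)\<^esub> a3"
    using exb[OF a(1,3,4,6)] by blast
  obtain b3 where b3: "b3 \<in> carrier (PP (Suc (Suc 0)))" "d (Suc 0) b3 = vX \<odot>\<^bsub>PP (Suc 0)\<^esub> a2 \<ominus>\<^bsub>PP (Suc 0)\<^esub> vY \<odot>\<^bsub>PP (Suc 0)\<^esub> a1"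
    using exb[OF a(2,1,5,4)] by blast
  \<comment> \<open>The last Koszul step: the differential of \<open>bb\<close> vanishes formally,
    and injectivity in degree 2 makes \<open>bb\<close> itself zero.\<close>
  define bb where "bb = vX \<odot>\<^bsub>PP (Suc (Suc 0))\<^esub> b1 \<oplus>\<^bsub>PP (Suc (Suc 0))\<^esub> (vY \<odot>\<^bsub>PP (Suc (Suc 0))\<^esub> b2 \<oplus>\<^bsub>PP (Suc (Suc 0))\<^esub> vZ \<odot>\<^bsub>PP (Suc (Suc 0))\<^esub> b3)"
  have bb: "bb = \<zero>\<^bsub>PP (Suc (Suc 0))\<^esub>"
  proof (rule P2inj)
    interpret M1: module TA "PP (Suc 0)" by (rule mP)
    interpret M2: module TA "PP (Suc (Suc 0))" by (rule mP)
    show "bb \<in> carrier (PP (Suc (Suc 0)))" unfolding bb_def using b1(1) b2(1) b3(1) sc by simp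
    have sd: "u \<odot>\<^bsub>PP (Suc 0)\<^esub> (v \<odot>\<^bsub>PP (Suc 0)\<^esub> x \<ominus>\<^bsub>PP (Suc 0)\<^esub> w \<odot>\<^bsub>PP (Suc 0)\<^esub> y)
       = (u * v) \<odot>\<^bsub>PP (Suc 0)\<^esub> x \<oplus>\<^bsub>PP (Suc 0)\<^esub> (\<ominus>\<^bsub>PP (Suc 0)\<^esub> ((u * w) \<odot>\<^bsub>PP (Suc 0)\<^esub> y))"
      if "x \<in> carrier (PP (Suc 0))" "y \<in> carrier (PP (Suc 0))" for u v w x y
      using M1.smult_r_distr[of u "v \<odot>\<^bsub>PP (Suc 0)\<^esub> x" "\<ominus>\<^bsub>PP (Suc 0)\<^esub> (w \<odot>\<^bsub>PP (Suc 0)\<^esub> y)"]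
        M1.smult_r_minus[of u "w \<odot>\<^bsub>PP (Suc 0)\<^esub> y"] M1.smult_assoc1[of u v x] M1.smult_assoc1[of u w y] sc that
      by (simp add: a_minus_def)
    have hd: "d (Suc 0) (u \<odot>\<^bsub>PP (Suc (Suc 0))\<^esub> x) = u \<odot>\<^bsub>PP (Suc 0)\<^esub> d (Suc 0) x" if "x \<in> carrier (PP (Suc (Suc 0)))" for u x
      using mod_homD(3)[OF dh _ that, of u] by simp
    have "d (Suc 0) bb = vX \<odot>\<^bsub>PP (Suc 0)\<^esub> d (Suc 0) b1 \<oplus>\<^bsub>PP (Suc 0)\<^esub> (vY \<odot>\<^bsub>PP (Suc 0)\<^esub> d (Suc 0) b2 \<oplus>\<^bsub>PP (Suc 0)\<^esub> vZ \<odot>\<^bsub>PP (Suc 0)\<^esub> d (Suc 0) b3)"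
      unfolding bb_def using mod_homD(2)[OF dh] b1(1) b2(1) b3(1) sc hd by simp
    also have "\<dots> = \<zero>\<^bsub>PP (Suc 0)\<^esub>"
    proof -
      define m1 m2 m3 where "m1 = (vX * vY) \<odot>\<^bsub>PP (Suc 0)\<^esub> a3" and "m2 = (vX * vZ) \<odot>\<^bsub>PP (Suc 0)\<^esub> a2" and "m3 = (vY * vZ) \<odot>\<^bsub>PP (Suc 0)\<^esub> a1"
      have m: "m1 \<in> carrier (PP (Suc 0))" "m2 \<in> carrier (PP (Suc 0))" "m3 \<in> carrier (PP (Suc 0))"
        unfolding m1_def m2_def m3_def using sc a by auto
      have mm: "m2 \<oplus>\<^bsub>PP (Suc 0)\<^esub> (m3 \<oplus>\<^bsub>PP (Suc 0)\<^esub> (\<ominus>\<^bsub>PP (Suc 0)\<^esub> m2 \<oplus>\<^bsub>PP (Suc 0)\<^esub> \<ominus>\<^bsub>PP (Suc 0)\<^esub> m3)) = \<zero>\<^bsub>PP (Suc 0)\<^esub>"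
        using M1.M.r_neg[OF M1.M.a_closed[OF m(2,3)]] m by (simp add: M1.M.minus_add M1.M.a_assoc)
      have "(m1 \<oplus>\<^bsub>PP (Suc 0)\<^esub> (\<ominus>\<^bsub>PP (Suc 0)\<^esub> m2)) \<oplus>\<^bsub>PP (Suc 0)\<^esub> ((m3 \<oplus>\<^bsub>PP (Suc 0)\<^esub> (\<ominus>\<^bsub>PP (Suc 0)\<^esub> m1)) \<oplus>\<^bsub>PP (Suc 0)\<^esub> (m2 \<oplus>\<^bsub>PP (Suc 0)\<^esub> (\<ominus>\<^bsub>PP (Suc 0)\<^esub> m3))) = \<zero>\<^bsub>PP (Suc 0)\<^esub>"
        using m mm by (simp add: M1.M.a_ac M1.M.r_neg M1.M.r_neg1 M1.M.r_neg2)
      then show ?thesis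
        unfolding b1(2) b2(2) b3(2) sd[OF a(3,2)] sd[OF a(1,3)] sd[OF a(2,1)] m1_def m2_def m3_def
        by (simp add: mult.commute)
    qed
    finally show "d (Suc 0) bb = \<zero>\<^bsub>PP (Suc 0)\<^esub>" .
  qed
  \<comment> \<open>the same computation in the free resolution, where the Koszul cycle is a boundary\<close>
  define q0 A1 A2 A3 B1 B2 B3 where "q0 = \<beta>0 p0" and "A1 = \<beta>1 a1" and "A2 = \<beta>1 a2" and "A3 = \<beta>1 a3"
    and "B1 = \<beta>2 b1" and "B2 = \<beta>2 b2" and "B3 = \<beta>2 b3"
  have mem: "q0 \<in> Fr N0" "A1 \<in> Fr N1" "A2 \<in> Fr N1" "A3 \<in> Fr N1" "B1 \<in> Fr N2" "B2 \<in> Fr N2" "B3 \<in> Fr N2"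
    using mod_homD(1)[OF \<beta>0 p0(1)] mod_homD(1)[OF \<beta>1(1) a(1)] mod_homD(1)[OF \<beta>1(1) a(2)] mod_homD(1)[OF \<beta>1(1) a(3)]
      mod_homD(1)[OF \<beta>2(1) b1(1)] mod_homD(1)[OF \<beta>2(1) b2(1)] mod_homD(1)[OF \<beta>2(1) b3(1)]
    by (simp_all add: q0_def A1_def A2_def A3_def B1_def B2_def B3_def)
  have b0s: "\<beta>0 (v \<odot>\<^bsub>PP 0\<^esub> p0) = sm v q0" for v
    using mod_homD(3)[OF \<beta>0 _ p0(1), of v] by (simp add: q0_def)
  have D0A: "D0 A1 = sm vX q0" "D0 A2 = sm vY q0" "D0 A3 = sm vZ q0"
    unfolding A1_def A2_def A3_def \<beta>1(2)[OF a(1)] \<beta>1(2)[OF a(2)] \<beta>1(2)[OF a(3)] a(4-6) by (rule b0s)+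
  have b1m: "\<beta>1 (u \<odot>\<^bsub>PP (Suc 0)\<^esub> x \<ominus>\<^bsub>PP (Suc 0)\<^esub> v \<odot>\<^bsub>PP (Suc 0)\<^esub> y) = sm u (\<beta>1 x) - sm v (\<beta>1 y)"
    if xy: "x \<in> carrier (PP (Suc 0))" "y \<in> carrier (PP (Suc 0))" for u v x y
  proof -
    interpret N1: module TA "frm (Fr N1) :: ('k ps3, nat \<Rightarrow> 'k ps3) module" by (rule frm_module[OF submod_Fr])
    have cl: "\<beta>1 x \<in> Fr N1" "\<beta>1 y \<in> Fr N1" using mod_homD(1)[OF \<beta>1(1)] xy by auto
    have "\<ominus>\<^bsub>frm (Fr N1)\<^esub> (sm v (\<beta>1 y)) = - sm v (\<beta>1 y)"
      using cl Fr_simps(3)[OF cl(2), of v] Fr_simps(4)[OF Fr_simps(1) Fr_simps(3)[OF cl(2), of v]]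
      by (intro N1.M.minus_equality) simp_all
    then show ?thesis
      using mod_hom_minus[OF \<beta>1(1) mP frm_module[OF submod_Fr] sc[OF xy(1), of u] sc[OF xy(2), of v]]
        mod_homD(3)[OF \<beta>1(1) _ xy(1), of u] mod_homD(3)[OF \<beta>1(1) _ xy(2), of v]
      by (simp add: a_minus_def)
  qed
  have D1B: "D1 B1 = sm vY A3 - sm vZ A2" "D1 B2 = sm vZ A1 - sm vX A3" "D1 B3 = sm vX A2 - sm vY A1"
    unfolding B1_def B2_def B3_def A1_def A2_def A3_def \<beta>2(2)[OF b1(1)] \<beta>2(2)[OF b2(1)] \<beta>2(2)[OF b3(1)] b1(2) b2(2) b3(2)
    by (rule b1m[OF a(3,2)], rule b1m[OF a(1,3)], rule b1m[OF a(2,1)])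
  have XB: "sm vX B1 + (sm vY B2 + sm vZ B3) = 0"
  proof -
    have "\<beta>2 bb = 0" using mod_hom_zero[OF \<beta>2(1) mP frm_module[OF submod_Fr]] bb by simp
    moreover have s2: "vY \<odot>\<^bsub>PP (Suc (Suc 0))\<^esub> b2 \<oplus>\<^bsub>PP (Suc (Suc 0))\<^esub> vZ \<odot>\<^bsub>PP (Suc (Suc 0))\<^esub> b3 \<in> carrier (PP (Suc (Suc 0)))"
      by (rule module_add_closed[OF mP sc[OF b2(1)] sc[OF b3(1)]])
    have "\<beta>2 bb = sm vX B1 + (sm vY B2 + sm vZ B3)"
      unfolding bb_def using mod_homD(2)[OF \<beta>2(1) sc[OF b1(1), of vX] s2] mod_homD(2)[OF \<beta>2(1) sc[OF b2(1), of vY] sc[OF b3(1), of vZ]]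
        mod_homD(3)[OF \<beta>2(1) _ b1(1), of vX] mod_homD(3)[OF \<beta>2(1) _ b2(1), of vY] mod_homD(3)[OF \<beta>2(1) _ b3(1), of vZ]
      by (simp add: B1_def B2_def B3_def)
    ultimately show ?thesis by simp
  qed
  have "\<exists>u v w. B1 i = vY * w - vZ * v \<and> B2 i = vZ * u - vX * w \<and> B3 i = vX * v - vY * u" for i
    using fun_cong[OF XB, of i] by (intro koszul_exact1) (simp add: add.assoc)
  then obtain C1 C2 C3 where C: "\<And>i. B1 i = vY * C3 i - vZ * C2 i" "\<And>i. B2 i = vZ * C1 i - vX * C3 i" "\<And>i. B3 i = vX * C2 i - vY * C1 i"
    by metis
  define E1 E2 E3 where "E1 = rs N2 C1" and "E2 = rs N2 C2" and "E3 = rs N2 C3"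
  have E: "B1 = sm vY E3 - sm vZ E2" "B2 = sm vZ E1 - sm vX E3" "B3 = sm vX E2 - sm vY E1"
    using mem(5-7) C by (auto simp: fun_eq_iff E1_def E2_def E3_def rs_def Fr_def)
  have Em: "E1 \<in> Fr N2" "E2 \<in> Fr N2" "E3 \<in> Fr N2" by (simp_all add: E1_def E2_def E3_def)
  \<comment> \<open>Subtracting the boundaries of the lifts \<open>E1\<close>, \<open>E2\<close>,
    \<open>E3\<close> leaves a triple on which the next Koszul equations hold exactly, so it is (x,
    y, z) times a vector.\<close>
  define H1 H2 H3 where "H1 = A1 - D1 E1" and "H2 = A2 - D1 E2" and "H3 = A3 - D1 E3"
  have "D1 B1 = sm vY (D1 E3) - sm vZ (D1 E2)" "D1 B2 = sm vZ (D1 E1) - sm vX (D1 E3)" "D1 B3 = sm vX (D1 E2) - sm vY (D1 E1)"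
    unfolding E using linD(2,3)[OF r(3)] Em Fr_simps(3) by metis+
  then have H: "sm vY H3 - sm vZ H2 = 0" "sm vZ H1 - sm vX H3 = 0" "sm vX H2 - sm vY H1 = 0"
    using D1B unfolding H1_def H2_def H3_def sm_diff by (auto simp: algebra_simps)
  have "\<exists>q. H1 i = vX * q \<and> H2 i = vY * q \<and> H3 i = vZ * q" for i
    by (rule koszul_exact2) (use fun_cong[OF H(1), of i] fun_cong[OF H(2), of i] fun_cong[OF H(3), of i] in simp_all)
  then obtain K where K: "\<And>i. H1 i = vX * K i" by metis
  have Hm: "H1 \<in> Fr N1" unfolding H1_def by (intro Fr_simps(4) mem r(6) Em)
  have HK: "H1 = sm vX (rs N1 K)" using K Hm by (auto simp: fun_eq_iff rs_def Fr_def)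
  have "D0 (D1 E1) = 0" using r(10)[OF r(6)[OF Em(1)]] Em(1) by blast
  moreover have "D0 H1 = D0 A1 - D0 (D1 E1)" unfolding H1_def by (rule linD(3)[OF r(2) mem(2) r(6)[OF Em(1)]])
  ultimately have "sm vX (D0 (rs N1 K)) = sm vX q0"
    using D0A(1) linD(2)[OF r(2) rs_Fr, of vX K] HK by simp
  \<comment> \<open>Cancelling x in each coordinate shows that the lift of s is a boundary, which
    would put s into \<open>I\<close>.\<close>
  then have "q0 = D0 (rs N1 K)" by (auto simp: fun_eq_iff)
  then have "e q0 \<in> I" using r(9)[OF mem(1)] rs_Fr by blast
  moreover have "qm I (e q0) = qm I ?s" using \<beta>0e[OF p0(1)] p0(2) by (simp add: q0_def)
  then have "e q0 - ?s \<in> I" by (simp add: qm_eq[OF I] del: WT.simps)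
  ultimately have "?s \<in> I" using tidealD(6)[OF I, of "e q0" "e q0 - ?s"] by (simp del: WT.simps)
  from LT_I[OF this tpm_Lam] show False by (simp add: LT_WT del: WT.simps LT.simps)
qed

lemma proj_dim_3: "proj_dim TA (quotient_module TA I) = 3"
proof -
  let ?S = "{enat n | n. \<exists>PP d \<epsilon>. projective_resolution TA (quotient_module TA I) PP d \<epsilon> \<and>
                              (\<forall>i>n. carrier (PP i) = {\<zero>\<^bsub>PP i\<^esub>})}"
  obtain N0 N1 N2 N3 e D0 D1 D2 where fr: "free_res I N0 N1 N2 N3 e D0 D1 D2"
    using free_res_IL[OF finite_Lam order_closed_Lam, where 'k = 'k] unfolding I_eq by blast
  have "enat 3 \<in> ?S" using proj_dim_le_3[OF I fr] by blast
  moreover have "enat 3 \<le> x" if "x \<in> ?S" for x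
  proof -
    from that obtain n PP d \<epsilon> where n: "x = enat n" "projective_resolution TA (quotient_module TA I) PP d \<epsilon>"
      "\<forall>i>n. carrier (PP i) = {\<zero>\<^bsub>PP i\<^esub>}" by blast
    have "\<not> n < 3"
    proof
      assume "n < 3"
      then have "carrier (PP 3) = {\<zero>\<^bsub>PP 3\<^esub>}" using n(3) by blast
      then show False by (rule proj_dim_ge_3[OF n(2)])
    qed
    then show ?thesis using n(1) by simp
  qed
  ultimately have "Inf ?S = enat 3" by (intro antisym Inf_lower Inf_greatest)
  then show ?thesis unfolding proj_dim_def by (simp add: numeral_eq_enat)
qed

end

theorem theorem1p1:
  fixes r :: nat
  assumes "r \<ge> 3"
  shows "\<exists>I. ideal I (power_series_3 :: 'k::field fps fps fps ring) \<and>
             class_G (power_series_3 :: 'k fps fps fps ring) I r \<and>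
             \<not> gorenstein_local_ring ((power_series_3 :: 'k fps fps fps ring) Quot I)"
proof -
  \<comment> \<open>\<open>be\<close> is the parity of \<open>r\<close>, and \<open>k\<close> is
    solved from r = 2 k - 2 - be; the bound r >= 3 gives k >= 3.\<close>
  define be where "be = r mod 2"
  define k where "k = (r + be + 2) div 2"
  have kb: "3 \<le> k" "be \<le> 1" "2 * k - 2 - be = r"
    using assms by (cases "even r"; auto simp: k_def be_def elim!: evenE oddE)+
  define I where "I = (IL (Lam k be) :: 'k ps3 set)"
  have oc: "order_closed (Lam k be)"
    unfolding order_closed_def Lam_def LamG_def sig_def using kb by auto
  have tI: "tideal I" unfolding I_def using oc by (auto simp: tideal_def intro: IL_add IL_mult)
  interpret trim I k be
  proof
    show "tideal I" by (rule tI)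
    show "ordge 2 f" if "f \<in> I" for f
    proof (rule L_ordge)
      fix a b c :: nat assume "a + b + c < 2"
      then have "(a, b, c) \<in> Lam k be" using kb(1) by (simp add: Lam_def LamG_def)
      then have "LT (a, b, c) f = 0" using that unfolding I_def IL_def by blast
      then show "L a b c f = 0" by simp
    qed
  qed (use kb I_def in auto)
  have "ideal I TA" by (simp add: ideal_TA tI)
  moreover have "class_G TA I r" using class_G_trim[OF proj_dim_3] kb(3) by simp
  ultimately show ?thesis using not_gorenstein unfolding power_series_3_def by blast
qed

end
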